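(* Let $F_\epsilon$ be a family of polynomial diffeomorphisms of $\mathbf C^2$ varying analytically in $\epsilon$ near $0\in\mathbf C$. Suppose that $F_\epsilon$ is conjugate to a composition of generalized Hénon maps, and that $F_\epsilon$ is normalized near the fixed point $O$ of $F_0$ as $$F_\epsilon(x,y)=\left(x+(x^2+\epsilon^2)\alpha_\epsilon(x,y),\ b_\epsilon(x)y+(x^2+\epsilon^2)\beta_\epsilon(x,y)\right),$$ with $\alpha_\epsilon=1+(q+1)x+ry+O(|x|^2+|y|^2+|\epsilon|^2)$ and $b_0(0)=b$, $0<|b|<1$. Let $\alpha\in\mathbf C$. If $\{\epsilon_j\}$ is an $\alpha$-sequence, then $$\mathcal B\cap\limsup_{j\to\infty}K^+(F_{\epsilon_j})\subset K^+(F_0,T_\alpha).$$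
   Context: The displayed form of $F_\epsilon$ holds in local holomorphic coordinates at $O=(0,0)$; $q,r\in\mathbf C$ are constants. A generalized Hénon map is a map $(x,y)\mapsto(y,P(y)-\delta x)$ of $\mathbf C^2$ with $P$ a polynomial of degree at least $2$ and $\delta\neq0$. $\{\epsilon_j\}$ is an $\alpha$-sequence if $\epsilon_j\to0$ and there are positive integers $n_j\to\infty$ with $n_j-\pi/\epsilon_j\to\alpha$. $\mathcal B$ is the set of points having a neighborhood on which $F_0^n$ converges uniformly to $O$ as $n\to\infty$. $\Sigma=\{p\neq O: F_0^{-n}(p)\to O \text{ as } n\to\infty\}$, a Riemann surface equivalent to $\mathbf C$. With principal logarithms put $w^\iota(x,y)=-\frac1x-q\log(-x)$, $w^o(x,y)=-\frac1x-q\log(x)$. The Fatou coordinates are $\varphi^\iota:\mathcal B\to\mathbf C$, $\varphi^\iota(p)=\lim_{n\to\infty}(w^\iota(F_0^n(p))-n)$, and $\varphi^o:\Sigma\to\mathbf C$, $\varphi^o(p)=\lim_{n\to\infty}(w^o(F_0^{-n}(p))+n)$; these limits exist and are holomorphic, and $\varphi^o$ is a bijection onto $\mathbf C$. With $\tau_\alpha(\zeta)=\zeta+\alpha$, set $T_\alpha=(\varphi^o)^{-1}\circ\tau_\alpha\circ\varphi^\iota:\mathcal B\to\Sigma$. $K^+(F)$ is the set of points with bounded forward $F$-orbit. $K^+(F_0,T_\alpha)$ is the set of points $p\in K^+(F_0)$ satisfying one of: (i) $T_\alpha^n(p)$ is defined and belongs to $\mathcal B$ for all $n\ge0$; (ii)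 there is an integer $n\ge0$ such that $T_\alpha^k(p)\in\mathcal B$ for $0\le k\le n-1$ and $T_\alpha^n(p)\in K^+(F_0)\setminus\mathcal B$. For closed sets $X_j$, $\limsup_j X_j$ is the set of points each of whose neighborhoods meets $X_j$ for infinitely many $j$.
   Formalization: "Conjugate to a composition of generalized Hénon maps" is required of the family: number and degrees of the factors are constant in ε, and factors and conjugacy vary continuously in ε; if the degree may drop at ε=0 the inclusion fails. *)

theory Defs
  imports "HOL-Complex_Analysis.Complex_Analysis" "HOL-Library.Landau_Symbols"
begin

section \<open>Holomorphic functions of two and three complex variables\<close>

text \<open>
  Holomorphy is Frechet differentiability with a complex-linear derivative.
  The sets \<open>S\<close> below are always open in the uses that follow.
\<close>

definition holo2_on :: "(complex \<times> complex \<Rightarrow> complex) \<Rightarrow> (complex \<times> complex) set \<Rightarrow> bool" where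
  "holo2_on f S \<longleftrightarrow>
     (\<forall>p\<in>S. \<exists>a b. (f has_derivative (\<lambda>(h, k). a * h + b * k)) (at p))"

definition holo3_on ::
  "(complex \<times> complex \<times> complex \<Rightarrow> complex) \<Rightarrow> (complex \<times> complex \<times> complex) set \<Rightarrow> bool" where
  "holo3_on f S \<longleftrightarrow>
     (\<forall>p\<in>S. \<exists>a b c. (f has_derivative (\<lambda>(g, h, k). a * g + b * h + c * k)) (at p))"

definition holo2_map_on ::
  "(complex \<times> complex \<Rightarrow> complex \<times> complex) \<Rightarrow> (complex \<times> complex) set \<Rightarrow> bool" where
  "holo2_map_on f S \<longleftrightarrow> holo2_on (fst \<circ> f) S \<and> holo2_on (snd \<circ> f) S"

definition holo_family_on ::
  "(complex \<Rightarrow> complex \<times> complex \<Rightarrow> complex \<times> complex) \<Rightarrow> complex set \<Rightarrow> (complex \<times> complex) set \<Rightarrow> bool" where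
  "holo_family_on f D S \<longleftrightarrow>
     holo3_on (\<lambda>(\<epsilon>, p). fst (f \<epsilon> p)) (D \<times> S) \<and> holo3_on (\<lambda>(\<epsilon>, p). snd (f \<epsilon> p)) (D \<times> S)"


section \<open>Polynomial diffeomorphisms and generalized Henon maps\<close>

definition polynomial_fun :: "(complex \<times> complex \<Rightarrow> complex) \<Rightarrow> bool" where
  "polynomial_fun f \<longleftrightarrow>
     (\<exists>(N::nat) c. \<forall>x y. f (x, y) = (\<Sum>i\<le>N. \<Sum>j\<le>N. c i j * x ^ i * y ^ j))"

definition polynomial_map :: "(complex \<times> complex \<Rightarrow> complex \<times> complex) \<Rightarrow> bool" where
  "polynomial_map f \<longleftrightarrow> polynomial_fun (fst \<circ> f) \<and> polynomial_fun (snd \<circ> f)"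

definition polynomial_diffeo :: "(complex \<times> complex \<Rightarrow> complex \<times> complex) \<Rightarrow> bool" where
  "polynomial_diffeo f \<longleftrightarrow> bij f \<and> polynomial_map f \<and> polynomial_map (inv f)"

definition henon :: "complex poly \<Rightarrow> complex \<Rightarrow> complex \<times> complex \<Rightarrow> complex \<times> complex" where
  "henon P \<delta> = (\<lambda>(x, y). (y, poly P y - \<delta> * x))"

text \<open>
  The family \<open>F\<close> is conjugate, by polynomial diffeomorphisms, to a family of compositions of
  \<open>m \<ge> 1\<close> generalized Henon maps. This is a condition on the family and not on each member
  separately: the number and the degrees of the factors do not depend on the parameter, and the
  factors and the conjugacy depend continuously on it. (If, say, the degree were allowed to drop
  at \<open>\<epsilon> = 0\<close>, then \<open>K_plus (F \<epsilon>)\<close> would not be upper semicontinuous at \<open>0\<close>.)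
\<close>

definition conj_to_henon_composition ::
  "complex set \<Rightarrow> (complex \<Rightarrow> complex \<times> complex \<Rightarrow> complex \<times> complex) \<Rightarrow> bool" where
  "conj_to_henon_composition D F \<longleftrightarrow>
     (\<exists>(m::nat) (d :: nat \<Rightarrow> nat) (P :: nat \<Rightarrow> complex \<Rightarrow> complex poly)
        (\<delta> :: nat \<Rightarrow> complex \<Rightarrow> complex) \<psi>.
        1 \<le> m \<and>
        (\<forall>i<m. 2 \<le> d i \<and>
           (\<forall>\<epsilon>\<in>D. degree (P i \<epsilon>) = d i \<and> \<delta> i \<epsilon> \<noteq> 0) \<and>
           (\<forall>k. continuous_on D (\<lambda>\<epsilon>. coeff (P i \<epsilon>) k)) \<and>
           continuous_on D (\<delta> i)) \<and>
        (\<forall>\<epsilon>\<in>D. polynomial_diffeo (\<psi> \<epsilon>)) \<and>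
        continuous_on (D \<times> UNIV) (\<lambda>(\<epsilon>, p). \<psi> \<epsilon> p) \<and>
        (\<forall>\<epsilon>\<in>D. F \<epsilon> =
           inv (\<psi> \<epsilon>) \<circ> foldr (\<circ>) (map (\<lambda>i. henon (P i \<epsilon>) (\<delta> i \<epsilon>)) [0..<m]) id \<circ> \<psi> \<epsilon>))"


section \<open>The local normal form\<close>

text \<open>
  \<open>\<Phi> \<epsilon>\<close> are local holomorphic coordinates on the neighborhood \<open>U\<close> of \<open>z\<^sub>0\<close> in \<open>\<complex>\<^sup>2\<close>, centered at
  \<open>z\<^sub>0\<close> for \<open>\<epsilon> = 0\<close> and depending analytically on the parameter. (A family unfolding a
  semi-parabolic fixed point is brought to the normal form below by coordinates that move with
  \<open>\<epsilon>\<close>.)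
\<close>

definition local_coordinates ::
  "complex set \<Rightarrow> (complex \<times> complex) set \<Rightarrow> complex \<times> complex \<Rightarrow>
   (complex \<Rightarrow> complex \<times> complex \<Rightarrow> complex \<times> complex) \<Rightarrow> bool" where
  "local_coordinates D U z\<^sub>0 \<Phi> \<longleftrightarrow>
     open U \<and> z\<^sub>0 \<in> U \<and> \<Phi> 0 z\<^sub>0 = (0, 0) \<and> holo_family_on \<Phi> D U \<and>
     (\<forall>\<epsilon>\<in>D. inj_on (\<Phi> \<epsilon>) U \<and> open (\<Phi> \<epsilon> ` U) \<and>
        holo2_map_on (inv_into U (\<Phi> \<epsilon>)) (\<Phi> \<epsilon> ` U))"

text \<open>
  Here \<open>a (\<epsilon>, x, y)\<close>, \<open>\<beta> (\<epsilon>, x, y)\<close> and \<open>c (\<epsilon>, x)\<close> are the functions \<open>\<alpha>\<^sub>\<epsilon>(x,y)\<close>, \<open>\<beta>\<^sub>\<epsilon>(x,y)\<close> and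
  \<open>b\<^sub>\<epsilon>(x)\<close> of the normal form.
\<close>

definition normalized_family ::
  "complex set \<Rightarrow> (complex \<times> complex) set \<Rightarrow>
   (complex \<Rightarrow> complex \<times> complex \<Rightarrow> complex \<times> complex) \<Rightarrow>
   (complex \<Rightarrow> complex \<times> complex \<Rightarrow> complex \<times> complex) \<Rightarrow>
   complex \<Rightarrow> complex \<Rightarrow> complex \<Rightarrow> bool" where
  "normalized_family D U \<Phi> F q r b \<longleftrightarrow>
     (\<exists>a \<beta> c.
        holo3_on a (SIGMA \<epsilon>:D. \<Phi> \<epsilon> ` U) \<and>
        holo3_on \<beta> (SIGMA \<epsilon>:D. \<Phi> \<epsilon> ` U) \<and>
        holo2_on c (SIGMA \<epsilon>:D. fst ` \<Phi> \<epsilon> ` U) \<and>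
        (\<lambda>(\<epsilon>, x, y). a (\<epsilon>, x, y) - (1 + (q + 1) * x + r * y))
          \<in> O[nhds (0, 0, 0)](\<lambda>(\<epsilon>, x, y). of_real ((norm x)\<^sup>2 + (norm y)\<^sup>2 + (norm \<epsilon>)\<^sup>2)) \<and>
        c (0, 0) = b \<and>
        (\<forall>\<epsilon>\<in>D. \<forall>p\<in>U. F \<epsilon> p \<in> U \<longrightarrow>
           (\<forall>x y. \<Phi> \<epsilon> p = (x, y) \<longrightarrow>
              \<Phi> \<epsilon> (F \<epsilon> p) =
                (x + (x\<^sup>2 + \<epsilon>\<^sup>2) * a (\<epsilon>, x, y), c (\<epsilon>, x) * y + (x\<^sup>2 + \<epsilon>\<^sup>2) * \<beta> (\<epsilon>, x, y)))))"


section \<open>Basin, asymptotic curve and Fatou coordinates of the semi-parabolic map\<close>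

definition parabolic_basin ::
  "(complex \<times> complex \<Rightarrow> complex \<times> complex) \<Rightarrow> complex \<times> complex \<Rightarrow> (complex \<times> complex) set" where
  "parabolic_basin f z\<^sub>0 =
     {p. \<exists>V. open V \<and> p \<in> V \<and> uniform_limit V (\<lambda>n. f ^^ n) (\<lambda>_. z\<^sub>0) sequentially}"

definition asymptotic_curve ::
  "(complex \<times> complex \<Rightarrow> complex \<times> complex) \<Rightarrow> complex \<times> complex \<Rightarrow> (complex \<times> complex) set" where
  "asymptotic_curve f z\<^sub>0 = {p. p \<noteq> z\<^sub>0 \<and> (\<lambda>n. (inv f ^^ n) p) \<longlonglongrightarrow> z\<^sub>0}"

definition w_in :: "complex \<Rightarrow> complex \<times> complex \<Rightarrow> complex" where
  "w_in q = (\<lambda>(x, y). - 1 / x - q * Ln (- x))"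

definition w_out :: "complex \<Rightarrow> complex \<times> complex \<Rightarrow> complex" where
  "w_out q = (\<lambda>(x, y). - 1 / x - q * Ln x)"

text \<open>
  In the next three definitions \<open>\<phi>\<close> is the coordinate chart at the fixed point; only its values
  near \<open>z\<^sub>0\<close> matter for the limits.
\<close>

definition fatou_in ::
  "(complex \<times> complex \<Rightarrow> complex \<times> complex) \<Rightarrow> (complex \<times> complex \<Rightarrow> complex \<times> complex) \<Rightarrow>
   complex \<Rightarrow> complex \<times> complex \<Rightarrow> complex" where
  "fatou_in f \<phi> q p = lim (\<lambda>n. w_in q (\<phi> ((f ^^ n) p)) - of_nat n)"

definition fatou_out ::
  "(complex \<times> complex \<Rightarrow> complex \<times> complex) \<Rightarrow> (complex \<times> complex \<Rightarrow> complex \<times> complex) \<Rightarrow>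
   complex \<Rightarrow> complex \<times> complex \<Rightarrow> complex" where
  "fatou_out f \<phi> q p = lim (\<lambda>n. w_out q (\<phi> ((inv f ^^ n) p)) + of_nat n)"

text \<open>Meaningful on \<open>parabolic_basin f z\<^sub>0\<close>.\<close>

definition lavaurs_map ::
  "(complex \<times> complex \<Rightarrow> complex \<times> complex) \<Rightarrow> complex \<times> complex \<Rightarrow>
   (complex \<times> complex \<Rightarrow> complex \<times> complex) \<Rightarrow> complex \<Rightarrow> complex \<Rightarrow>
   complex \<times> complex \<Rightarrow> complex \<times> complex" where
  "lavaurs_map f z\<^sub>0 \<phi> q \<alpha> p =
     inv_into (asymptotic_curve f z\<^sub>0) (fatou_out f \<phi> q) (fatou_in f \<phi> q p + \<alpha>)"


section \<open>Filled Julia sets and limits of sets\<close>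

definition K_plus :: "(complex \<times> complex \<Rightarrow> complex \<times> complex) \<Rightarrow> (complex \<times> complex) set" where
  "K_plus f = {p. bounded (range (\<lambda>n. (f ^^ n) p))}"

text \<open>
  \<open>B\<close> is the domain of the partial map \<open>T\<close>, so \<open>(T ^^ n) p\<close> is defined exactly if
  \<open>(T ^^ k) p \<in> B\<close> for all \<open>k < n\<close>.
\<close>

definition K_plus_T ::
  "(complex \<times> complex \<Rightarrow> complex \<times> complex) \<Rightarrow> (complex \<times> complex) set \<Rightarrow>
   (complex \<times> complex \<Rightarrow> complex \<times> complex) \<Rightarrow> (complex \<times> complex) set" where
  "K_plus_T f B T =
     {p \<in> K_plus f.
        (\<forall>n. (T ^^ n) p \<in> B) \<or>
        (\<exists>n. (\<forall>k<n. (T ^^ k) p \<in> B) \<and> (T ^^ n) p \<in> K_plus f - B)}"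

definition limsup_sets :: "(nat \<Rightarrow> 'a::topological_space set) \<Rightarrow> 'a set" where
  "limsup_sets X = {p. \<forall>V. open V \<and> p \<in> V \<longrightarrow> infinite {j. V \<inter> X j \<noteq> {}}}"

definition alpha_sequence :: "complex \<Rightarrow> (nat \<Rightarrow> complex) \<Rightarrow> bool" where
  "alpha_sequence \<alpha> \<epsilon> \<longleftrightarrow>
     (\<forall>j. \<epsilon> j \<noteq> 0) \<and> \<epsilon> \<longlonglongrightarrow> 0 \<and>
     (\<exists>n :: nat \<Rightarrow> nat. (\<forall>j. 0 < n j) \<and> filterlim n at_top sequentially \<and>
        (\<lambda>j. of_nat (n j) - of_real pi / \<epsilon> j) \<longlonglongrightarrow> \<alpha>)"

end

theory Submission
  imports Defs "HOL-Real_Asymp.Real_Asymp"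
begin

text \<open>
  The theorem follows from two facts: \<open>K\<^sup>+\<close> is upper semicontinuous at \<open>\<epsilon> = 0\<close>, and for \<open>p\<close> in the
  basin and \<open>p\<^sub>j \<longlonglongrightarrow> p\<close> the points \<open>F\<^bsub>\<epsilon>\<^sub>j\<^esub>\<^bsup>n\<^sub>j\<^esup>(p\<^sub>j)\<close> accumulate at \<open>T\<^sub>\<alpha>(p)\<close>. As \<open>K\<^sup>+\<close> of
  each map is invariant, \<open>T\<^sub>\<alpha>\<close> then maps the basin part of \<open>limsup K\<^sup>+\<close> into \<open>limsup K\<^sup>+\<close>.

  For the second fact write \<open>x = - \<epsilon> cot (\<epsilon> s)\<close> near the fixed point. The first coordinate of the map
  becomes \<open>s \<mapsto> s + 1 + q x + r y + O(\<bar>x\<bar>\<^sup>2 + \<bar>y\<bar>\<^sup>2 + \<bar>\<epsilon>\<bar>\<^sup>2)\<close>, and \<open>v = s + q Ln (sin (\<epsilon> s) / \<epsilon>)\<close> moves by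
  \<open>1\<close> up to summable errors, since \<open>y = O(\<bar>x\<^sup>2 + \<epsilon>\<^sup>2\<bar>)\<close>. As \<open>\<epsilon> \<longlonglongrightarrow> 0\<close>, \<open>v\<close> tends to \<open>w\<^sup>\<iota>\<close> on the incoming side and
  \<open>v - \<pi>/\<epsilon>\<close> to \<open>w\<^sup>o\<close> on the outgoing side. Hence a limit \<open>Q\<close> of \<open>F\<^bsub>\<epsilon>\<^sub>j\<^esub>\<^bsup>n\<^sub>j\<^esup>(p\<^sub>j)\<close> lies on \<open>\<Sigma>\<close>
  with \<open>\<phi>\<^sup>o(Q) = \<phi>\<^sup>\<iota>(p) + \<alpha>\<close>, and injectivity of \<open>\<phi>\<^sup>o\<close> identifies \<open>Q\<close> with \<open>T\<^sub>\<alpha>(p)\<close>.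
\<close>


section \<open>Filtration for compositions of Henon maps\<close>

text \<open>The transit lasts about \<pi>/\<epsilon>_j steps, so continuity of a fixed number of
  iterates says nothing about it. The estimates cover only the times from M to n_j - M, with
  constants independent of j and of M, and the transit coordinate is then off by O(1/M). First j
  grows with M fixed: the M iterates at either end converge. Then M grows. The control of s is a
  bootstrap. The bounds on x and y presuppose that s is close to the time k; the errors that they
  give are summable, and s differs from v only by a logarithm, which is small against the distance
  of k from the two ends. An \<alpha>-sequence keeps \<pi>/\<epsilon>_j within bounded distance of
  large positive integers. Hence \<epsilon>_j is nearly real, and \<epsilon>s stays near the real
  interval (0, \<pi>), at a distance from its ends at which the sine is under control. The charts
  move with \<epsilon>, and their inverses are controlled only for each \<epsilon> separately. A
  compact neighborhood of the fixed point therefore takes over the task of recognizing points near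
  it by their coordinates.\<close>

definition escape_region :: "real \<Rightarrow> (complex \<times> complex) set" where
  "escape_region R = {p. max R (norm (fst p)) < norm (snd p)}"

text \<open>\<open>escape_region R\<close> is the set V^+ of the usual Henon filtration. The second
  clause is conditioned on the image lying outside V^+, because this is what a Henon map controls:
  the first coordinate of the image is an old coordinate, and the second is then at most the maximum
  of R and the first. By the first clause the point itself is outside as well, so both clauses
  survive composition with the same R.\<close>

definition filtrated :: "real \<Rightarrow> (complex \<times> complex \<Rightarrow> complex \<times> complex) \<Rightarrow> bool" where
  "filtrated R H \<longleftrightarrow>
     (\<forall>p\<in>escape_region R. H p \<in> escape_region R \<and> 2 * norm (snd p) \<le> norm (snd (H p))) \<and>
     (\<forall>p. H p \<notin> escape_region R \<longrightarrow>
        max (norm (fst (H p))) (norm (snd (H p))) \<le> max R (max (norm (fst p)) (norm (snd p))))"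

lemma open_escape_region: "open (escape_region R)"
  unfolding escape_region_def by (intro open_Collect_less continuous_intros)

lemma filtrated_comp:
  assumes "filtrated R G" "filtrated R H"
  shows "filtrated R (G \<circ> H)"
  unfolding filtrated_def
proof (intro conjI ballI allI impI)
  fix p assume p: "p \<in> escape_region R"
  have 1: "H p \<in> escape_region R" "2 * norm (snd p) \<le> norm (snd (H p))"
    using assms(2) p by (auto simp: filtrated_def)
  have 2: "G (H p) \<in> escape_region R" "2 * norm (snd (H p)) \<le> norm (snd (G (H p)))"
    using assms(1) 1 by (auto simp: filtrated_def)
  show "(G \<circ> H) p \<in> escape_region R" using 2 by simp
  show "2 * norm (snd p) \<le> norm (snd ((G \<circ> H) p))"
    using 1 2 norm_ge_zero[of "snd p"] unfolding o_def by linarith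
next
  fix p assume p: "(G \<circ> H) p \<notin> escape_region R"
  then have 1: "H p \<notin> escape_region R"
    using assms(1) by (auto simp: filtrated_def)
  have "max (norm (fst (G (H p)))) (norm (snd (G (H p))))
      \<le> max R (max (norm (fst (H p))) (norm (snd (H p))))"
    using assms(1) p unfolding filtrated_def o_def by blast
  moreover have "max (norm (fst (H p))) (norm (snd (H p))) \<le> max R (max (norm (fst p)) (norm (snd p)))"
    using assms(2) 1 unfolding filtrated_def by blast
  ultimately show "max (norm (fst ((G \<circ> H) p))) (norm (snd ((G \<circ> H) p)))
      \<le> max R (max (norm (fst p)) (norm (snd p)))"
    unfolding o_def by linarith
qed

text \<open>The list is nonempty because the identity does not double anything.\<close>

lemma filtrated_foldr:
  assumes "hs \<noteq> []" "\<And>h. h \<in> set hs \<Longrightarrow> filtrated R h"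
  shows "filtrated R (foldr (\<circ>) hs id)"
  using assms by (induction hs rule: list_nonempty_induct) (auto intro: filtrated_comp)

text \<open>An orbit that meets the region keeps doubling its second coordinate; one that avoids it
  never exceeds the maximum of R and its start. Boundedness thus becomes a condition on single
  iterates, with a threshold R independent of the orbit.\<close>

lemma filtrated_bounded_orbit_iff:
  assumes "filtrated R H"
  shows "bounded (range (\<lambda>n. (H ^^ n) p)) \<longleftrightarrow> (\<forall>n. (H ^^ n) p \<notin> escape_region R)"
proof
  assume bdd: "bounded (range (\<lambda>n. (H ^^ n) p))"
  show "\<forall>n. (H ^^ n) p \<notin> escape_region R"
  proof (intro allI notI)
    fix n assume n: "(H ^^ n) p \<in> escape_region R"
    have pos: "0 < norm (snd ((H ^^ n) p))"
      using n unfolding escape_region_def by (auto intro: le_less_trans[OF norm_ge_zero])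
    have *: "(H ^^ (k + n)) p \<in> escape_region R \<and>
      2 ^ k * norm (snd ((H ^^ n) p)) \<le> norm (snd ((H ^^ (k + n)) p))" for k
    proof (induction k)
      case (Suc k)
      define z where "z = (H ^^ (k + n)) p"
      have z: "z \<in> escape_region R" "2 ^ k * norm (snd ((H ^^ n) p)) \<le> norm (snd z)"
        using Suc unfolding z_def by auto
      have "H z \<in> escape_region R" "2 * norm (snd z) \<le> norm (snd (H z))"
        using assms z(1) unfolding filtrated_def by blast+
      moreover have "(H ^^ (Suc k + n)) p = H z" unfolding z_def by simp
      ultimately show ?case using z(2) by simp
    qed (use n in simp)
    obtain B where B: "\<And>k. norm ((H ^^ k) p) \<le> B"
      using bdd unfolding bounded_iff by auto
    obtain k where k: "B / norm (snd ((H ^^ n) p)) < 2 ^ k"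
      using real_arch_pow[of 2] by auto
    have "B < 2 ^ k * norm (snd ((H ^^ n) p))" using k pos by (simp add: field_simps)
    also have "\<dots> \<le> norm (snd ((H ^^ (k + n)) p))" using * by blast
    also have "\<dots> \<le> norm ((H ^^ (k + n)) p)" using norm_snd_le[of "snd z" "fst z" for z] by (metis prod.collapse)
    also have "\<dots> \<le> B" by (rule B)
    finally show False by simp
  qed
next
  assume notin: "\<forall>n. (H ^^ n) p \<notin> escape_region R"
  define c where "c = max R (max (norm (fst p)) (norm (snd p)))"
  have *: "max (norm (fst ((H ^^ n) p))) (norm (snd ((H ^^ n) p))) \<le> c" for n
  proof (induction n)
    case (Suc n)
    have "max (norm (fst ((H ^^ Suc n) p))) (norm (snd ((H ^^ Suc n) p)))
        \<le> max R (max (norm (fst ((H ^^ n) p))) (norm (snd ((H ^^ n) p))))"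
      using assms notin[rule_format, of "Suc n"] unfolding filtrated_def funpow.simps o_def by blast
    then show ?case using Suc unfolding c_def by linarith
  qed (simp add: c_def)
  show "bounded (range (\<lambda>n. (H ^^ n) p))"
  proof (rule boundedI[where B = "2 * c"])
    fix z assume "z \<in> range (\<lambda>n. (H ^^ n) p)"
    then obtain n where z: "z = (H ^^ n) p" by auto
    have "norm z \<le> norm (fst z) + norm (snd z)" by (metis norm_Pair_le prod.collapse)
    then show "norm z \<le> 2 * c" using *[of n] z by auto
  qed
qed

text \<open>The leading term, at least l|y|^d, has to beat d lower terms of size at most C|y|^(d-1)
  and the term in x of size at most C|y|, and to leave 2|y|; this is the origin of (2 + C + dC)/l.
  As d is at least 2, the spare power |y|^(d-1) is at least |y|. Only the bounds C and l enter, so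
  the threshold is uniform over nearby parameters.\<close>

lemma henon_growth:
  fixes P :: "complex poly"
  assumes "degree P = d" "2 \<le> d" and C: "\<And>k. k < d \<Longrightarrow> norm (coeff P k) \<le> C" and "norm \<delta> \<le> C"
    and "0 < l" "l \<le> norm (coeff P d)"
    and y1: "1 < norm y" and yl: "(2 + C + real d * C) / l < norm y" and xy: "norm x \<le> norm y"
  shows "2 * norm y \<le> norm (poly P y - \<delta> * x)"
proof -
  obtain e where e: "d = Suc (Suc e)" using assms(2) by (metis add_2_eq_Suc le_Suc_ex)
  have C0: "0 \<le> C" using assms(4) norm_ge_zero order_trans by blast
  have "poly P y = (\<Sum>i<d. coeff P i * y ^ i) + coeff P d * y ^ d"
    by (simp add: poly_altdef assms(1) lessThan_Suc_atMost[symmetric])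
  moreover have "norm (\<Sum>i<d. coeff P i * y ^ i) \<le> (\<Sum>i<d. C * norm y ^ Suc e)"
  proof (rule sum_norm_le)
    fix i assume "i \<in> {..<d}"
    then have "norm y ^ i \<le> norm y ^ Suc e" "norm (coeff P i) \<le> C"
      using y1 e C power_increasing[of i "Suc e" "norm y"] by auto
    then show "norm (coeff P i * y ^ i) \<le> C * norm y ^ Suc e"
      unfolding norm_mult norm_power using C0 by (intro mult_mono) auto
  qed
  moreover have "l * norm y ^ d \<le> norm (coeff P d * y ^ d)"
    using assms(6) by (simp add: norm_mult norm_power mult_right_mono)
  moreover have "norm (\<delta> * x) \<le> C * norm y"
    unfolding norm_mult using assms(4) xy C0 by (intro mult_mono) auto
  ultimately have "l * norm y ^ d - real d * (C * norm y ^ Suc e) - C * norm y \<le> norm (poly P y - \<delta> * x)"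
    using norm_triangle_ineq4[of "poly P y - \<delta> * x" "- (\<delta> * x)"]
      norm_diff_ineq[of "coeff P d * y ^ d" "\<Sum>i<d. coeff P i * y ^ i"]
    by (simp add: algebra_simps)
  moreover have "(2 + C) * norm y \<le> norm y ^ Suc e * (l * norm y - real d * C)"
  proof -
    have "2 + C + real d * C < l * norm y" using yl assms(5) by (simp add: field_simps)
    then have "2 + C \<le> l * norm y - real d * C" by linarith
    moreover have "norm y \<le> norm y ^ Suc e" using y1 by (intro self_le_power) auto
    moreover have "0 \<le> norm y ^ Suc e" "0 \<le> 2 + C" using C0 by auto
    ultimately have "norm y * (2 + C) \<le> norm y ^ Suc e * (l * norm y - real d * C)"
      by (intro mult_mono)
    then show ?thesis by (simp add: mult.commute)
  qed
  ultimately show ?thesis by (simp add: e algebra_simps)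
qed

lemma henon_filtrated:
  fixes P :: "complex poly"
  assumes "degree P = d" "2 \<le> d" "\<And>k. k < d \<Longrightarrow> norm (coeff P k) \<le> C" "norm \<delta> \<le> C"
    and "0 < l" "l \<le> norm (coeff P d)" and R: "1 \<le> R" "(2 + C + real d * C) / l \<le> R"
  shows "filtrated R (henon P \<delta>)"
proof -
  have g: "2 * norm y \<le> norm (poly P y - \<delta> * x)" if "max R (norm x) < norm y" for x y
    by (rule henon_growth[OF assms(1-6)]) (use that R in auto)
  show ?thesis
    unfolding filtrated_def
  proof (intro conjI ballI allI impI)
    fix p assume "p \<in> escape_region R"
    then obtain x y where p: "p = (x, y)" and xy: "max R (norm x) < norm y"
      by (cases p) (auto simp: escape_region_def)
    show "2 * norm (snd p) \<le> norm (snd (henon P \<delta> p))"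
      using g[OF xy] by (simp add: p henon_def)
    show "henon P \<delta> p \<in> escape_region R"
      using g[OF xy] xy R(1) by (simp add: p henon_def escape_region_def)
  next
    fix p assume p: "henon P \<delta> p \<notin> escape_region R"
    obtain x y where "p = (x, y)" by (cases p)
    then show "max (norm (fst (henon P \<delta> p))) (norm (snd (henon P \<delta> p)))
        \<le> max R (max (norm (fst p)) (norm (snd p)))"
      using p by (simp add: henon_def escape_region_def not_less le_max_iff_disj) auto
  qed
qed

section \<open>Bounded orbits under conjugation, and upper semicontinuity of K^+ at the parameter
  0\<close>

lemma polynomial_map_continuous:
  assumes "polynomial_map f"
  shows "continuous_on UNIV f"
proof -
  have *: "continuous_on UNIV g" if g: "polynomial_fun g" for g
  proof -
    obtain N c where "\<And>x y. g (x, y) = (\<Sum>i\<le>(N::nat). \<Sum>j\<le>N. c i j * x ^ i * y ^ j)"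
      using g unfolding polynomial_fun_def by blast
    then have "g = (\<lambda>p. \<Sum>i\<le>N. \<Sum>j\<le>N. c i j * fst p ^ i * snd p ^ j)" by auto
    then show ?thesis by (auto intro!: continuous_intros)
  qed
  have "f = (\<lambda>p. ((fst \<circ> f) p, (snd \<circ> f) p))" by auto
  moreover have "continuous_on UNIV (\<lambda>p. ((fst \<circ> f) p, (snd \<circ> f) p))"
    using assms unfolding polynomial_map_def by (intro continuous_on_Pair *) blast+
  ultimately show ?thesis by simp
qed

lemma bounded_continuous_image:
  fixes f :: "complex \<times> complex \<Rightarrow> complex \<times> complex"
  assumes "continuous_on UNIV f" "bounded S"
  shows "bounded (f ` S)"
proof -
  have "compact (f ` closure S)"
    using assms by (intro compact_continuous_image) (auto intro: continuous_on_subset)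
  then show ?thesis
    by (meson bounded_subset closure_subset compact_imp_bounded image_mono)
qed

text \<open>Both \<psi> and its inverse are polynomial, hence continuous, and continuous maps of C^2
  send bounded sets to bounded sets; so bounded orbits correspond to bounded orbits.\<close>

lemma K_plus_conj:
  assumes "polynomial_diffeo \<psi>" "F = inv \<psi> \<circ> H \<circ> \<psi>" "filtrated R H"
  shows "p \<in> K_plus F \<longleftrightarrow> (\<forall>n. \<psi> ((F ^^ n) p) \<notin> escape_region R)"
proof -
  have bij: "bij \<psi>" and cont: "continuous_on UNIV \<psi>" "continuous_on UNIV (inv \<psi>)"
    using assms(1) by (auto simp: polynomial_diffeo_def intro: polynomial_map_continuous)
  have conj: "\<psi> ((F ^^ n) p) = (H ^^ n) (\<psi> p)" for n
    by (induction n) (use bij in \<open>auto simp: assms(2) bij_inv_eq_iff surj_f_inv_f bij_is_surj\<close>)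
  have "bounded (range (\<lambda>n. (F ^^ n) p)) \<longleftrightarrow> bounded (range (\<lambda>n. \<psi> ((F ^^ n) p)))"
  proof
    assume "bounded (range (\<lambda>n. (F ^^ n) p))"
    from bounded_continuous_image[OF cont(1) this] show "bounded (range (\<lambda>n. \<psi> ((F ^^ n) p)))"
      by (simp add: image_image)
  next
    assume "bounded (range (\<lambda>n. \<psi> ((F ^^ n) p)))"
    from bounded_continuous_image[OF cont(2) this] show "bounded (range (\<lambda>n. (F ^^ n) p))"
      using bij by (simp add: image_image inv_f_f bij_is_inj)
  qed
  then show ?thesis
    unfolding K_plus_def using filtrated_bounded_orbit_iff[OF assms(3), of "\<psi> p"] by (simp add: conj)
qed

text \<open>The point is a single R for all parameters near 0. The degrees are constant and the
  coefficients continuous, so near 0 the leading coefficients stay away from 0 and all others stay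
  bounded.\<close>

lemma conj_to_henon_composition_K_plus:
  assumes "conj_to_henon_composition D F" "open D" "0 \<in> D"
  obtains \<psi> R where "continuous_on (D \<times> UNIV) (\<lambda>(\<epsilon>, p). \<psi> \<epsilon> p)"
    "\<forall>\<^sub>F \<epsilon> in nhds 0. \<forall>p. p \<in> K_plus (F \<epsilon>) \<longleftrightarrow> (\<forall>n. \<psi> \<epsilon> ((F \<epsilon> ^^ n) p) \<notin> escape_region R)"
proof -
  from assms(1)[unfolded conj_to_henon_composition_def]
  obtain m :: nat and d P \<delta> \<psi> where m: "1 \<le> m"
    and fac0: "\<forall>i<m. 2 \<le> d i \<and>
           (\<forall>\<epsilon>\<in>D. degree (P i \<epsilon>) = d i \<and> \<delta> i \<epsilon> \<noteq> 0) \<and>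
           (\<forall>k. continuous_on D (\<lambda>\<epsilon>. coeff (P i \<epsilon>) k)) \<and> continuous_on D (\<delta> i)"
    and psi0: "\<forall>\<epsilon>\<in>D. polynomial_diffeo (\<psi> \<epsilon>)"
    and psi1: "continuous_on (D \<times> UNIV) (\<lambda>(\<epsilon>, p). \<psi> \<epsilon> p)"
    and psi2: "\<forall>\<epsilon>\<in>D. F \<epsilon> =
         inv (\<psi> \<epsilon>) \<circ> foldr (\<circ>) (map (\<lambda>i. henon (P i \<epsilon>) (\<delta> i \<epsilon>)) [0..<m]) id \<circ> \<psi> \<epsilon>"
    by (elim exE conjE) (rule that)
  note psi = psi0[rule_format] psi1 psi2[rule_format]
  have fac: "\<And>i. i < m \<Longrightarrow> 2 \<le> d i"
      "\<And>i \<epsilon>. i < m \<Longrightarrow> \<epsilon> \<in> D \<Longrightarrow> degree (P i \<epsilon>) = d i"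
      "\<And>i k. i < m \<Longrightarrow> continuous_on D (\<lambda>\<epsilon>. coeff (P i \<epsilon>) k)"
      "\<And>i. i < m \<Longrightarrow> continuous_on D (\<delta> i)"
    using fac0 by blast+
  have D: "\<forall>\<^sub>F \<epsilon> in nhds 0. \<epsilon> \<in> D" using assms(2,3) by (rule eventually_nhds_in_open)
  have "\<exists>R. \<forall>\<^sub>F \<epsilon> in nhds 0. \<forall>R'\<ge>R. filtrated R' (henon (P i \<epsilon>) (\<delta> i \<epsilon>))" if i: "i < m" for i
  proof -
    have tend: "((\<lambda>\<epsilon>. coeff (P i \<epsilon>) k) \<longlongrightarrow> coeff (P i 0) k) (nhds 0)" for k
      using fac(3)[OF i, of k] assms(2,3)
      by (simp add: continuous_on_eq_continuous_at isCont_def tendsto_at_iff_tendsto_nhds[of "\<lambda>\<epsilon>. coeff (P i \<epsilon>) k"])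
    have tend': "(\<delta> i \<longlongrightarrow> \<delta> i 0) (nhds 0)"
      using fac(4)[OF i] assms(2,3)
      by (simp add: continuous_on_eq_continuous_at isCont_def tendsto_at_iff_tendsto_nhds[of "\<delta> i"])
    \<comment> \<open>Both bounds are strict at the parameter 0: C has 1 to spare and l is half the
      modulus of the leading coefficient. Hence they persist nearby.\<close>
    define C where "C = norm (\<delta> i 0) + (\<Sum>k<d i. norm (coeff (P i 0) k)) + 1"
    define l where "l = norm (coeff (P i 0) (d i)) / 2"
    have "degree (P i 0) = d i" "d i \<ge> 2" using fac i assms(3) by auto
    then have "lead_coeff (P i 0) \<noteq> 0" by (metis degree_0 leading_coeff_0_iff not_numeral_le_zero)
    then have l: "0 < l" unfolding l_def using \<open>degree (P i 0) = d i\<close> by simp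
    have "norm (coeff (P i 0) k) < C" if "k < d i" for k
    proof -
      have "norm (coeff (P i 0) k) \<le> (\<Sum>k<d i. norm (coeff (P i 0) k))"
        using that by (intro member_le_sum) auto
      then show ?thesis unfolding C_def by (smt (verit) norm_ge_zero)
    qed
    then have "\<forall>\<^sub>F \<epsilon> in nhds 0. norm (coeff (P i \<epsilon>) k) < C" if "k < d i" for k
      using that by (intro order_tendstoD(2)[OF tendsto_norm[OF tend]]) auto
    then have e1: "\<forall>\<^sub>F \<epsilon> in nhds 0. \<forall>k\<in>{..<d i}. norm (coeff (P i \<epsilon>) k) < C"
      by (intro eventually_ball_finite) auto
    have "0 \<le> (\<Sum>k<d i. norm (coeff (P i 0) k))" by (intro sum_nonneg) auto
    then have e2: "\<forall>\<^sub>F \<epsilon> in nhds 0. norm (\<delta> i \<epsilon>) < C"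
      by (intro order_tendstoD(2)[OF tendsto_norm[OF tend']]) (auto simp: C_def)
    have e3: "\<forall>\<^sub>F \<epsilon> in nhds 0. l < norm (coeff (P i \<epsilon>) (d i))"
      using l by (intro order_tendstoD(1)[OF tendsto_norm[OF tend]]) (auto simp: l_def)
    have "\<forall>\<^sub>F \<epsilon> in nhds 0. \<forall>R'\<ge>max 1 ((2 + C + real (d i) * C) / l).
        filtrated R' (henon (P i \<epsilon>) (\<delta> i \<epsilon>))"
      using e1 e2 e3 D
    proof eventually_elim
      case (elim \<epsilon>)
      show ?case
      proof (intro allI impI)
        fix R' assume "max 1 ((2 + C + real (d i) * C) / l) \<le> R'"
        then show "filtrated R' (henon (P i \<epsilon>) (\<delta> i \<epsilon>))"
          using elim fac i l
          by (intro henon_filtrated[where d = "d i" and C = C and l = l]) (auto simp: less_imp_le)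
      qed
    qed
    then show ?thesis by blast
  qed
  then obtain Rf where Rf: "\<And>i. i < m \<Longrightarrow>
      \<forall>\<^sub>F \<epsilon> in nhds 0. \<forall>R'\<ge>Rf i. filtrated R' (henon (P i \<epsilon>) (\<delta> i \<epsilon>))" by metis
  define R where "R = Max (Rf ` {..<m})"
  have "\<forall>\<^sub>F \<epsilon> in nhds 0. \<forall>i\<in>{..<m}. filtrated R (henon (P i \<epsilon>) (\<delta> i \<epsilon>))"
  proof -
    have "\<forall>\<^sub>F \<epsilon> in nhds 0. filtrated R (henon (P i \<epsilon>) (\<delta> i \<epsilon>))" if "i < m" for i
    proof -
      have "Rf i \<le> R" using that by (auto simp: R_def)
      then show ?thesis using Rf[OF that] by (auto elim: eventually_mono)
    qed
    then show ?thesis by (intro eventually_ball_finite) auto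
  qed
  then have "\<forall>\<^sub>F \<epsilon> in nhds 0. \<forall>p. p \<in> K_plus (F \<epsilon>) \<longleftrightarrow> (\<forall>n. \<psi> \<epsilon> ((F \<epsilon> ^^ n) p) \<notin> escape_region R)"
    using D
  proof eventually_elim
    case (elim \<epsilon>)
    have "filtrated R (foldr (\<circ>) (map (\<lambda>i. henon (P i \<epsilon>) (\<delta> i \<epsilon>)) [0..<m]) id)"
      using elim m by (intro filtrated_foldr) auto
    from K_plus_conj[OF psi(1)[OF elim(2)] psi(3)[OF elim(2)] this] show ?case by blast
  qed
  with psi(2) show thesis using that by blast
qed

lemma funpow_tendsto:
  fixes F :: "'a::t2_space \<Rightarrow> 'b::t2_space \<Rightarrow> 'b"
  assumes "continuous_on (D \<times> UNIV) (\<lambda>(\<epsilon>, p). F \<epsilon> p)" "open D" "e \<in> D"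
    and "(\<epsilon> \<longlongrightarrow> e) A" "(p \<longlongrightarrow> p') A"
  shows "((\<lambda>i. (F (\<epsilon> i) ^^ n) (p i)) \<longlongrightarrow> (F e ^^ n) p') A"
proof (induction n)
  case (Suc n)
  have "isCont (\<lambda>(\<epsilon>, p). F \<epsilon> p) (e, (F e ^^ n) p')"
    using assms(1-3) by (simp add: continuous_on_eq_continuous_at open_Times)
  from isCont_tendsto_compose[OF this tendsto_Pair[OF assms(4) Suc]] show ?case by simp
qed (use assms in simp)

text \<open>Escape is an open condition: if the orbit of \<open>p'\<close> entered the escape region
  at time n, then by continuity of n iterates and of \<psi> the orbits of \<open>p i\<close> would
  be there at time n for all large i.\<close>

lemma K_plus_upper_semicontinuous:
  assumes "conj_to_henon_composition D F" "open D" "0 \<in> D"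
    and cont: "continuous_on (D \<times> UNIV) (\<lambda>(\<epsilon>, p). F \<epsilon> p)"
    and lims: "\<epsilon> \<longlonglongrightarrow> 0" "p \<longlonglongrightarrow> p'" and K: "\<And>i. p i \<in> K_plus (F (\<epsilon> i))"
  shows "p' \<in> K_plus (F 0)"
proof -
  obtain \<psi> R where psi: "continuous_on (D \<times> UNIV) (\<lambda>(\<epsilon>, p). \<psi> \<epsilon> p)"
    and ev: "\<forall>\<^sub>F \<epsilon> in nhds 0. \<forall>p. p \<in> K_plus (F \<epsilon>) \<longleftrightarrow> (\<forall>n. \<psi> \<epsilon> ((F \<epsilon> ^^ n) p) \<notin> escape_region R)"
    using conj_to_henon_composition_K_plus[OF assms(1-3)] by blast
  have ev': "\<forall>\<^sub>F i in sequentially. \<forall>n. \<psi> (\<epsilon> i) ((F (\<epsilon> i) ^^ n) (p i)) \<notin> escape_region R"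
    using eventually_compose_filterlim[OF ev lims(1)]
  proof eventually_elim
    case (elim i)
    then show ?case using K[of i] by blast
  qed
  have "\<psi> 0 ((F 0 ^^ n) p') \<notin> escape_region R" for n
  proof
    assume *: "\<psi> 0 ((F 0 ^^ n) p') \<in> escape_region R"
    have "isCont (\<lambda>(\<epsilon>, p). \<psi> \<epsilon> p) (0, (F 0 ^^ n) p')"
      using continuous_on_interior[OF psi] assms(2,3) by (simp add: interior_open open_Times)
    from isCont_tendsto_compose[OF this tendsto_Pair[OF lims(1)
        funpow_tendsto[OF cont assms(2,3) lims, of n]]]
    have "(\<lambda>i. \<psi> (\<epsilon> i) ((F (\<epsilon> i) ^^ n) (p i))) \<longlonglongrightarrow> \<psi> 0 ((F 0 ^^ n) p')" by simp
    from topological_tendstoD[OF this open_escape_region *] ev'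
    have "\<forall>\<^sub>F i in sequentially. False" by eventually_elim auto
    then show False by simp
  qed
  then show ?thesis using eventually_nhds_x_imp_x[OF ev] by blast
qed


section \<open>The cotangent coordinate\<close>

lemma norm_sin_bound: "norm (sin z) \<le> norm z * exp (norm z)" for z :: complex
proof -
  have "norm (sin z - sin 0) \<le> exp (norm z) * norm (z - 0)"
  proof (rule field_differentiable_bound[where S = "cball 0 (norm z)" and f' = cos])
    fix w :: complex assume "w \<in> cball 0 (norm z)"
    then show "norm (cos w) \<le> exp (norm z)" using norm_cos_le[of w] by (auto intro: order_trans)
  qed (auto intro!: derivative_eq_intros)
  then show ?thesis by (simp add: mult.commute)
qed

lemma norm_cos_minus_1_bound: "norm (cos z - 1) \<le> (norm z)\<^sup>2 * exp (norm z)" for z :: complex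
proof -
  have "norm (cos z - cos 0) \<le> (norm z * exp (norm z)) * norm (z - 0)"
  proof (rule field_differentiable_bound[where S = "cball 0 (norm z)" and f' = "\<lambda>w. - sin w"])
    fix w :: complex assume "w \<in> cball 0 (norm z)"
    then have "norm w * exp (norm w) \<le> norm z * exp (norm z)" by (intro mult_mono) auto
    then show "norm (- sin w) \<le> norm z * exp (norm z)" using norm_sin_bound[of w] by simp
  qed (auto intro!: derivative_eq_intros)
  then show ?thesis by (simp add: power2_eq_square mult_ac)
qed

lemma norm_Arctan_approx:
  assumes "norm z \<le> 1 / 2"
  shows "norm (Arctan z - z) \<le> 2 * norm z ^ 3"
proof -
  have *: "1 + w\<^sup>2 \<noteq> 0" "norm (inverse (1 + w\<^sup>2) - 1) \<le> 2 * (norm z)\<^sup>2" "norm w < 1"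
    if "norm w \<le> norm z" for w :: complex
  proof -
    have w: "norm w \<le> 1 / 2" using that assms by simp
    have "norm (w\<^sup>2) \<le> (1 / 2)\<^sup>2" unfolding norm_power using w by (intro power_mono) auto
    then have "1 / 2 \<le> norm (1 + w\<^sup>2)"
      using norm_diff_ineq[of 1 "w\<^sup>2"] by (simp add: power2_eq_square)
    then show nz: "1 + w\<^sup>2 \<noteq> 0" by auto
    have "inverse (1 + w\<^sup>2) - 1 = - w\<^sup>2 / (1 + w\<^sup>2)" using nz by (simp add: field_simps)
    then have "norm (inverse (1 + w\<^sup>2) - 1) = (norm w)\<^sup>2 / norm (1 + w\<^sup>2)"
      by (simp add: norm_divide norm_power)
    also have "\<dots> \<le> (norm w)\<^sup>2 / (1 / 2)"
      using \<open>1 / 2 \<le> norm (1 + w\<^sup>2)\<close> by (intro divide_left_mono) auto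
    also have "\<dots> \<le> 2 * (norm z)\<^sup>2" using that by (simp add: power_mono)
    finally show "norm (inverse (1 + w\<^sup>2) - 1) \<le> 2 * (norm z)\<^sup>2" .
    show "norm w < 1" using w by simp
  qed
  have "norm ((Arctan z - z) - (Arctan 0 - 0)) \<le> (2 * (norm z)\<^sup>2) * norm (z - 0)"
  proof (rule field_differentiable_bound[where S = "cball 0 (norm z)" and f' = "\<lambda>w. inverse (1 + w\<^sup>2) - 1"])
    fix w :: complex assume "w \<in> cball 0 (norm z)"
    then have w: "norm w \<le> norm z" by simp
    have "Re w = 0 \<Longrightarrow> \<bar>Im w\<bar> < 1" using *(3)[OF w] abs_Im_le_cmod[of w] by linarith
    then show "((\<lambda>w. Arctan w - w) has_field_derivative inverse (1 + w\<^sup>2) - 1) (at w within cball 0 (norm z))"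
      by (auto intro!: derivative_eq_intros)
    show "norm (inverse (1 + w\<^sup>2) - 1) \<le> 2 * (norm z)\<^sup>2" using * w by blast
  qed auto
  then show ?thesis by (simp add: power3_eq_cube power2_eq_square mult_ac)
qed

text \<open>Makes x times a first-order error a second-order error in
  \<open>normal_form_increment\<close>.\<close>

lemma mult_sum_le_sum_squares: "x * (x + y + z) \<le> 2 * (x\<^sup>2 + y\<^sup>2 + z\<^sup>2)" for x y z :: real
proof -
  have "2 * (2 * (x\<^sup>2 + y\<^sup>2 + z\<^sup>2) - x * (x + y + z)) = (x - y)\<^sup>2 + (x - z)\<^sup>2 + 3 * y\<^sup>2 + 3 * z\<^sup>2"
    by (simp add: power2_eq_square algebra_simps)
  also have "\<dots> \<ge> 0" by simp
  finally show ?thesis by simp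
qed

lemma norm_add5_le:
  "norm (a + b + c + d + e) \<le> norm a + norm b + norm c + norm d + norm e"
  by (intro order_trans[OF norm_triangle_ineq] add_mono order_refl)

text \<open>In the variable \<open>s\<close> with \<open>x = - \<epsilon> cot (\<epsilon> s)\<close> the addition theorem of the cotangent turns
  \<open>x \<mapsto> x + (x\<^sup>2 + \<epsilon>\<^sup>2) a\<close> into the translation by \<open>Arctan (\<epsilon> a / (1 + x a)) / \<epsilon>\<close>; no branch
  of the inverse cotangent has to be chosen.\<close>

lemma cot_step:
  fixes x e s a :: complex
  defines "T \<equiv> a / (1 + x * a)"
  defines "u \<equiv> Arctan (e * T)"
  assumes "e \<noteq> 0" "sin (e * s) \<noteq> 0" and x: "x * sin (e * s) = - e * cos (e * s)"
    and "1 + x * a \<noteq> 0" and eT: "(e * T)\<^sup>2 \<noteq> -1"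
  shows "cos u \<noteq> 0" and "sin (e * s + u) = sin (e * s) * (cos u / (1 + x * a))"
    and "(x + (x\<^sup>2 + e\<^sup>2) * a) * sin (e * s + u) = - e * cos (e * s + u)"
proof -
  have tan: "tan u = e * T" unfolding u_def by (rule tan_Arctan[OF eT])
  show cu: "cos u \<noteq> 0"
  proof
    assume c0: "cos u = 0"
    then have "e * T = 0" using tan by (simp add: tan_def)
    then have "u = 0" by (simp only: u_def Arctan_0)
    then show False using c0 by simp
  qed
  have su: "sin u = e * T * cos u" using tan cu by (simp add: tan_def field_simps)
  have xT: "1 - x * T = 1 / (1 + x * a)" unfolding T_def using assms(6) by (simp add: field_simps)
  have "sin (e * s + u) = cos u * (sin (e * s) + T * (e * cos (e * s)))"
    by (simp add: sin_add su algebra_simps)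
  also have "e * cos (e * s) = - (x * sin (e * s))" using x by simp
  finally have sin1: "sin (e * s + u) = cos u * sin (e * s) * (1 - x * T)" by (simp add: algebra_simps)
  then show "sin (e * s + u) = sin (e * s) * (cos u / (1 + x * a))" by (simp add: xT)
  have "e * cos (e * s + u) = cos u * (e * cos (e * s) - e\<^sup>2 * T * sin (e * s))"
    by (simp add: cos_add su algebra_simps power2_eq_square)
  also have "e * cos (e * s) = - (x * sin (e * s))" using x by simp
  finally have cos1: "e * cos (e * s + u) = - (cos u * sin (e * s) * (x + e\<^sup>2 * T))"
    by (simp add: algebra_simps)
  have X: "(x + (x\<^sup>2 + e\<^sup>2) * a) * (1 - x * T) = x + e\<^sup>2 * T"
    unfolding xT using assms(6) unfolding T_def by (simp add: field_simps power2_eq_square)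
  have "(x + (x\<^sup>2 + e\<^sup>2) * a) * sin (e * s + u) = cos u * sin (e * s) * ((x + (x\<^sup>2 + e\<^sup>2) * a) * (1 - x * T))"
    unfolding sin1 by (simp only: mult_ac)
  then show "(x + (x\<^sup>2 + e\<^sup>2) * a) * sin (e * s + u) = - e * cos (e * s + u)"
    unfolding X using cos1 by simp
qed

text \<open>Up to second order, a/(1 + xa) = a - xa^2 = 1 + qx + ry and Ln(1 + xa) = x. So the
  geometric series removes the 1 from the coefficient q + 1, and the logarithm removes q. The term
  ry is left in place; it is summed later through the decay of y.\<close>

lemma normal_form_increment:
  fixes q r :: complex and C :: real
  assumes "0 \<le> C"
  obtains \<delta> C' where "0 < \<delta>" "\<delta> \<le> 1" "0 \<le> C'"
    "\<And>x (y::complex) (e::complex) a. \<lbrakk>norm x < \<delta>; norm y < \<delta>; norm e < \<delta>;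
        norm (a - (1 + (q + 1) * x + r * y)) \<le> C * ((norm x)\<^sup>2 + (norm y)\<^sup>2 + (norm e)\<^sup>2)\<rbrakk> \<Longrightarrow>
       norm (x * a) \<le> 1 / 4 \<and> norm (a / (1 + x * a) - 1) \<le> 1 / 4 \<and>
       norm (a / (1 + x * a) - q * Ln (1 + x * a) - (1 + r * y))
         \<le> C' * ((norm x)\<^sup>2 + (norm y)\<^sup>2 + (norm e)\<^sup>2)"
proof -
  \<comment> \<open>L gives |a - 1| <= L(|x| + |y| + |e|). The choice of \<delta> makes both
    \<delta> and L\<delta> at most 1/100, hence |a - 1| <= 3/100, |a| <= 2 and |xa| <= 1/50, well
    inside the required 1/4.\<close>
  define L where "L = norm (q + 1) + norm r + C + 1"
  define C' where "C' = 16 + 9 * L + C + norm q * (8 + 6 * L)"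
  define \<delta> where "\<delta> = 1 / (100 * (L + norm q + C))"
  have L1: "1 \<le> L" unfolding L_def using assms by simp
  have den: "0 < L + norm q + C" "1 \<le> L + norm q + C" "0 \<le> norm q + C"
    using L1 assms norm_ge_zero[of q] by linarith+
  then have d0: "0 < \<delta>" unfolding \<delta>_def by simp
  have dL: "L * \<delta> \<le> 1 / 100" "\<delta> \<le> 1 / 100"
    unfolding \<delta>_def using den by (auto simp: field_simps)
  show thesis
  proof (rule that[of \<delta> C'])
    show "0 < \<delta>" "\<delta> \<le> 1" using d0 dL by auto
    show "0 \<le> C'" unfolding C'_def using L1 assms by simp
    fix x y e a :: complex
    assume b: "norm x < \<delta>" "norm y < \<delta>" "norm e < \<delta>"
      and a: "norm (a - (1 + (q + 1) * x + r * y)) \<le> C * ((norm x)\<^sup>2 + (norm y)\<^sup>2 + (norm e)\<^sup>2)"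
    define Q where "Q = (norm x)\<^sup>2 + (norm y)\<^sup>2 + (norm e)\<^sup>2"
    define S where "S = norm x + norm y + norm e"
    have Q0: "0 \<le> Q" unfolding Q_def by simp
    have "(norm x)\<^sup>2 \<le> norm x" "(norm y)\<^sup>2 \<le> norm y" "(norm e)\<^sup>2 \<le> norm e"
      using b dL by (auto intro!: power_le_one_iff[THEN iffD2] mult_left_le simp: power2_eq_square)
    then have QS: "Q \<le> S" unfolding Q_def S_def by simp
    have S2: "norm x * S \<le> 2 * Q" unfolding S_def Q_def by (rule mult_sum_le_sum_squares)
    have "a - 1 = (a - (1 + (q + 1) * x + r * y)) + ((q + 1) * x + r * y)" by simp
    then have "norm (a - 1) \<le> C * Q + (norm (q + 1) * norm x + norm r * norm y)"
      using norm_triangle_mono[OF a[folded Q_def] norm_triangle_ineq[of "(q + 1) * x" "r * y"]]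
      by (simp add: norm_mult)
    also have "\<dots> \<le> C * S + (norm (q + 1) * S + norm r * S)"
      using QS assms by (intro add_mono mult_left_mono) (auto simp: S_def)
    also have "\<dots> \<le> L * S" unfolding L_def S_def by (simp add: algebra_simps)
    finally have a1: "norm (a - 1) \<le> L * S" .
    have "L * S \<le> L * (3 * \<delta>)" using b L1 unfolding S_def by (intro mult_left_mono) auto
    then have LS: "L * S \<le> 3 / 100" using dL by simp
    have LS0: "0 \<le> L * S" using a1 norm_ge_zero order_trans by blast
    have na: "norm a \<le> 2" "norm (a + 1) \<le> 3"
      using a1 LS norm_triangle_ineq[of "a - 1" 1] norm_triangle_ineq[of "a - 1" 2] by (auto simp: add.commute)
    have "norm (x * a) \<le> \<delta> * 2" unfolding norm_mult using b na d0 by (intro mult_mono) auto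
    then have xa: "norm (x * a) \<le> 1 / 50" using dL by simp
    then have h: "1 / 2 \<le> norm (1 + x * a)" using norm_diff_ineq[of 1 "x * a"] by simp
    then have nz: "1 + x * a \<noteq> 0" by auto
    define T where "T = a / (1 + x * a)"
    have T1: "norm (T - (a - x * a\<^sup>2)) \<le> 16 * Q"
    proof -
      have "T - (a - x * a\<^sup>2) = x\<^sup>2 * a ^ 3 / (1 + x * a)"
        unfolding T_def using nz by (simp add: field_simps power2_eq_square power3_eq_cube)
      then have "norm (T - (a - x * a\<^sup>2)) = (norm x)\<^sup>2 * norm a ^ 3 / norm (1 + x * a)"
        by (simp add: norm_mult norm_power norm_divide)
      also have "\<dots> \<le> (norm x)\<^sup>2 * 2 ^ 3 / (1 / 2)"
        using h na by (intro frac_le mult_left_mono power_mono) auto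
      also have "\<dots> \<le> 16 * Q" unfolding Q_def by simp
      finally show ?thesis .
    qed
    have T2: "norm (x * (a - 1) * (a + 1)) \<le> 6 * L * Q"
    proof -
      have "norm (x * (a - 1) * (a + 1)) \<le> norm x * (L * S) * 3"
        unfolding norm_mult using a1 na LS0 by (intro mult_mono) auto
      also have "\<dots> = 3 * L * (norm x * S)" by simp
      also have "\<dots> \<le> 3 * L * (2 * Q)" using S2 L1 by (intro mult_left_mono) auto
      finally show ?thesis by simp
    qed
    have T3: "norm (x * (a - 1)) \<le> 2 * L * Q"
    proof -
      have "norm (x * (a - 1)) \<le> norm x * (L * S)"
        unfolding norm_mult using a1 LS0 by (intro mult_mono) auto
      also have "\<dots> = L * (norm x * S)" by simp
      also have "\<dots> \<le> L * (2 * Q)" using S2 L1 by (intro mult_left_mono) auto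
      finally show ?thesis by simp
    qed
    have T4: "norm (Ln (1 + x * a) - x * a) \<le> 8 * Q"
    proof -
      have "norm (Ln (1 + x * a) - x * a) \<le> (norm (x * a))\<^sup>2 / (1 - norm (x * a))"
        using xa by (intro Ln_approx_linear) simp
      also have "\<dots> \<le> (norm x * 2)\<^sup>2 / (1 / 2)"
        using xa na unfolding norm_mult by (intro frac_le power_mono mult_left_mono) auto
      also have "\<dots> \<le> 8 * Q" unfolding Q_def by (simp add: power2_eq_square)
      finally show ?thesis .
    qed
    \<comment> \<open>The term (q + 1)x is split: x is compared with xa^2, and qx with q Ln(1 + xa)
      by way of qxa.\<close>
    have eq: "T - q * Ln (1 + x * a) - (1 + r * y) =
        (T - (a - x * a\<^sup>2)) + (- (x * (a - 1) * (a + 1))) + (a - (1 + (q + 1) * x + r * y))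
        + (- (q * (Ln (1 + x * a) - x * a))) + (- (q * (x * (a - 1))))"
      by (simp add: algebra_simps power2_eq_square)
    have "norm (T - q * Ln (1 + x * a) - (1 + r * y)) \<le>
        norm (T - (a - x * a\<^sup>2)) + norm (x * (a - 1) * (a + 1)) + norm (a - (1 + (q + 1) * x + r * y))
        + norm (q * (Ln (1 + x * a) - x * a)) + norm (q * (x * (a - 1)))"
      using norm_add5_le[of "T - (a - x * a\<^sup>2)" "- (x * (a - 1) * (a + 1))" "a - (1 + (q + 1) * x + r * y)"
          "- (q * (Ln (1 + x * a) - x * a))" "- (q * (x * (a - 1)))"]
      unfolding eq[symmetric] norm_minus_cancel .
    also have "\<dots> \<le> 16 * Q + 6 * L * Q + C * Q + norm q * (8 * Q) + norm q * (2 * L * Q)"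
      using T1 T2 a[folded Q_def] T3 T4 unfolding norm_mult[of q]
      by (intro add_mono mult_left_mono) auto
    also have "\<dots> \<le> C' * Q"
    proof -
      have "0 \<le> 3 * L * Q + norm q * (4 * L * Q)" using L1 Q0 by (intro add_nonneg_nonneg mult_nonneg_nonneg) auto
      then show ?thesis unfolding C'_def by (simp add: algebra_simps)
    qed
    finally have fin: "norm (T - q * Ln (1 + x * a) - (1 + r * y)) \<le> C' * Q" .
    have eq2: "T - 1 = (T - (a - x * a\<^sup>2)) + (a - 1) - x * a * a" by (simp add: power2_eq_square)
    have "norm (T - 1) \<le> norm (T - (a - x * a\<^sup>2)) + norm (a - 1) + norm (x * a * a)"
      unfolding eq2
      using norm_triangle_ineq4[of "T - (a - x * a\<^sup>2) + (a - 1)" "x * a * a"]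
        norm_triangle_ineq[of "T - (a - x * a\<^sup>2)" "a - 1"] by linarith
    also have "\<dots> \<le> 16 * Q + 3 / 100 + 1 / 50 * 2"
      using T1 a1 LS xa na unfolding norm_mult[of "x * a" a] by (intro add_mono mult_mono) auto
    also have "\<dots> \<le> 1 / 4"
    proof -
      have z2: "(norm z)\<^sup>2 \<le> (1 / 100)\<^sup>2" if "norm z < \<delta>" for z :: complex
        using that dL by (intro power_mono) auto
      then have "Q \<le> 3 * (1 / 100)\<^sup>2" unfolding Q_def using z2[OF b(1)] z2[OF b(2)] z2[OF b(3)] by linarith
      then show ?thesis by (simp add: power2_eq_square)
    qed
    finally show "norm (x * a) \<le> 1 / 4 \<and> norm (a / (1 + x * a) - 1) \<le> 1 / 4 \<and>
       norm (a / (1 + x * a) - q * Ln (1 + x * a) - (1 + r * y))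
         \<le> C' * ((norm x)\<^sup>2 + (norm y)\<^sup>2 + (norm e)\<^sup>2)"
      using fin xa unfolding T_def Q_def by simp
  qed
qed

lemma abs_Im_Ln_le: "\<bar>Im (Ln (1 + z))\<bar> \<le> 1 / 2" if "norm z \<le> 1 / 4"
  using norm_Ln_le[of z] abs_Im_le_cmod[of "Ln (1 + z)"] that by simp

text \<open>In \<open>cot_step\<close> the variable s moves by u/e. This differs from T by O(e^2),
  as Arctan z - z is cubic, and the factor cos u contributes only O(e^2) to the logarithm. Both are
  second-order errors.\<close>

lemma Arctan_increment:
  fixes e T :: complex
  assumes "e \<noteq> 0" "norm e \<le> 1 / 20" "norm T \<le> 2"
  defines "u \<equiv> Arctan (e * T)"
  shows "norm (u / e - T) \<le> 16 * (norm e)\<^sup>2" "norm (Ln (cos u)) \<le> 40 * (norm e)\<^sup>2"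
    "norm (cos u - 1) \<le> 1 / 4" "(e * T)\<^sup>2 \<noteq> -1"
proof -
  have eT: "norm (e * T) \<le> norm e * 2" unfolding norm_mult using assms by (intro mult_left_mono) auto
  then have eT': "norm (e * T) \<le> 1 / 10" using assms by simp
  have A: "norm (u - e * T) \<le> 2 * norm (e * T) ^ 3"
    unfolding u_def using eT' by (intro norm_Arctan_approx) simp
  also have "\<dots> \<le> 2 * (norm e * 2) ^ 3" using eT by (intro mult_left_mono power_mono) auto
  finally have A': "norm (u - e * T) \<le> 16 * norm e ^ 3" by (simp add: power3_eq_cube)
  have "u / e - T = (u - e * T) / e" using assms by (simp add: field_simps)
  then have "norm (u / e - T) = norm (u - e * T) / norm e" by (simp add: norm_divide)
  also have "\<dots> \<le> 16 * norm e ^ 3 / norm e" using A' by (intro divide_right_mono) auto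
  finally show "norm (u / e - T) \<le> 16 * (norm e)\<^sup>2"
    using assms by (simp add: power3_eq_cube power2_eq_square)
  have "2 * norm (e * T) ^ 3 \<le> 2 * (norm (e * T) * (1 / 10)\<^sup>2)"
    unfolding power3_eq_cube power2_eq_square mult.assoc using eT' by (intro mult_left_mono mult_mono) auto
  then have "norm u \<le> norm (e * T) + norm (e * T) / 50"
    using A norm_triangle_ineq[of "u - e * T" "e * T"] by (simp add: power2_eq_square)
  then have u: "norm u \<le> 4 * norm e" "norm u \<le> 1 / 5" using eT assms(2) norm_ge_zero[of e] by linarith+
  have "exp (norm u) \<le> 1 + norm u + (norm u)\<^sup>2" using u by (intro exp_bound) auto
  also have "\<dots> \<le> 1 + 1 / 5 + (1 / 5)\<^sup>2" using u by (intro add_mono power_mono) auto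
  finally have ex: "exp (norm u) \<le> 5 / 4" by (simp add: power2_eq_square)
  have "norm (cos u - 1) \<le> (norm u)\<^sup>2 * exp (norm u)" by (rule norm_cos_minus_1_bound)
  also have "\<dots> \<le> (norm u)\<^sup>2 * (5 / 4)" using ex by (intro mult_left_mono) auto
  finally have c: "norm (cos u - 1) \<le> 5 / 4 * (norm u)\<^sup>2" by simp
  have "(norm u)\<^sup>2 \<le> (1 / 5)\<^sup>2" using u by (intro power_mono) auto
  moreover have "(norm u)\<^sup>2 \<le> (4 * norm e)\<^sup>2" using u by (intro power_mono) auto
  ultimately have u2: "(norm u)\<^sup>2 \<le> 1 / 25" "(norm u)\<^sup>2 \<le> 16 * (norm e)\<^sup>2" by (simp_all add: power_mult_distrib power_divide)
  show c1: "norm (cos u - 1) \<le> 1 / 4" using c u2 by simp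
  have "norm (Ln (1 + (cos u - 1))) \<le> 2 * norm (cos u - 1)" using c1 by (intro norm_Ln_le) simp
  then show "norm (Ln (cos u)) \<le> 40 * (norm e)\<^sup>2" using c u2 by simp
  show "(e * T)\<^sup>2 \<noteq> -1"
  proof
    assume "(e * T)\<^sup>2 = -1"
    then have "norm (e * T) ^ 2 = 1" by (metis norm_minus_cancel norm_one norm_power)
    moreover have "norm (e * T) ^ 2 \<le> (1 / 10)\<^sup>2" using eT' by (intro power_mono) auto
    ultimately show False by (simp add: power2_eq_square)
  qed
qed

text \<open>The term \<open>q Ln (sin (\<epsilon> s) / \<epsilon>)\<close> absorbs the sum of the increments \<open>q x\<close> of \<open>s\<close>, because
  \<open>x = - \<epsilon> cot (\<epsilon> s)\<close> is minus the logarithmic derivative of \<open>sin (\<epsilon> s)\<close>.\<close>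

definition transit_coord :: "complex \<Rightarrow> complex \<Rightarrow> complex \<Rightarrow> complex" where
  "transit_coord q e s = s + q * Ln (sin (e * s) / e)"

text \<open>The positive real part of sin(es)/e keeps the argument of the old logarithm below
  \<pi>/2, and the new factor cos u/(1 + xa) changes it by at most 1. So the principal logarithm is
  additive here, and no branch has to be followed along the orbit.\<close>

lemma transit_step:
  fixes q r :: complex and C :: real
  assumes "0 \<le> C"
  obtains \<delta> C' where "0 < \<delta>" "\<delta> \<le> 1" "0 \<le> C'"
    "\<And>x (y::complex) (e::complex) a s. \<lbrakk>norm x < \<delta>; norm y < \<delta>; norm e < \<delta>; e \<noteq> 0;
        norm (a - (1 + (q + 1) * x + r * y)) \<le> C * ((norm x)\<^sup>2 + (norm y)\<^sup>2 + (norm e)\<^sup>2);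
        0 < Re (sin (e * s) / e); x * sin (e * s) = - e * cos (e * s)\<rbrakk> \<Longrightarrow>
       \<exists>s'. (x + (x\<^sup>2 + e\<^sup>2) * a) * sin (e * s') = - e * cos (e * s') \<and> norm (s' - s - 1) \<le> 1 / 2 \<and>
         norm (transit_coord q e s' - transit_coord q e s - (1 + r * y))
           \<le> C' * ((norm x)\<^sup>2 + (norm y)\<^sup>2 + (norm e)\<^sup>2)"
proof -
  obtain \<delta> C' where d: "0 < \<delta>" "\<delta> \<le> 1" "0 \<le> C'"
    and inc: "\<And>x (y::complex) (e::complex) a. \<lbrakk>norm x < \<delta>; norm y < \<delta>; norm e < \<delta>;
        norm (a - (1 + (q + 1) * x + r * y)) \<le> C * ((norm x)\<^sup>2 + (norm y)\<^sup>2 + (norm e)\<^sup>2)\<rbrakk> \<Longrightarrow>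
       norm (x * a) \<le> 1 / 4 \<and> norm (a / (1 + x * a) - 1) \<le> 1 / 4 \<and>
       norm (a / (1 + x * a) - q * Ln (1 + x * a) - (1 + r * y))
         \<le> C' * ((norm x)\<^sup>2 + (norm y)\<^sup>2 + (norm e)\<^sup>2)"
    using normal_form_increment[OF assms, of q r] by metis
  show thesis
  \<comment> \<open>The terms 16 and 40|q| are the e^2 errors of \<open>Arctan_increment\<close>,
    the second one multiplied by q in front of the logarithm.\<close>
  proof (rule that[of "min \<delta> (1 / 20)" "C' + 16 + 40 * norm q"])
    show "0 < min \<delta> (1 / 20)" "min \<delta> (1 / 20) \<le> 1" "0 \<le> C' + 16 + 40 * norm q" using d by auto
    fix x y e a s :: complex
    assume b: "norm x < min \<delta> (1 / 20)" "norm y < min \<delta> (1 / 20)" "norm e < min \<delta> (1 / 20)" and e0: "e \<noteq> 0"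
      and a: "norm (a - (1 + (q + 1) * x + r * y)) \<le> C * ((norm x)\<^sup>2 + (norm y)\<^sup>2 + (norm e)\<^sup>2)"
      and re: "0 < Re (sin (e * s) / e)" and xs: "x * sin (e * s) = - e * cos (e * s)"
    define T where "T = a / (1 + x * a)"
    define u where "u = Arctan (e * T)"
    define Q where "Q = (norm x)\<^sup>2 + (norm y)\<^sup>2 + (norm e)\<^sup>2"
    have I: "norm (x * a) \<le> 1 / 4" "norm (T - 1) \<le> 1 / 4"
      "norm (T - q * Ln (1 + x * a) - (1 + r * y)) \<le> C' * Q"
      using inc[of x y e a] b a unfolding T_def Q_def by auto
    have nz: "1 + x * a \<noteq> 0" using I(1) norm_diff_ineq[of 1 "x * a"] by auto
    have T2: "norm T \<le> 2" using I(2) norm_triangle_ineq[of "T - 1" 1] by simp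
    note AI = Arctan_increment[OF e0 _ T2, folded u_def]
    have A: "norm (u / e - T) \<le> 16 * (norm e)\<^sup>2" "norm (Ln (cos u)) \<le> 40 * (norm e)\<^sup>2"
      "norm (cos u - 1) \<le> 1 / 4" "(e * T)\<^sup>2 \<noteq> -1"
      using AI b by auto
    have s0: "sin (e * s) \<noteq> 0" using re by auto
    note cs = cot_step[OF e0 s0 xs nz A(4)[unfolded T_def], folded T_def, folded u_def]
    define s' where "s' = s + u / e"
    have es': "e * s' = e * s + u" using e0 by (simp add: s'_def field_simps)
    have w: "cos u / (1 + x * a) \<noteq> 0" using cs(1) nz by simp
    have im: "\<bar>Im (Ln (cos u))\<bar> \<le> 1 / 2" "\<bar>Im (Ln (1 + x * a))\<bar> \<le> 1 / 2"
      using abs_Im_Ln_le[OF A(3)] abs_Im_Ln_le[OF I(1)] by auto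
    have L1: "Ln (cos u / (1 + x * a)) = Ln (cos u) - Ln (1 + x * a)"
    proof (rule Ln_unique)
      show "exp (Ln (cos u) - Ln (1 + x * a)) = cos u / (1 + x * a)"
        using cs(1) nz by (simp add: exp_diff)
    qed (use im pi_gt3 in auto)
    have L2: "Ln (sin (e * s') / e) = Ln (sin (e * s) / e) + Ln (cos u / (1 + x * a))"
    proof -
      have "sin (e * s') / e = sin (e * s) / e * (cos u / (1 + x * a))"
        unfolding es' cs(2) by simp
      moreover have "Ln (sin (e * s) / e * (cos u / (1 + x * a))) = Ln (sin (e * s) / e) + Ln (cos u / (1 + x * a))"
        using Re_Ln_pos_lt_imp[OF re] im pi_gt3 s0 e0 w
        by (intro Ln_times_simple) (auto simp: L1)
      ultimately show ?thesis by simp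
    qed
    have "transit_coord q e s' - transit_coord q e s - (1 + r * y)
       = (T - q * Ln (1 + x * a) - (1 + r * y)) + (u / e - T) + q * Ln (cos u)"
      unfolding transit_coord_def L2 L1 by (simp add: s'_def algebra_simps)
    then have "norm (transit_coord q e s' - transit_coord q e s - (1 + r * y)) \<le>
       norm (T - q * Ln (1 + x * a) - (1 + r * y)) + norm (u / e - T) + norm (q * Ln (cos u))"
      by (metis add_right_mono norm_triangle_ineq order_trans)
    also have "\<dots> \<le> C' * Q + 16 * (norm e)\<^sup>2 + norm q * (40 * (norm e)\<^sup>2)"
      unfolding norm_mult using I A by (intro add_mono mult_left_mono) auto
    also have "\<dots> \<le> C' * Q + 16 * Q + norm q * (40 * Q)"
      using d by (intro add_mono mult_left_mono) (auto simp: Q_def)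
    finally have 1: "norm (transit_coord q e s' - transit_coord q e s - (1 + r * y))
        \<le> (C' + 16 + 40 * norm q) * Q" by (simp add: algebra_simps)
    have "(norm e)\<^sup>2 \<le> (1 / 20)\<^sup>2" using b by (intro power_mono) auto
    then have "norm (s' - s - 1) \<le> 1 / 2"
      using A(1) I(2) norm_triangle_ineq[of "u / e - T" "T - 1"] by (simp add: s'_def power2_eq_square)
    then show "\<exists>s'. (x + (x\<^sup>2 + e\<^sup>2) * a) * sin (e * s') = - e * cos (e * s') \<and> norm (s' - s - 1) \<le> 1 / 2 \<and>
         norm (transit_coord q e s' - transit_coord q e s - (1 + r * y))
           \<le> (C' + 16 + 40 * norm q) * ((norm x)\<^sup>2 + (norm y)\<^sup>2 + (norm e)\<^sup>2)"
      using 1 cs(3) unfolding es'[symmetric] Q_def by blast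
  qed
qed


section \<open>Transit through the gate between the fixed points\<close>

lemma norm_add3_le: "norm (a + b + c) \<le> norm a + norm b + norm c"
  by (intro order_trans[OF norm_triangle_ineq] add_mono order_refl)

text \<open>The range ends at 2.3 because in \<open>sin_over_bounds_half\<close> the real part is at
  most 15 percent above some \<theta> <= 2. At 2.3 the cubic Taylor polynomial t - t^3/6 is still
  above t/10.\<close>

lemma sin_ge_tenth: "t / 10 \<le> sin t" if "0 \<le> t" "t \<le> 23 / 10" for t :: real
proof -
  have "\<bar>sin t - t\<bar> \<le> t ^ 3 / 6"
    using Maclaurin_sin_bound[of t 3] that by (simp add: eval_nat_numeral sin_coeff_def)
  moreover have "t ^ 3 / 6 \<le> t * (9 / 10)"
  proof -
    have "t\<^sup>2 \<le> (23 / 10)\<^sup>2" using that by (intro power_mono) auto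
    then have "t * t\<^sup>2 \<le> t * (54 / 10)" using that by (intro mult_left_mono) (auto simp: power2_eq_square)
    then show ?thesis by (simp add: power3_eq_cube power2_eq_square)
  qed
  ultimately show ?thesis by linarith
qed

text \<open>As \<pi>/e is within A of the large real number n, e is almost \<pi>/n although it is
  complex, and es lies within 15 percent of the real number \<theta> = \<pi>k/n. There the sine is
  comparable to \<theta>, so sin(es)/e is comparable to k. For the real part, N is replaced by n at
  a cost of at most 25\<theta>A, which the size of n keeps below the main term.\<close>

lemma sin_over_bounds_half:
  fixes e s N :: complex and k n A :: real
  assumes e0: "e \<noteq> 0" and N: "N = of_real pi / e" and An: "norm (N - of_real n) \<le> A"
    and n: "1000 * (A + 1) \<le> n" and k: "0 < k" "k \<le> n / 2" and s: "norm (s - of_real k) \<le> k / 8"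
  shows "k / 16 \<le> norm (sin (e * s) / e)" "norm (sin (e * s) / e) \<le> 26 * k" "0 < Re (sin (e * s) / e)"
proof -
  have A0: "0 \<le> A" using An norm_ge_zero order_trans by blast
  have n0: "0 < n" "A \<le> n / 1000" using n A0 by auto
  have N0: "N \<noteq> 0" using N e0 by simp
  have nN: "999 / 1000 * n \<le> norm N" "norm N \<le> 1001 / 1000 * n"
    using An n0 norm_triangle_ineq[of "N - of_real n" "of_real n"] norm_triangle_ineq2[of "of_real n" "of_real n - N"]
      norm_minus_commute[of N "of_real n"] by auto
  define \<theta> where "\<theta> = pi * k / n"
  have \<theta>: "0 < \<theta>" "\<theta> \<le> 2"
    unfolding \<theta>_def using k n0 pi_less_4 pi_gt_zero mult_mono[of pi 4 k "n / 2"] by (auto simp: field_simps)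
  define z where "z = e * s"
  have sk: "norm (s * of_real n - of_real k * N) \<le> 15 / 100 * (k * norm N)"
  proof -
    have "s * of_real n - of_real k * N = (s - of_real k) * of_real n - of_real k * (N - of_real n)"
      by (simp add: algebra_simps)
    then have "norm (s * of_real n - of_real k * N) \<le> norm (s - of_real k) * n + k * norm (N - of_real n)"
      using norm_triangle_ineq4[of "(s - of_real k) * of_real n" "of_real k * (N - of_real n)"] k n0
      by (simp add: norm_mult)
    also have "\<dots> \<le> k / 8 * n + k * (n / 1000)"
      using s An n0 k by (intro add_mono mult_right_mono mult_left_mono) auto
    also have "\<dots> = k * (126 / 1000 * n)" by simp
    also have "\<dots> \<le> k * (15 / 100 * norm N)" using nN k n0 by (intro mult_left_mono) auto
    finally show ?thesis by simp
  qed
  have "z - of_real \<theta> = of_real (pi / n) * ((s * of_real n - of_real k * N) / N)"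
  proof -
    have "e = of_real pi / N" using N e0 by simp
    then show ?thesis using N0 n0 unfolding z_def \<theta>_def by (simp add: diff_divide_distrib right_diff_distrib)
  qed
  then have "norm (z - of_real \<theta>) = pi / n * (norm (s * of_real n - of_real k * N) / norm N)"
    using n0 by (simp add: norm_mult norm_divide)
  also have "\<dots> \<le> pi / n * (15 / 100 * (k * norm N) / norm N)"
    using n0 sk by (intro mult_left_mono divide_right_mono) auto
  also have "\<dots> = 15 / 100 * \<theta>" using N0 by (simp add: \<theta>_def)
  finally have z: "norm (z - of_real \<theta>) \<le> 15 / 100 * \<theta>" .
  have "\<bar>Re z - \<theta>\<bar> \<le> 15 / 100 * \<theta>" using z abs_Re_le_cmod[of "z - of_real \<theta>"] by simp
  then have rz: "85 / 100 * \<theta> \<le> Re z" "Re z \<le> 115 / 100 * \<theta>" by linarith+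
  have nz: "norm z \<le> 115 / 100 * \<theta>"
    using z \<theta> norm_triangle_ineq[of "z - of_real \<theta>" "of_real \<theta>"] by simp
  have sre: "85 / 1000 * \<theta> \<le> sin (Re z)"
    using sin_ge_tenth[of "Re z"] rz \<theta> by simp
  have "2 \<le> exp (Im z) + exp (- Im z)"
    using exp_ge_add_one_self[of "Im z"] exp_ge_add_one_self[of "- Im z"] by linarith
  then have "sin (Re z) * 2 \<le> sin (Re z) * (exp (Im z) + exp (- Im z))"
    using sre \<theta> by (intro mult_left_mono) auto
  then have res: "85 / 1000 * \<theta> \<le> Re (sin z)" using sre by (simp add: Re_sin)
  have "exp (norm z) \<le> exp (3 * 1)" using nz \<theta> by simp
  also have "\<dots> = exp 1 ^ 3" by (simp add: exp_of_nat_mult[symmetric])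
  also have "\<dots> \<le> (272 / 100) ^ 3" using e_less_272 by (intro power_mono) auto
  finally have ez: "exp (norm z) \<le> 21" by (simp add: power3_eq_cube)
  have "norm (sin z) \<le> norm z * exp (norm z)" by (rule norm_sin_bound)
  also have "\<dots> \<le> (115 / 100 * \<theta>) * 21" using nz ez \<theta> by (intro mult_mono) auto
  finally have ns: "norm (sin z) \<le> 25 * \<theta>" using \<theta> by simp
  have quot: "sin (e * s) / e = sin z * N / of_real pi" using N e0 unfolding z_def by simp
  have nq: "norm (sin (e * s) / e) = norm (sin z) * norm N / pi"
    unfolding quot by (simp add: norm_mult norm_divide)
  have "85 / 1000 * \<theta> * (999 / 1000 * n) \<le> norm (sin z) * norm N"
    using res abs_Re_le_cmod[of "sin z"] nN \<theta> n0 by (intro mult_mono) auto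
  moreover have "\<theta> * n = pi * k" unfolding \<theta>_def using n0 by simp
  ultimately have "85 / 1000 * (999 / 1000) * (pi * k) \<le> norm (sin z) * norm N" by (simp add: algebra_simps)
  then have "85 / 1000 * (999 / 1000) * k \<le> norm (sin z) * norm N / pi"
    by (simp add: field_simps)
  then show "k / 16 \<le> norm (sin (e * s) / e)" unfolding nq using k by linarith
  have "norm (sin z) * norm N \<le> 25 * \<theta> * (1001 / 1000 * n)"
    using ns nN \<theta> n0 by (intro mult_mono) auto
  then have "norm (sin z) * norm N \<le> 25 * (1001 / 1000) * (pi * k)"
    using \<open>\<theta> * n = pi * k\<close> by (simp add: algebra_simps)
  then have "norm (sin z) * norm N / pi \<le> 25 * (1001 / 1000) * k" by (simp add: field_simps)
  then show "norm (sin (e * s) / e) \<le> 26 * k" unfolding nq using k by linarith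
  have "Re (sin z * N) = n * Re (sin z) + Re (sin z * (N - of_real n))" by (simp add: algebra_simps)
  moreover have "- (25 * \<theta> * A) \<le> Re (sin z * (N - of_real n))"
  proof -
    have "norm (sin z * (N - of_real n)) \<le> 25 * \<theta> * A"
      unfolding norm_mult using ns An \<theta> by (intro mult_mono) auto
    then show ?thesis using abs_Re_le_cmod[of "sin z * (N - of_real n)"] by linarith
  qed
  moreover have "n * (85 / 1000 * \<theta>) \<le> n * Re (sin z)" using res n0 by (intro mult_left_mono) auto
  moreover have "0 < \<theta> * (n * (85 / 1000) - 25 * A)" using \<theta> n0 by (intro mult_pos_pos) auto
  ultimately have "0 < Re (sin z * N)" by (simp add: algebra_simps)
  then show "0 < Re (sin (e * s) / e)" unfolding quot by simp
qed

text \<open>The second half of the gate is the mirror image of the first: s and N - s give the same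
  sine. Replacing N by n costs A, and 24A <= m turns m/12 + A into the m/8 allowed in the first
  half.\<close>

lemma sin_over_bounds:
  fixes e s N :: complex and k n A m :: real
  assumes e0: "e \<noteq> 0" and N: "N = of_real pi / e" and An: "norm (N - of_real n) \<le> A"
    and n: "1000 * (A + 1) \<le> n" and m: "m = min k (n - k)" "0 < m" "24 * A \<le> m"
    and s: "norm (s - of_real k) \<le> m / 12"
  shows "m / 16 \<le> norm (sin (e * s) / e)" "norm (sin (e * s) / e) \<le> 26 * m" "0 < Re (sin (e * s) / e)"
proof -
  have "m / 16 \<le> norm (sin (e * s) / e) \<and> norm (sin (e * s) / e) \<le> 26 * m \<and> 0 < Re (sin (e * s) / e)"
  proof (cases "k \<le> n / 2")
    case True
    then have "m = k" using m by (auto simp: min_def)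
    with sin_over_bounds_half[OF e0 N An n, of k s] m s True show ?thesis by auto
  next
    case False
    then have mk: "m = n - k" using m by (auto simp: min_def)
    have eq: "(N - s) - of_real m = (N - of_real n) - (s - of_real k)" by (simp add: mk)
    have "norm ((N - s) - of_real m) \<le> A + m / 12"
      unfolding eq using An s norm_triangle_ineq4[of "N - of_real n" "s - of_real k"] by simp
    then have "norm ((N - s) - of_real m) \<le> m / 8" using m(2,3) by linarith
    moreover have "sin (e * (N - s)) = sin (e * s)"
    proof -
      have "e * (N - s) = of_real pi - e * s" using N e0 by (simp add: algebra_simps)
      then show ?thesis by (simp add: sin_diff)
    qed
    ultimately show ?thesis using sin_over_bounds_half[OF e0 N An n, of m "N - s"] m mk False by auto
  qed
  then show "m / 16 \<le> norm (sin (e * s) / e)" "norm (sin (e * s) / e) \<le> 26 * m" "0 < Re (sin (e * s) / e)"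
    by auto
qed

text \<open>Since sin^2 + cos^2 = 1, x^2 + e^2 is the square of e/sin(es), so the bound 256/m^2 is
  the lower bound m/16 of \<open>sin_over_bounds\<close>. From n >= 2m comes |e| <= 3/m, and 256 + 9
  <= 17^2 gives the bound on x.\<close>

lemma transit_bounds:
  fixes e s x :: complex and k n A m :: real
  assumes e0: "e \<noteq> 0" and An: "norm (of_real pi / e - of_real n) \<le> A"
    and n: "1000 * (A + 1) \<le> n" and m: "m = min k (n - k)" "0 < m" "24 * A \<le> m"
    and s: "norm (s - of_real k) \<le> m / 12" and x: "x * sin (e * s) = - e * cos (e * s)"
  shows "norm e \<le> 3 / m" "norm (x\<^sup>2 + e\<^sup>2) \<le> 256 / m\<^sup>2" "norm x \<le> 17 / m"
    "0 < Re (sin (e * s) / e)" "16 \<le> m \<Longrightarrow> norm (Ln (sin (e * s) / e)) \<le> ln (26 * m) + 4"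
proof -
  note b = sin_over_bounds[OF e0 refl An n m s]
  show "0 < Re (sin (e * s) / e)" by (rule b)
  have A0: "0 \<le> A" using An norm_ge_zero order_trans by blast
  have mn: "m \<le> n / 2" using m by (auto simp: min_def)
  have npe: "norm (of_real pi / e) = pi / norm e" by (simp add: norm_divide)
  have "n \<le> norm (of_real pi / e) + A"
    using An norm_triangle_ineq2[of "of_real n" "of_real pi / e"] norm_minus_commute[of "of_real pi / e" "of_real n"]
    by simp
  then have "n - A \<le> pi / norm e" unfolding npe by simp
  moreover have "n * (999 / 1000) \<le> n - A" using n A0 by simp
  ultimately have "n * (999 / 1000) \<le> pi / norm e" by linarith
  then have "norm e * (n * (999 / 1000)) \<le> pi" using e0 by (simp add: field_simps)
  moreover have "norm e * (2 * m) \<le> norm e * n" using mn by (intro mult_left_mono) auto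
  ultimately have "norm e * m \<le> 3" using pi_less_4 by simp
  then show ne: "norm e \<le> 3 / m" using m by (simp add: field_simps)
  have s0: "sin (e * s) \<noteq> 0" using b(3) by auto
  have "(x * sin (e * s))\<^sup>2 = (- e * cos (e * s))\<^sup>2" using x by simp
  then have "x\<^sup>2 * (sin (e * s))\<^sup>2 = e\<^sup>2 * (cos (e * s))\<^sup>2" by (simp add: power_mult_distrib)
  then have "(x\<^sup>2 + e\<^sup>2) * (sin (e * s))\<^sup>2 = e\<^sup>2 * ((cos (e * s))\<^sup>2 + (sin (e * s))\<^sup>2)"
    by (simp only: distrib_left distrib_right)
  then have sq: "(x\<^sup>2 + e\<^sup>2) * (sin (e * s) / e)\<^sup>2 = 1"
    using e0 by (simp add: power_divide)
  have "norm (x\<^sup>2 + e\<^sup>2) * (norm (sin (e * s) / e))\<^sup>2 = 1"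
    by (metis norm_mult norm_one norm_power sq)
  moreover have "norm (x\<^sup>2 + e\<^sup>2) * (m / 16)\<^sup>2 \<le> norm (x\<^sup>2 + e\<^sup>2) * (norm (sin (e * s) / e))\<^sup>2"
    using b(1) m by (intro mult_left_mono power_mono) auto
  ultimately have "norm (x\<^sup>2 + e\<^sup>2) * m\<^sup>2 \<le> 256" by (simp add: power_divide)
  then show X: "norm (x\<^sup>2 + e\<^sup>2) \<le> 256 / m\<^sup>2" using m(2) by (simp add: pos_le_divide_eq)
  have "(norm x)\<^sup>2 \<le> norm (x\<^sup>2 + e\<^sup>2) + (norm e)\<^sup>2"
    using norm_triangle_ineq4[of "x\<^sup>2 + e\<^sup>2" "e\<^sup>2"] by (simp add: norm_power)
  also have "\<dots> \<le> 256 / m\<^sup>2 + (3 / m)\<^sup>2" using X ne by (intro add_mono power_mono) auto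
  also have "\<dots> \<le> (17 / m)\<^sup>2" using m by (simp add: field_simps power2_eq_square)
  finally show "norm x \<le> 17 / m" by (rule power2_le_imp_le) (use m in auto)
  assume m16: "16 \<le> m"
  let ?w = "sin (e * s) / e"
  have w0: "?w \<noteq> 0" using b(3) by auto
  have "1 \<le> norm ?w" using b(1) m16 by linarith
  then have "0 \<le> Re (Ln ?w)" "Re (Ln ?w) \<le> ln (26 * m)"
    using w0 b(2) m by (auto simp: Re_Ln)
  moreover have "\<bar>Im (Ln ?w)\<bar> \<le> 4"
    using mpi_less_Im_Ln[OF w0] Im_Ln_le_pi[OF w0] pi_less_4 by linarith
  ultimately show "norm (Ln ?w) \<le> ln (26 * m) + 4" using cmod_le[of "Ln ?w"] by linarith
qed

text \<open>A bootstrap, with m the distance of the time k from the ends 0 and n. If |s - k| <=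
  m/16, then one step later it is at most m/12, which is enough for the bounds on sin(es)/e; the
  accumulated transit coordinate then restores m/16, as s differs from it only by a logarithm. The
  errors are O(1/m^2) per step and add up to O(1/M). \<open>M0\<close> and \<open>K\<close> come
  before M, n and e, so that e can tend to 0 at fixed M and M can grow afterwards.\<close>

lemma transit:
  fixes q r :: complex and C G \<rho> A C0 Cy \<delta>0 :: real
  assumes "0 \<le> C" "0 \<le> G" "0 \<le> \<rho>" "\<rho> < 1" "0 \<le> A" "0 \<le> C0" "0 \<le> Cy" "0 < \<delta>0"
  obtains M0 :: nat and K where "0 < M0" "0 < K"
    "\<And>(M::nat) (n::nat) (e::complex) (x :: nat \<Rightarrow> complex) (y :: nat \<Rightarrow> complex) s0.
      \<lbrakk>M0 \<le> M; e \<noteq> 0; norm (of_real pi / e - of_nat n) \<le> A;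
       x M * sin (e * s0) = - e * cos (e * s0); norm (s0 - of_nat M) \<le> real M / 16;
       norm (transit_coord q e s0 - of_nat M) \<le> C0; norm (y M) \<le> Cy / (real M)\<^sup>2;
       \<And>k. \<lbrakk>M \<le> k; k < n - M; \<forall>j. M \<le> j \<longrightarrow> j \<le> k \<longrightarrow> norm (x j) < \<delta>0 \<and> norm (y j) < \<delta>0; norm e < \<delta>0\<rbrakk> \<Longrightarrow>
         \<exists>a b g. x (Suc k) = x k + ((x k)\<^sup>2 + e\<^sup>2) * a \<and> y (Suc k) = b * y k + ((x k)\<^sup>2 + e\<^sup>2) * g \<and>
           norm (a - (1 + (q + 1) * x k + r * y k)) \<le> C * ((norm (x k))\<^sup>2 + (norm (y k))\<^sup>2 + (norm e)\<^sup>2) \<and>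
           norm b \<le> \<rho> \<and> norm g \<le> G\<rbrakk> \<Longrightarrow>
      \<forall>k. M \<le> k \<longrightarrow> k + M \<le> n \<longrightarrow>
        norm e < \<delta>0 \<and> norm (x k) < \<delta>0 \<and> norm (y k) < \<delta>0 \<and>
        norm (x k) \<le> K / min (real k) (real n - real k) \<and> norm (y k) \<le> K / (min (real k) (real n - real k))\<^sup>2 \<and>
        (\<exists>s. x k * sin (e * s) = - e * cos (e * s) \<and> norm (s - of_nat k) \<le> min (real k) (real n - real k) / 12 \<and>
          norm (transit_coord q e s - transit_coord q e s0 - (of_nat k - of_nat M)) \<le> K / real M)"
proof -
  obtain \<delta>1 C' where d1: "0 < \<delta>1" "\<delta>1 \<le> 1" "0 \<le> C'"
    and vstep: "\<And>x (y::complex) (e::complex) a s. \<lbrakk>norm x < \<delta>1; norm y < \<delta>1; norm e < \<delta>1; e \<noteq> 0;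
        norm (a - (1 + (q + 1) * x + r * y)) \<le> C * ((norm x)\<^sup>2 + (norm y)\<^sup>2 + (norm e)\<^sup>2);
        0 < Re (sin (e * s) / e); x * sin (e * s) = - e * cos (e * s)\<rbrakk> \<Longrightarrow>
       \<exists>s'. (x + (x\<^sup>2 + e\<^sup>2) * a) * sin (e * s') = - e * cos (e * s') \<and> norm (s' - s - 1) \<le> 1 / 2 \<and>
         norm (transit_coord q e s' - transit_coord q e s - (1 + r * y))
           \<le> C' * ((norm x)\<^sup>2 + (norm y)\<^sup>2 + (norm e)\<^sup>2)"
    using transit_step[OF assms(1), of q r] by metis
  \<comment> \<open>Y is so large that \<rho>Y + 256G <= (1 + \<rho>)Y/2, which lets the bound Y/m^2
    on y reproduce itself. E/m^2 bounds the error of one step, with 298 = 17^2 + 3^2 from the bounds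
    on x and e.\<close>
  define Y where "Y = max Cy (512 * G / (1 - \<rho>)) + 1"
  define E where "E = norm r * Y + C' * (298 + Y\<^sup>2)"
  define \<delta> where "\<delta> = min \<delta>0 \<delta>1"
  have \<delta>0: "0 < \<delta>" unfolding \<delta>_def using d1 assms(8) by simp
  have Y: "Cy \<le> Y" "1 \<le> Y" "512 * G \<le> (1 - \<rho>) * Y"
  proof -
    show "Cy \<le> Y" "1 \<le> Y" unfolding Y_def using assms by auto
    have "512 * G / (1 - \<rho>) \<le> Y" unfolding Y_def by auto
    then show "512 * G \<le> (1 - \<rho>) * Y" using assms by (simp add: field_simps)
  qed
  have E0: "0 \<le> E" unfolding E_def using Y d1 by (intro add_nonneg_nonneg mult_nonneg_nonneg) auto
  \<comment> \<open>The first inequality closes the bootstrap. The second says that the contraction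
    outweighs the change of Y/m^2 when m grows by 1.\<close>
  have "\<forall>\<^sub>F m in at_top. C0 + 3 * E + norm q * (ln (26 * m) + 4) \<le> m / 16" by real_asymp
  moreover have "\<forall>\<^sub>F m in at_top. (1 + \<rho>) / 2 * (m + 1)\<^sup>2 \<le> m\<^sup>2"
    using assms(4) by real_asymp
  moreover have "\<forall>\<^sub>F m :: real in at_top. 17 / m < \<delta>" using \<delta>0 by real_asymp
  moreover have "\<forall>\<^sub>F m :: real in at_top. Y / m\<^sup>2 < \<delta>" using \<delta>0 by real_asymp
  moreover have "\<forall>\<^sub>F m :: real in at_top. 1000 * (A + 1) \<le> m \<and> 27 \<le> m"
    using eventually_ge_at_top[of "1000 * (A + 1)"] eventually_ge_at_top[of 27] by eventually_elim auto
  ultimately have "\<forall>\<^sub>F m in at_top. C0 + 3 * E + norm q * (ln (26 * m) + 4) \<le> m / 16 \<and>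
      (1 + \<rho>) / 2 * (m + 1)\<^sup>2 \<le> m\<^sup>2 \<and> 17 / m < \<delta> \<and> Y / m\<^sup>2 < \<delta> \<and> 1000 * (A + 1) \<le> m \<and> 27 \<le> m"
    by eventually_elim auto
  then obtain m0 where m0: "\<And>m. m0 \<le> m \<Longrightarrow> C0 + 3 * E + norm q * (ln (26 * m) + 4) \<le> m / 16 \<and>
      (1 + \<rho>) / 2 * (m + 1)\<^sup>2 \<le> m\<^sup>2 \<and> 17 / m < \<delta> \<and> Y / m\<^sup>2 < \<delta> \<and> 1000 * (A + 1) \<le> m \<and> 27 \<le> m"
    unfolding eventually_at_top_linorder by blast
  define M0 where "M0 = max 27 (nat \<lceil>m0\<rceil>)"
  have M0: "m0 \<le> m" if "real M0 \<le> m" for m using that unfolding M0_def by linarith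
  show thesis
  proof (rule that[of M0 "max 17 (max Y (3 * E))"])
    show "0 < M0" "0 < max 17 (max Y (3 * E))" unfolding M0_def by auto
    fix M n :: nat and e :: complex and x y :: "nat \<Rightarrow> complex" and s0
    assume M: "M0 \<le> M" and e0: "e \<noteq> 0" and An': "norm (of_real pi / e - of_nat n) \<le> A"
      and xM: "x M * sin (e * s0) = - e * cos (e * s0)" and s0: "norm (s0 - of_nat M) \<le> real M / 16"
      and v0: "norm (transit_coord q e s0 - of_nat M) \<le> C0" and yM: "norm (y M) \<le> Cy / (real M)\<^sup>2"
      and dyn: "\<And>k. \<lbrakk>M \<le> k; k < n - M; \<forall>j. M \<le> j \<longrightarrow> j \<le> k \<longrightarrow> norm (x j) < \<delta>0 \<and> norm (y j) < \<delta>0; norm e < \<delta>0\<rbrakk> \<Longrightarrow>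
         \<exists>a b g. x (Suc k) = x k + ((x k)\<^sup>2 + e\<^sup>2) * a \<and> y (Suc k) = b * y k + ((x k)\<^sup>2 + e\<^sup>2) * g \<and>
           norm (a - (1 + (q + 1) * x k + r * y k)) \<le> C * ((norm (x k))\<^sup>2 + (norm (y k))\<^sup>2 + (norm e)\<^sup>2) \<and>
           norm b \<le> \<rho> \<and> norm g \<le> G"
    have An: "norm (of_real pi / e - of_real (real n)) \<le> A" using An' by simp
    define m where "m k = min (real k) (real n - real k)" for k :: nat
    have M27: "27 \<le> M" using M unfolding M0_def by simp
    have mM: "real M \<le> m k" if "M \<le> k" "k + M \<le> n" for k
      using that unfolding m_def by auto
    have mprop: "C0 + 3 * E + norm q * (ln (26 * m k) + 4) \<le> m k / 16 \<and>
      (1 + \<rho>) / 2 * (m k + 1)\<^sup>2 \<le> (m k)\<^sup>2 \<and> 17 / m k < \<delta> \<and> Y / (m k)\<^sup>2 < \<delta> \<and>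
      1000 * (A + 1) \<le> m k \<and> 27 \<le> m k" if "M \<le> k" "k + M \<le> n" for k
    proof (rule m0, rule M0)
      show "real M0 \<le> m k" using mM[OF that] M by linarith
    qed
    \<comment> \<open>A telescoping majorant of the sum of E/m^2, equal to 0 at k = M: as 1/m^2 <=
      1/k^2 + 1/(n - k)^2, each end contributes a difference of reciprocals.\<close>
    define B where "B k = E * ((1 / (real M - 1) - 1 / (real k - 1)) + (1 / (real n - real k) - 1 / (real n - real M)))" for k
    have B: "B k \<le> 3 * E / real M" if k: "M \<le> k" "k + M \<le> n" for k
    proof -
      have "1 / (real n - real k) \<le> 1 / real M" using k M27 by (intro divide_left_mono) auto
      moreover have "1 / (real M - 1) \<le> 2 / real M" using M27 by (simp add: field_simps)
      moreover have "0 \<le> 1 / (real k - 1)" "0 \<le> 1 / (real n - real M)" using k M27 by auto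
      ultimately have "1 / (real M - 1) - 1 / (real k - 1) + (1 / (real n - real k) - 1 / (real n - real M)) \<le> 3 / real M"
        by linarith
      from mult_left_mono[OF this E0] show ?thesis unfolding B_def by (simp add: mult.commute[of _ E])
    qed
    \<comment> \<open>Smallness at all times since M is carried along, because \<open>dyn\<close>
      grants the recursion only while the orbit has stayed small since then.\<close>
    have main: "(\<forall>j. M \<le> j \<longrightarrow> j \<le> k \<longrightarrow> norm (x j) < \<delta> \<and> norm (y j) < \<delta>) \<and> norm e < \<delta> \<and> norm (x k) < \<delta> \<and> norm (y k) < \<delta> \<and> norm (x k) \<le> 17 / m k \<and> norm (y k) \<le> Y / (m k)\<^sup>2 \<and>
      (\<exists>s. x k * sin (e * s) = - e * cos (e * s) \<and> norm (s - of_nat k) \<le> m k / 16 \<and>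
          norm (transit_coord q e s - transit_coord q e s0 - (of_nat k - of_nat M)) \<le> B k)"
      if "M \<le> k" "k + M \<le> n" for k
      using that
    proof (induction k rule: nat_induct_at_least)
      case base
      have "real M \<le> real n - real M" using base by linarith
      then have mp: "0 < m M" "m M = real M" using M27 by (simp_all add: m_def)
      have Ab: "1000 * (A + 1) \<le> real n" "24 * A \<le> m M"
        using mprop[of M] base mp assms(5) by auto
      have tb: "norm e \<le> 3 / m M" "norm (x M) \<le> 17 / m M"
        using transit_bounds[OF e0 An Ab(1) m_def[of M] mp(1) Ab(2) _ xM] s0 mp by auto
      have y: "norm (y M) \<le> Y / (m M)\<^sup>2"
        using yM Y(1) unfolding mp(2) by (meson divide_right_mono order_trans zero_le_power2)
      have "3 / m M \<le> 17 / m M" using mp by (intro divide_right_mono) auto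
      then have "norm e < \<delta>" "norm (x M) < \<delta>" "norm (y M) < \<delta>"
        using tb y mprop[of M] base by auto
      moreover have "norm (transit_coord q e s0 - transit_coord q e s0 - (of_nat M - of_nat M)) \<le> B M"
        unfolding B_def by simp
      ultimately show ?case using xM s0 tb y mp(2) le_antisym by auto
    next
      case (Suc k)
      then have k: "M \<le> k" "k + M \<le> n" "k < n - M" by auto
      from Suc.IH[OF k(2)] obtain s where J: "\<forall>j. M \<le> j \<longrightarrow> j \<le> k \<longrightarrow> norm (x j) < \<delta> \<and> norm (y j) < \<delta>"
        and I: "norm e < \<delta>" "norm (x k) < \<delta>" "norm (y k) < \<delta>"
        "norm (x k) \<le> 17 / m k" "norm (y k) \<le> Y / (m k)\<^sup>2" and
        s: "x k * sin (e * s) = - e * cos (e * s)" "norm (s - of_nat k) \<le> m k / 16"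
          "norm (transit_coord q e s - transit_coord q e s0 - (of_nat k - of_nat M)) \<le> B k" by blast
      have mk: "27 \<le> m k" "24 * A \<le> m k" "1000 * (A + 1) \<le> real n" 
        using mprop[OF k(1,2)] assms(5) unfolding m_def by auto
      have mk0: "0 < m k" using mk by simp
      have tb: "norm e \<le> 3 / m k" "norm ((x k)\<^sup>2 + e\<^sup>2) \<le> 256 / (m k)\<^sup>2" "0 < Re (sin (e * s) / e)"
        using transit_bounds[OF e0 An mk(3) m_def[of k] mk0 mk(2) _ s(1)] s(2) mk0 by auto
      obtain a b g where D: "x (Suc k) = x k + ((x k)\<^sup>2 + e\<^sup>2) * a" "y (Suc k) = b * y k + ((x k)\<^sup>2 + e\<^sup>2) * g"
        "norm (a - (1 + (q + 1) * x k + r * y k)) \<le> C * ((norm (x k))\<^sup>2 + (norm (y k))\<^sup>2 + (norm e)\<^sup>2)"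
        "norm b \<le> \<rho>" "norm g \<le> G"
        using dyn[OF k(1,3)] J I(1) unfolding \<delta>_def by auto
      obtain s' where s': "x (Suc k) * sin (e * s') = - e * cos (e * s')" "norm (s' - s - 1) \<le> 1 / 2"
        "norm (transit_coord q e s' - transit_coord q e s - (1 + r * y k))
           \<le> C' * ((norm (x k))\<^sup>2 + (norm (y k))\<^sup>2 + (norm e)\<^sup>2)"
        using vstep[of "x k" "y k" e a s] I D(1,3) s(1) tb(3) e0 unfolding \<delta>_def by auto
      have k': "M \<le> Suc k" "Suc k + M \<le> n" using Suc by auto
      have mk': "27 \<le> m (Suc k)" "24 * A \<le> m (Suc k)"
        using mprop[OF k'] assms(5) unfolding m_def by auto
      have mm: "m (Suc k) \<le> m k + 1" "m k \<le> m (Suc k) + 1" unfolding m_def by auto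
      have mk0': "0 < m (Suc k)" using mk' by simp
      have eq1: "s' - of_nat (Suc k) = (s' - s - 1) + (s - of_nat k)" by simp
      \<comment> \<open>As m drops by at most 1, the bound at the new time is 1/2 + (m + 1)/16 with
        the new m. This is at most m/12 exactly when m >= 27, the constant in the choice of
        \<open>M0\<close>.\<close>
      have "norm (s' - of_nat (Suc k)) \<le> 1 / 2 + m k / 16"
        unfolding eq1 using s'(2) s(2) by (rule norm_triangle_mono)
      then have s12: "norm (s' - of_nat (Suc k)) \<le> m (Suc k) / 12" using mm mk' by linarith
      have s12': "norm (s' - of_real (real (Suc k))) \<le> m (Suc k) / 12" using s12 by simp
      note tb' = transit_bounds[OF e0 An mk(3) m_def[of "Suc k"] mk0' mk'(2) s12' s'(1)]
      have y': "norm (y (Suc k)) \<le> Y / (m (Suc k))\<^sup>2"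
      proof -
        have "norm (y (Suc k)) \<le> norm b * norm (y k) + norm ((x k)\<^sup>2 + e\<^sup>2) * norm g"
          unfolding D(2) norm_mult[symmetric] by (rule norm_triangle_ineq)
        also have "\<dots> \<le> \<rho> * (Y / (m k)\<^sup>2) + 256 / (m k)\<^sup>2 * G"
          using D I tb assms by (intro add_mono mult_mono) auto
        also have "\<dots> = (\<rho> * Y + 256 * G) / (m k)\<^sup>2" by (simp add: add_divide_distrib)
        also have "\<dots> \<le> ((1 + \<rho>) / 2 * Y) / (m k)\<^sup>2"
          using Y(3) by (intro divide_right_mono) (auto simp: algebra_simps)
        also have "\<dots> \<le> Y / (m (Suc k))\<^sup>2"
        proof -
          have "(1 + \<rho>) / 2 * (m (Suc k))\<^sup>2 \<le> (1 + \<rho>) / 2 * (m k + 1)\<^sup>2"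
            using mm mk0' assms by (intro mult_left_mono power_mono) auto
          also have "\<dots> \<le> (m k)\<^sup>2" using mprop[OF k(1,2)] unfolding m_def by auto
          finally have "Y * ((1 + \<rho>) / 2 * (m (Suc k))\<^sup>2) \<le> Y * (m k)\<^sup>2" using Y by (intro mult_left_mono) auto
          then show ?thesis using mk0 mk0' by (simp add: field_simps)
        qed
        finally show ?thesis .
      qed
      have sq: "(norm (x k))\<^sup>2 + (norm (y k))\<^sup>2 + (norm e)\<^sup>2 \<le> (298 + Y\<^sup>2) / (m k)\<^sup>2"
      proof -
        have "(norm (x k))\<^sup>2 \<le> (17 / m k)\<^sup>2" "(norm e)\<^sup>2 \<le> (3 / m k)\<^sup>2"
          using I tb by (auto intro!: power_mono)
        moreover have "(norm (y k))\<^sup>2 \<le> (Y / m k)\<^sup>2"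
        proof (rule power_mono)
          have "Y / (m k)\<^sup>2 \<le> Y / m k"
            using mk Y by (intro divide_left_mono) (auto simp: power2_eq_square)
          then show "norm (y k) \<le> Y / m k" using I by linarith
        qed auto
        ultimately show ?thesis by (simp add: power_divide add_divide_distrib)
      qed
      have eq: "transit_coord q e s' - transit_coord q e s0 - (of_nat (Suc k) - of_nat M) =
          (transit_coord q e s' - transit_coord q e s - (1 + r * y k)) + r * y k +
          (transit_coord q e s - transit_coord q e s0 - (of_nat k - of_nat M))" by simp
      have "norm (transit_coord q e s' - transit_coord q e s0 - (of_nat (Suc k) - of_nat M)) \<le>
          norm (transit_coord q e s' - transit_coord q e s - (1 + r * y k)) + norm (r * y k) +
          norm (transit_coord q e s - transit_coord q e s0 - (of_nat k - of_nat M))"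
        unfolding eq by (rule norm_add3_le)
      also have "\<dots> \<le> C' * ((298 + Y\<^sup>2) / (m k)\<^sup>2) + norm r * (Y / (m k)\<^sup>2) + B k"
      proof (intro add_mono s(3))
        show "norm (transit_coord q e s' - transit_coord q e s - (1 + r * y k)) \<le> C' * ((298 + Y\<^sup>2) / (m k)\<^sup>2)"
          using s'(3) mult_left_mono[OF sq d1(3)] by linarith
        show "norm (r * y k) \<le> norm r * (Y / (m k)\<^sup>2)"
          unfolding norm_mult using I by (intro mult_left_mono) auto
      qed
      also have "\<dots> = E / (m k)\<^sup>2 + B k" unfolding E_def by (simp add: add_divide_distrib distrib_left)
      also have "\<dots> \<le> B (Suc k)"
      proof -
        have "1 / (m k)\<^sup>2 \<le> 1 / (real k)\<^sup>2 + 1 / (real n - real k)\<^sup>2"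
          unfolding m_def min_def by auto
        also have "\<dots> \<le> (1 / (real k - 1) - 1 / real k) + (1 / (real n - real k - 1) - 1 / (real n - real k))"
        proof -
          have tele: "1 / t\<^sup>2 \<le> 1 / (t - 1) - 1 / t" if "1 < t" for t :: real
          proof -
            have "1 / (t - 1) - 1 / t = 1 / ((t - 1) * t)" using that by (simp add: field_simps)
            moreover have "1 / t\<^sup>2 \<le> 1 / ((t - 1) * t)"
              using that by (intro divide_left_mono) (auto simp: power2_eq_square intro: mult_right_mono)
            ultimately show ?thesis by simp
          qed
          show ?thesis using k M27 by (intro add_mono tele) auto
        qed
        finally have "E * (1 / (m k)\<^sup>2) \<le> E * ((1 / (real k - 1) - 1 / real k) + (1 / (real n - real k - 1) - 1 / (real n - real k)))"
          using E0 by (rule mult_left_mono)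
        then show ?thesis unfolding B_def by (simp add: algebra_simps)
      qed
      finally have v': "norm (transit_coord q e s' - transit_coord q e s0 - (of_nat (Suc k) - of_nat M)) \<le> B (Suc k)" .
      have "3 * E / real M \<le> 3 * E / 1" using E0 M27 by (intro divide_left_mono) auto
      then have B3: "B (Suc k) \<le> 3 * E" using B[OF k'] by linarith
      \<comment> \<open>s is read back from the transit coordinate; the logarithm costs only O(ln
        m), which is how m/16 is recovered.\<close>
      have eq2: "s' - of_nat (Suc k) = (transit_coord q e s' - transit_coord q e s0 - (of_nat (Suc k) - of_nat M))
          + (transit_coord q e s0 - of_nat M) + (- (q * Ln (sin (e * s') / e)))"
        unfolding transit_coord_def by simp
      have "norm (s' - of_nat (Suc k)) \<le> norm (transit_coord q e s' - transit_coord q e s0 - (of_nat (Suc k) - of_nat M))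
          + norm (transit_coord q e s0 - of_nat M) + norm (q * Ln (sin (e * s') / e))"
        unfolding eq2 norm_minus_cancel[of "q * Ln (sin (e * s') / e)", symmetric] by (rule norm_add3_le)
      also have "\<dots> \<le> 3 * E + C0 + norm q * (ln (26 * m (Suc k)) + 4)"
        unfolding norm_mult using v' B3 v0 tb'(5) mk' by (intro add_mono mult_left_mono) auto
      also have "\<dots> \<le> m (Suc k) / 16" using mprop[OF k'] unfolding m_def by auto
      finally have s16: "norm (s' - of_nat (Suc k)) \<le> m (Suc k) / 16" .
      have "3 / m (Suc k) \<le> 17 / m (Suc k)" using mk0' by (intro divide_right_mono) auto
      then have sm: "norm e < \<delta>" "norm (x (Suc k)) < \<delta>" "norm (y (Suc k)) < \<delta>"
        using tb'(1,3) y' mprop[OF k'] unfolding m_def by auto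
      then have "\<forall>j. M \<le> j \<longrightarrow> j \<le> Suc k \<longrightarrow> norm (x j) < \<delta> \<and> norm (y j) < \<delta>"
        using J by (auto simp: le_Suc_eq)
      with sm show ?case using s'(1) s16 v' tb'(3) y' by blast
    qed
    show "\<forall>k. M \<le> k \<longrightarrow> k + M \<le> n \<longrightarrow>
        norm e < \<delta>0 \<and> norm (x k) < \<delta>0 \<and> norm (y k) < \<delta>0 \<and>
        norm (x k) \<le> max 17 (max Y (3 * E)) / min (real k) (real n - real k) \<and>
        norm (y k) \<le> max 17 (max Y (3 * E)) / (min (real k) (real n - real k))\<^sup>2 \<and>
        (\<exists>s. x k * sin (e * s) = - e * cos (e * s) \<and> norm (s - of_nat k) \<le> min (real k) (real n - real k) / 12 \<and>
          norm (transit_coord q e s - transit_coord q e s0 - (of_nat k - of_nat M)) \<le> max 17 (max Y (3 * E)) / real M)"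
    proof (intro allI impI)
      fix k assume k: "M \<le> k" "k + M \<le> n"
      let ?K = "max 17 (max Y (3 * E))"
      from main[OF k] obtain s where I: "norm e < \<delta>" "norm (x k) < \<delta>" "norm (y k) < \<delta>"
        "norm (x k) \<le> 17 / m k" "norm (y k) \<le> Y / (m k)\<^sup>2" and
        s: "x k * sin (e * s) = - e * cos (e * s)" "norm (s - of_nat k) \<le> m k / 16"
          "norm (transit_coord q e s - transit_coord q e s0 - (of_nat k - of_nat M)) \<le> B k" by blast
      have mk0: "0 < m k" using mM[OF k] M27 by simp
      have "norm (x k) \<le> ?K / m k" "norm (y k) \<le> ?K / (m k)\<^sup>2"
        using I mk0 by (auto elim!: order_trans intro!: divide_right_mono)
      moreover have "norm (s - of_nat k) \<le> m k / 12" using s mk0 by linarith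
      moreover have "3 * E / real M \<le> ?K / real M" by (intro divide_right_mono) auto
      then have "norm (transit_coord q e s - transit_coord q e s0 - (of_nat k - of_nat M)) \<le> ?K / real M"
        using s(3) B[OF k] by linarith
      ultimately show "norm e < \<delta>0 \<and> norm (x k) < \<delta>0 \<and> norm (y k) < \<delta>0 \<and>
        norm (x k) \<le> ?K / min (real k) (real n - real k) \<and>
        norm (y k) \<le> ?K / (min (real k) (real n - real k))\<^sup>2 \<and>
        (\<exists>s. x k * sin (e * s) = - e * cos (e * s) \<and> norm (s - of_nat k) \<le> min (real k) (real n - real k) / 12 \<and>
          norm (transit_coord q e s - transit_coord q e s0 - (of_nat k - of_nat M)) \<le> ?K / real M)"
        using I s(1) unfolding m_def \<delta>_def by auto
    qed
  qed
qed


section \<open>Incoming and outgoing orbits of the semi-parabolic map\<close>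

text \<open>The contraction outweighs the slow change of 1/n^2, so the forcing decides the rate: K
  satisfies \<rho>K + c <= (1 + \<rho>)K/2, and (1 + \<rho>)(n + 1)^2/2 <= n^2 for large n.\<close>

lemma forward_decay:
  fixes u :: "nat \<Rightarrow> real"
  assumes "0 \<le> \<rho>" "\<rho> < 1" "0 \<le> c"
    and u: "\<forall>\<^sub>F n in sequentially. u (Suc n) \<le> \<rho> * u n + c / (real n)\<^sup>2"
  obtains K where "0 \<le> K" "\<forall>\<^sub>F n in sequentially. u n \<le> K / (real n)\<^sup>2"
proof -
  have "\<forall>\<^sub>F n in sequentially. (1 + \<rho>) / 2 * (real n + 1)\<^sup>2 \<le> (real n)\<^sup>2"
    using assms(2) by real_asymp
  with u have "\<forall>\<^sub>F n in sequentially. u (Suc n) \<le> \<rho> * u n + c / (real n)\<^sup>2 \<and>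
      (1 + \<rho>) / 2 * (real n + 1)\<^sup>2 \<le> (real n)\<^sup>2" by (rule eventually_conj)
  then obtain N where N: "\<And>n. n \<ge> N \<Longrightarrow> u (Suc n) \<le> \<rho> * u n + c / (real n)\<^sup>2"
    "\<And>n. n \<ge> N \<Longrightarrow> (1 + \<rho>) / 2 * (real n + 1)\<^sup>2 \<le> (real n)\<^sup>2"
    unfolding eventually_sequentially by blast
  define N1 where "N1 = Suc N"
  define K where "K = max (\<bar>u N1\<bar> * (real N1)\<^sup>2) (2 * c / (1 - \<rho>))"
  have K0: "0 \<le> K" unfolding K_def by (simp add: le_max_iff_disj)
  have "2 * c / (1 - \<rho>) \<le> K" unfolding K_def by simp
  then have K: "2 * c \<le> K * (1 - \<rho>)" using assms by (simp add: pos_divide_le_eq)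
  have "u n \<le> K / (real n)\<^sup>2" if "N1 \<le> n" for n
    using that
  proof (induction n rule: nat_induct_at_least)
    case base
    have "\<bar>u N1\<bar> * (real N1)\<^sup>2 \<le> K" unfolding K_def by simp
    then have "\<bar>u N1\<bar> \<le> K / (real N1)\<^sup>2" by (simp add: pos_le_divide_eq N1_def)
    then show ?case by linarith
  next
    case (Suc n)
    then have n: "N \<le> n" "0 < real n" unfolding N1_def by auto
    have "u (Suc n) \<le> \<rho> * (K / (real n)\<^sup>2) + c / (real n)\<^sup>2"
      using N(1)[OF n(1)] mult_left_mono[OF Suc.IH assms(1)] by linarith
    also have "\<dots> = (\<rho> * K + c) / (real n)\<^sup>2" by (simp add: add_divide_distrib)
    also have "\<dots> \<le> ((1 + \<rho>) / 2 * K) / (real n)\<^sup>2"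
      using K by (intro divide_right_mono) (auto simp: algebra_simps)
    also have "\<dots> \<le> K / (real (Suc n))\<^sup>2"
    proof -
      have "K * ((1 + \<rho>) / 2 * (real n + 1)\<^sup>2) \<le> K * (real n)\<^sup>2"
        using N(2)[OF n(1)] K0 by (intro mult_left_mono)
      then show ?thesis using n by (simp add: pos_divide_le_eq pos_le_divide_eq mult_ac add.commute)
    qed
    finally show ?case .
  qed
  then have "\<forall>\<^sub>F n in sequentially. u n \<le> K / (real n)\<^sup>2"
    unfolding eventually_sequentially by blast
  with K0 show thesis using that by blast
qed

text \<open>The recursion expresses each value by the next one, so a bounded sequence has no free
  initial value: after k unfoldings only \<rho>^k B is left of it. With c = 0 a nonnegative u must
  vanish, which later excludes backward orbits on x = 0.\<close>

lemma backward_decay: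
  fixes u :: "nat \<Rightarrow> real"
  assumes "0 \<le> \<rho>" "\<rho> < 1" "0 \<le> c" "0 < N"
    and u: "\<And>n. N \<le> n \<Longrightarrow> u n \<le> \<rho> * u (Suc n) + c / (real n)\<^sup>2" and B: "\<And>n. N \<le> n \<Longrightarrow> u n \<le> B"
    and n: "N \<le> n"
  shows "u n \<le> c / (1 - \<rho>) / (real n)\<^sup>2"
proof -
  let ?K = "c / (1 - \<rho>)"
  have K0: "0 \<le> ?K" using assms by simp
  have K: "\<rho> * ?K + c = ?K" using assms by (simp add: field_simps)
  have *: "u n \<le> \<rho> ^ k * B + ?K / (real n)\<^sup>2" if "N \<le> n" for n k
    using that
  proof (induction k arbitrary: n)
    case 0
    have "0 \<le> ?K / (real n)\<^sup>2" by (rule divide_nonneg_nonneg[OF K0]) simp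
    then show ?case using B[OF 0] by simp
  next
    case (Suc k)
    have "?K / (real (Suc n))\<^sup>2 \<le> ?K / (real n)\<^sup>2"
      using K0 Suc.prems assms(4) by (intro divide_left_mono power_mono) auto
    then have "u (Suc n) \<le> \<rho> ^ k * B + ?K / (real n)\<^sup>2" using Suc.IH[of "Suc n"] Suc.prems by linarith
    then have "u n \<le> \<rho> * (\<rho> ^ k * B + ?K / (real n)\<^sup>2) + c / (real n)\<^sup>2"
      using u[OF Suc.prems] mult_left_mono[OF _ assms(1)] by (meson add_right_mono order_trans)
    also have "\<dots> = \<rho> ^ Suc k * B + (\<rho> * ?K + c) / (real n)\<^sup>2"
      by (simp add: add_divide_distrib distrib_left)
    finally show ?case unfolding K .
  qed
  have "(\<lambda>k. \<rho> ^ k * B + ?K / (real n)\<^sup>2) \<longlonglongrightarrow> 0 * B + ?K / (real n)\<^sup>2"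
    using assms by (intro tendsto_intros LIMSEQ_power_zero) auto
  then show ?thesis using *[OF n] by (intro LIMSEQ_le_const[where X = "\<lambda>k. \<rho> ^ k * B + ?K / (real n)\<^sup>2"]) auto
qed

lemma convergent_if_increments_quadratic:
  fixes u :: "nat \<Rightarrow> complex"
  assumes "\<forall>\<^sub>F n in sequentially. norm (u (Suc n) - u n) \<le> c / (real n)\<^sup>2"
  shows "convergent u"
proof -
  have "summable (\<lambda>n. c * inverse ((real n)\<^sup>2))"
    by (intro summable_mult inverse_power_summable) auto
  then have "summable (\<lambda>n. c / (real n)\<^sup>2)" by (simp add: divide_inverse)
  then have "summable (\<lambda>n. u (Suc n) - u n)"
    using assms by (rule summable_comparison_test_ev[rotated])
  then have "convergent (\<lambda>n. u n - u 0)"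
    by (simp add: summable_iff_convergent sum_lessThan_telescope)
  then show ?thesis using convergent_diff_const_right_iff by blast
qed

lemma unit_translation_growth:
  fixes V T :: "nat \<Rightarrow> complex"
  assumes "\<forall>\<^sub>F n in sequentially. V (Suc n) = V n + T n \<and> norm (T n - 1) \<le> 1 / 4"
  shows "\<forall>\<^sub>F n in sequentially. real n / 2 \<le> Re (V n) \<and> norm (V n) \<le> 2 * real n"
proof -
  obtain N where N: "\<And>n. N \<le> n \<Longrightarrow> V (Suc n) = V n + T n \<and> norm (T n - 1) \<le> 1 / 4"
    using assms unfolding eventually_sequentially by blast
  have *: "4 * Re (V N) + 3 * real n \<le> 4 * Re (V n) + 3 * real N \<and>
      4 * norm (V n) + 5 * real N \<le> 4 * norm (V N) + 5 * real n"
    if "N \<le> n" for n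
    using that
  proof (induction n rule: nat_induct_at_least)
    case (Suc n)
    have "\<bar>Re (T n) - 1\<bar> \<le> 1 / 4" using N[OF Suc.hyps] abs_Re_le_cmod[of "T n - 1"] by simp
    then have "3 / 4 \<le> Re (T n)" by linarith
    moreover have "norm (T n) \<le> 5 / 4" using N[OF Suc.hyps] norm_triangle_ineq[of "T n - 1" 1] by simp
    ultimately show ?case using N[OF Suc.hyps] Suc.IH norm_triangle_ineq[of "V n" "T n"] by auto
  qed simp
  have "\<forall>\<^sub>F n in sequentially. 2 * real n + 3 * real N \<le> 4 * Re (V N) + 3 * real n" by real_asymp
  moreover have "\<forall>\<^sub>F n in sequentially. 4 * norm (V N) + 5 * real n \<le> 8 * real n + 5 * real N" by real_asymp
  moreover have "\<forall>\<^sub>F n in sequentially. N \<le> n" by (rule eventually_ge_at_top)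
  ultimately show ?thesis
  proof eventually_elim
    case (elim n)
    then show ?case using *[of n] by linarith
  qed
qed

lemma norm_Ln_bound:
  fixes z :: complex
  assumes "1 / B \<le> norm z" "norm z \<le> B" "0 < B"
  shows "norm (Ln z) \<le> ln B + 4"
proof -
  have z0: "z \<noteq> 0" using assms by auto
  have "ln (1 / B) \<le> ln (norm z)" "ln (norm z) \<le> ln B" using assms z0 by (auto intro!: ln_mono)
  moreover have "ln (1 / B) = - ln B" "Re (Ln z) = ln (norm z)" using z0 assms by (auto simp: ln_div)
  ultimately have "\<bar>Re (Ln z)\<bar> \<le> ln B" by linarith
  moreover have "\<bar>Im (Ln z)\<bar> \<le> 4"
    using mpi_less_Im_Ln[OF z0] Im_Ln_le_pi[OF z0] pi_less_4 by linarith
  ultimately show ?thesis using cmod_le[of "Ln z"] by linarith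
qed

lemma Ln_mult_near_1:
  assumes "0 < Re z" "norm w \<le> 1 / 4"
  shows "Ln (z * (1 + w)) = Ln z + Ln (1 + w)"
proof -
  have "1 + w \<noteq> 0" using assms(2) norm_diff_ineq[of 1 w] by auto
  moreover have "z \<noteq> 0" using assms(1) by auto
  ultimately show ?thesis
    using Re_Ln_pos_lt_imp[OF assms(1)] abs_Im_Ln_le[OF assms(2)] pi_gt3
    by (intro Ln_times_simple) auto
qed

text \<open>The case e = 0 of \<open>cot_step\<close>: in the coordinate -1/x the map is the
  translation by a/(1 + xa).\<close>

lemma inverse_step:
  fixes x a :: complex
  assumes "x \<noteq> 0" "norm (x * a) \<le> 1 / 4" "x' = x + x\<^sup>2 * a"
  shows "x' \<noteq> 0" "1 / x = 1 / x' + a / (1 + x * a)" "x' = x * (1 + x * a)"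
proof -
  have nz: "1 + x * a \<noteq> 0" using assms(2) norm_diff_ineq[of 1 "x * a"] by auto
  show x': "x' = x * (1 + x * a)" using assms(3) by (simp add: algebra_simps power2_eq_square)
  then show "x' \<noteq> 0" using nz assms by simp
  then show "1 / x = 1 / x' + a / (1 + x * a)" unfolding x'
  proof -
    have "1 / (x * (1 + x * a)) + a / (1 + x * a) = 1 / (x * (1 + x * a)) + (x * a) / (x * (1 + x * a))"
      using assms by simp
    also have "\<dots> = (1 + x * a) / (x * (1 + x * a))" by (rule add_divide_distrib[symmetric])
    also have "\<dots> = 1 / x" using nz by simp
    finally show "1 / x = 1 / (x * (1 + x * a)) + a / (1 + x * a)" by simp
  qed
qed

lemma norm_le_of_inverse: "norm x \<le> 2 / t" if "t / 2 \<le> Re (1 / x)" "0 < t" for x :: complex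
proof -
  have "t / 2 \<le> norm (1 / x)" using that(1) complex_Re_le_cmod[of "1 / x"] by linarith
  then have "t / 2 \<le> 1 / norm x" by (simp add: norm_divide)
  moreover have "x \<noteq> 0" using that by auto
  ultimately show ?thesis using that by (simp add: field_simps)
qed

lemma Re_pos_of_inverse: "0 < Re z" if "0 < Re (1 / z)" for z :: complex
  using that by (simp add: Re_divide zero_less_divide_iff not_sum_power2_lt_zero)

text \<open>Here z is -x on an incoming orbit and x on a backward outgoing one, so that in both
  cases z ends up in the right half-plane, where the principal logarithm is continuous. The second
  conclusion makes the logarithm negligible against n.\<close>

lemma translation_orbit:
  fixes z T :: "nat \<Rightarrow> complex"
  assumes "\<forall>\<^sub>F n in sequentially. 1 / z (Suc n) = 1 / z n + T n \<and> norm (T n - 1) \<le> 1 / 4"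
  shows "\<forall>\<^sub>F n in sequentially. 1 \<le> real n \<and> norm (z n) \<le> 2 / real n \<and> 0 < Re (z n)"
    and "(\<lambda>n. Ln (z n) / of_nat n) \<longlonglongrightarrow> 0"
proof -
  have zb: "\<forall>\<^sub>F n in sequentially. 1 \<le> real n \<and> norm (z n) \<le> 2 / real n \<and> 0 < Re (z n) \<and> 1 / (2 * real n) \<le> norm (z n)"
    using unit_translation_growth[OF assms] eventually_ge_at_top[of "1::nat"]
  proof eventually_elim
    case (elim n)
    have "norm (z n) \<le> 2 / real n" using elim by (intro norm_le_of_inverse) auto
    moreover have "0 < Re (1 / z n)" using elim by auto
    then have "0 < Re (z n)" by (rule Re_pos_of_inverse)
    moreover have "1 / (2 * real n) \<le> norm (z n)"
    proof -
      have "z n \<noteq> 0" using \<open>0 < Re (z n)\<close> by auto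
      then show ?thesis using elim by (auto simp: norm_divide field_simps)
    qed
    ultimately show ?case using elim by auto
  qed
  then show "\<forall>\<^sub>F n in sequentially. 1 \<le> real n \<and> norm (z n) \<le> 2 / real n \<and> 0 < Re (z n)"
    by eventually_elim auto
  show "(\<lambda>n. Ln (z n) / of_nat n) \<longlonglongrightarrow> 0"
  proof (rule Lim_null_comparison)
    show "\<forall>\<^sub>F n in sequentially. norm (Ln (z n) / of_nat n) \<le> (ln (2 * real n) + 4) / real n"
      using zb
    proof eventually_elim
      case (elim n)
      have "2 / real n \<le> 2 / 1" using elim by (intro divide_left_mono) auto
      also have "\<dots> \<le> 2 * real n" using elim by simp
      finally have "2 / real n \<le> 2 * real n" .
      then have "norm (Ln (z n)) \<le> ln (2 * real n) + 4" using elim by (intro norm_Ln_bound) auto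
      then show ?case by (simp add: norm_divide divide_right_mono)
    qed
    show "(\<lambda>n. (ln (2 * real n) + 4) / real n) \<longlonglongrightarrow> 0" by real_asymp
  qed
qed

text \<open>The linear term ry counts as second order because y is O(1/t^2) while x is only
  O(1/t).\<close>

lemma quadratic_error_bound:
  fixes x y e :: complex
  assumes x: "norm x \<le> 2 / t" and y: "norm y \<le> K / t\<^sup>2" and t: "1 \<le> t" and CK: "0 \<le> C'" "0 \<le> K"
    and e: "norm (e - (1 + r * y)) \<le> C' * ((norm x)\<^sup>2 + (norm y)\<^sup>2)"
  shows "norm (e - 1) \<le> (norm r * K + C' * (4 + K\<^sup>2)) / t\<^sup>2"
proof -
  have "K / t\<^sup>2 \<le> K / t" using t CK by (intro divide_left_mono) (auto simp: power2_eq_square)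
  then have "(norm y)\<^sup>2 \<le> (K / t)\<^sup>2" using y by (intro power_mono) auto
  moreover have "(norm x)\<^sup>2 \<le> (2 / t)\<^sup>2" using x by (intro power_mono) auto
  ultimately have "(norm x)\<^sup>2 + (norm y)\<^sup>2 \<le> (4 + K\<^sup>2) / t\<^sup>2" by (simp add: power_divide add_divide_distrib)
  then have "C' * ((norm x)\<^sup>2 + (norm y)\<^sup>2) \<le> C' * ((4 + K\<^sup>2) / t\<^sup>2)" using CK by (intro mult_left_mono) auto
  moreover have "norm (r * y) \<le> norm r * (K / t\<^sup>2)" unfolding norm_mult using y by (intro mult_left_mono) auto
  moreover have "norm (e - 1) \<le> norm (e - (1 + r * y)) + norm (r * y)"
    using norm_triangle_ineq[of "e - (1 + r * y)" "r * y"] by simp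
  ultimately show ?thesis using e by (simp add: add_divide_distrib distrib_left)
qed

text \<open>The estimates build on each other: -1/x drifts by about 1 per step, so x = O(1/n); the
  contraction then gives y = O(1/n^2); with both, the increments of the coordinate minus n are
  summable.\<close>

lemma incoming_orbit:
  fixes x y :: "nat \<Rightarrow> complex"
  assumes "0 \<le> C" "0 \<le> G" "0 \<le> \<rho>" "\<rho> < 1"
    and lims: "x \<longlonglongrightarrow> 0" "y \<longlonglongrightarrow> 0"
    and dyn: "\<forall>\<^sub>F n in sequentially. x n \<noteq> 0 \<and> (\<exists>a b g. x (Suc n) = x n + (x n)\<^sup>2 * a \<and> y (Suc n) = b * y n + (x n)\<^sup>2 * g \<and>
       norm (a - (1 + (q + 1) * x n + r * y n)) \<le> C * ((norm (x n))\<^sup>2 + (norm (y n))\<^sup>2) \<and> norm b \<le> \<rho> \<and> norm g \<le> G)"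
  obtains K where "0 \<le> K" "\<forall>\<^sub>F n in sequentially. norm (y n) \<le> K / (real n)\<^sup>2"
    "convergent (\<lambda>n. w_in q (x n, y n) - of_nat n)" "(\<lambda>n. - 1 / x n / of_nat n) \<longlonglongrightarrow> 1"
    "\<forall>\<^sub>F n in sequentially. 0 < Re (- x n)"
proof -
  obtain \<delta> C' where d: "0 < \<delta>" "\<delta> \<le> 1" "0 \<le> C'"
    and inc: "\<And>x (y::complex) (e::complex) a. \<lbrakk>norm x < \<delta>; norm y < \<delta>; norm e < \<delta>;
        norm (a - (1 + (q + 1) * x + r * y)) \<le> C * ((norm x)\<^sup>2 + (norm y)\<^sup>2 + (norm e)\<^sup>2)\<rbrakk> \<Longrightarrow>
       norm (x * a) \<le> 1 / 4 \<and> norm (a / (1 + x * a) - 1) \<le> 1 / 4 \<and>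
       norm (a / (1 + x * a) - q * Ln (1 + x * a) - (1 + r * y))
         \<le> C' * ((norm x)\<^sup>2 + (norm y)\<^sup>2 + (norm e)\<^sup>2)"
    using normal_form_increment[OF assms(1), of q r] by metis
  have "\<forall>\<^sub>F n in sequentially. norm (x n) < \<delta>" "\<forall>\<^sub>F n in sequentially. norm (y n) < \<delta>"
    using order_tendstoD(2)[OF tendsto_norm[OF lims(1)]] order_tendstoD(2)[OF tendsto_norm[OF lims(2)]] d by auto
  with dyn have "\<forall>\<^sub>F n in sequentially. \<exists>a. x n \<noteq> 0 \<and> x (Suc n) = x n + (x n)\<^sup>2 * a \<and>
      norm (x n * a) \<le> 1 / 4 \<and> norm (a / (1 + x n * a) - 1) \<le> 1 / 4 \<and>
       norm (a / (1 + x n * a) - q * Ln (1 + x n * a) - (1 + r * y n)) \<le> C' * ((norm (x n))\<^sup>2 + (norm (y n))\<^sup>2) \<and>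
       norm (y (Suc n)) \<le> \<rho> * norm (y n) + (norm (x n))\<^sup>2 * G"
  proof eventually_elim
    case (elim n)
    then obtain a b g where D: "x (Suc n) = x n + (x n)\<^sup>2 * a" "y (Suc n) = b * y n + (x n)\<^sup>2 * g"
       "norm (a - (1 + (q + 1) * x n + r * y n)) \<le> C * ((norm (x n))\<^sup>2 + (norm (y n))\<^sup>2)" "norm b \<le> \<rho>" "norm g \<le> G" by blast
    have "norm (y (Suc n)) \<le> norm b * norm (y n) + (norm (x n))\<^sup>2 * norm g"
      unfolding D(2) norm_mult[symmetric] norm_power[symmetric] by (rule norm_triangle_ineq)
    also have "\<dots> \<le> \<rho> * norm (y n) + (norm (x n))\<^sup>2 * G"
      using D by (intro add_mono mult_mono mult_left_mono) (use assms in auto)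
    finally show ?case using inc[of "x n" "y n" 0 a] elim D d by (intro exI[of _ a]) auto
  qed
  then obtain a where a: "\<forall>\<^sub>F n in sequentially. x n \<noteq> 0 \<and> x (Suc n) = x n + (x n)\<^sup>2 * a n \<and>
      norm (x n * a n) \<le> 1 / 4 \<and> norm (a n / (1 + x n * a n) - 1) \<le> 1 / 4 \<and>
       norm (a n / (1 + x n * a n) - q * Ln (1 + x n * a n) - (1 + r * y n)) \<le> C' * ((norm (x n))\<^sup>2 + (norm (y n))\<^sup>2) \<and>
       norm (y (Suc n)) \<le> \<rho> * norm (y n) + (norm (x n))\<^sup>2 * G"
    unfolding eventually_ex by blast
  have "\<forall>\<^sub>F n in sequentially. 1 / (- x (Suc n)) = 1 / (- x n) + a n / (1 + x n * a n) \<and>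
      norm (a n / (1 + x n * a n) - 1) \<le> 1 / 4"
    using a
  proof eventually_elim
    case (elim n)
    then have "1 / x n = 1 / x (Suc n) + a n / (1 + x n * a n)" by (intro inverse_step(2)) auto
    then have "1 / (- x (Suc n)) = 1 / (- x n) + a n / (1 + x n * a n)" by simp
    with elim show ?case by blast
  qed
  note orbit = translation_orbit[OF this]
  have xb: "\<forall>\<^sub>F n in sequentially. 1 \<le> real n \<and> norm (x n) \<le> 2 / real n \<and> 0 < Re (- x n)"
    using orbit(1) by eventually_elim simp
  have "\<forall>\<^sub>F n in sequentially. norm (y (Suc n)) \<le> \<rho> * norm (y n) + (4 * G) / (real n)\<^sup>2"
    using a xb
  proof eventually_elim
    case (elim n)
    have "(norm (x n))\<^sup>2 \<le> (2 / real n)\<^sup>2" using elim by (intro power_mono) auto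
    then have "(norm (x n))\<^sup>2 * G \<le> (2 / real n)\<^sup>2 * G" using assms(2) by (rule mult_right_mono)
    then show ?case using elim by (simp add: power_divide)
  qed
  from forward_decay[OF assms(3,4) _ this] assms(2)
  obtain K where K: "0 \<le> K" "\<forall>\<^sub>F n in sequentially. norm (y n) \<le> K / (real n)\<^sup>2" by auto
  define v where "v n = w_in q (x n, y n) - of_nat n" for n
  have "\<forall>\<^sub>F n in sequentially. norm (v (Suc n) - v n) \<le> (norm r * K + C' * (4 + K\<^sup>2)) / (real n)\<^sup>2"
    using a xb K(2)
  proof eventually_elim
    case (elim n)
    have "- x (Suc n) = - x n * (1 + x n * a n)" using inverse_step(3)[of "x n" "a n" "x (Suc n)"] elim by simp
    then have "Ln (- x (Suc n)) = Ln (- x n) + Ln (1 + x n * a n)" using Ln_mult_near_1[of "- x n"] elim by simp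
    then have "v (Suc n) - v n = (a n / (1 + x n * a n) - q * Ln (1 + x n * a n)) - 1"
      using inverse_step(2)[of "x n" "a n" "x (Suc n)"] elim
      by (simp add: v_def w_in_def algebra_simps)
    then show ?case using quadratic_error_bound[of "x n" "real n" "y n" K C' "a n / (1 + x n * a n) - q * Ln (1 + x n * a n)" r]
      elim d K(1) by simp
  qed
  then have conv: "convergent v" by (rule convergent_if_increments_quadratic)
  \<comment> \<open>From -1/x = v + n + q Ln(-x), with v convergent and the logarithm o(n), division
    by n gives the limit 1.\<close>
  have "(\<lambda>n. v n / of_nat n) \<longlonglongrightarrow> 0"
  proof -
    obtain l where "v \<longlonglongrightarrow> l" using conv by (auto simp: convergent_def)
    from tendsto_mult[OF this lim_1_over_n] show ?thesis by simp
  qed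
  moreover note orbit(2)
  ultimately have "(\<lambda>n. v n / of_nat n + q * (Ln (- x n) / of_nat n) + 1) \<longlonglongrightarrow> 0 + q * 0 + 1"
    by (intro tendsto_intros)
  moreover have "\<forall>\<^sub>F n in sequentially. v n / of_nat n + q * (Ln (- x n) / of_nat n) + 1 = - 1 / x n / of_nat n"
    using xb by eventually_elim (auto simp: v_def w_in_def field_simps)
  ultimately have "(\<lambda>n. - 1 / x n / of_nat n) \<longlonglongrightarrow> 0 + q * 0 + 1" by (rule Lim_transform_eventually)
  moreover have "\<forall>\<^sub>F n in sequentially. 0 < Re (- x n)" using xb by eventually_elim auto
  ultimately show thesis using that[OF K conv[unfolded v_def]] by simp
qed

text \<open>\<open>x n\<close> is the image of \<open>x (Suc n)\<close>, so the index runs against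
  the dynamics and the contraction of y acts from larger to smaller indices. The decay of y
  therefore comes from \<open>backward_decay\<close> and rests on the boundedness of y.\<close>

lemma outgoing_orbit:
  fixes x y :: "nat \<Rightarrow> complex"
  assumes "0 \<le> C" "0 \<le> G" "0 \<le> \<rho>" "\<rho> < 1"
    and lims: "x \<longlonglongrightarrow> 0" "y \<longlonglongrightarrow> 0"
    and dyn: "\<forall>\<^sub>F n in sequentially. x (Suc n) \<noteq> 0 \<and> (\<exists>a b g. x n = x (Suc n) + (x (Suc n))\<^sup>2 * a \<and>
       y n = b * y (Suc n) + (x (Suc n))\<^sup>2 * g \<and>
       norm (a - (1 + (q + 1) * x (Suc n) + r * y (Suc n))) \<le> C * ((norm (x (Suc n)))\<^sup>2 + (norm (y (Suc n)))\<^sup>2) \<and>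
       norm b \<le> \<rho> \<and> norm g \<le> G)"
  shows "convergent (\<lambda>n. w_out q (x n, y n) + of_nat n)" "(\<lambda>n. 1 / x n / of_nat n) \<longlonglongrightarrow> 1"
    "\<forall>\<^sub>F n in sequentially. norm (x n) \<le> 2 / real n \<and> 0 < Re (x n)"
proof -
  obtain \<delta> C' where d: "0 < \<delta>" "\<delta> \<le> 1" "0 \<le> C'"
    and inc: "\<And>x (y::complex) (e::complex) a. \<lbrakk>norm x < \<delta>; norm y < \<delta>; norm e < \<delta>;
        norm (a - (1 + (q + 1) * x + r * y)) \<le> C * ((norm x)\<^sup>2 + (norm y)\<^sup>2 + (norm e)\<^sup>2)\<rbrakk> \<Longrightarrow>
       norm (x * a) \<le> 1 / 4 \<and> norm (a / (1 + x * a) - 1) \<le> 1 / 4 \<and>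
       norm (a / (1 + x * a) - q * Ln (1 + x * a) - (1 + r * y))
         \<le> C' * ((norm x)\<^sup>2 + (norm y)\<^sup>2 + (norm e)\<^sup>2)"
    using normal_form_increment[OF assms(1), of q r] by metis
  have "\<forall>\<^sub>F n in sequentially. norm (x (Suc n)) < \<delta>" "\<forall>\<^sub>F n in sequentially. norm (y (Suc n)) < \<delta>"
    using order_tendstoD(2)[OF tendsto_norm[OF LIMSEQ_Suc[OF lims(1)]]]
      order_tendstoD(2)[OF tendsto_norm[OF LIMSEQ_Suc[OF lims(2)]]] d by auto
  with dyn have "\<forall>\<^sub>F n in sequentially. \<exists>a. x (Suc n) \<noteq> 0 \<and> x n = x (Suc n) + (x (Suc n))\<^sup>2 * a \<and>
      norm (x (Suc n) * a) \<le> 1 / 4 \<and> norm (a / (1 + x (Suc n) * a) - 1) \<le> 1 / 4 \<and>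
       norm (a / (1 + x (Suc n) * a) - q * Ln (1 + x (Suc n) * a) - (1 + r * y (Suc n)))
         \<le> C' * ((norm (x (Suc n)))\<^sup>2 + (norm (y (Suc n)))\<^sup>2) \<and>
       norm (y n) \<le> \<rho> * norm (y (Suc n)) + (norm (x (Suc n)))\<^sup>2 * G"
  proof eventually_elim
    case (elim n)
    then obtain a b g where D: "x n = x (Suc n) + (x (Suc n))\<^sup>2 * a" "y n = b * y (Suc n) + (x (Suc n))\<^sup>2 * g"
       "norm (a - (1 + (q + 1) * x (Suc n) + r * y (Suc n))) \<le> C * ((norm (x (Suc n)))\<^sup>2 + (norm (y (Suc n)))\<^sup>2)"
       "norm b \<le> \<rho>" "norm g \<le> G" by blast
    have "norm (y n) \<le> norm b * norm (y (Suc n)) + (norm (x (Suc n)))\<^sup>2 * norm g"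
      unfolding D(2) norm_mult[symmetric] norm_power[symmetric] by (rule norm_triangle_ineq)
    also have "\<dots> \<le> \<rho> * norm (y (Suc n)) + (norm (x (Suc n)))\<^sup>2 * G"
      using D by (intro add_mono mult_mono mult_left_mono) (use assms in auto)
    finally show ?case using inc[of "x (Suc n)" "y (Suc n)" 0 a] elim D d by (intro exI[of _ a]) auto
  qed
  then obtain a where a: "\<forall>\<^sub>F n in sequentially. x (Suc n) \<noteq> 0 \<and> x n = x (Suc n) + (x (Suc n))\<^sup>2 * a n \<and>
      norm (x (Suc n) * a n) \<le> 1 / 4 \<and> norm (a n / (1 + x (Suc n) * a n) - 1) \<le> 1 / 4 \<and>
       norm (a n / (1 + x (Suc n) * a n) - q * Ln (1 + x (Suc n) * a n) - (1 + r * y (Suc n)))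
         \<le> C' * ((norm (x (Suc n)))\<^sup>2 + (norm (y (Suc n)))\<^sup>2) \<and>
       norm (y n) \<le> \<rho> * norm (y (Suc n)) + (norm (x (Suc n)))\<^sup>2 * G"
    unfolding eventually_ex by blast
  have "\<forall>\<^sub>F n in sequentially. 1 / x (Suc n) = 1 / x n + a n / (1 + x (Suc n) * a n) \<and>
      norm (a n / (1 + x (Suc n) * a n) - 1) \<le> 1 / 4"
    using a
  proof eventually_elim
    case (elim n)
    then show ?case using inverse_step(2)[of "x (Suc n)" "a n" "x n"] by simp
  qed
  note orbit = translation_orbit[OF this]
  note xb = orbit(1)
  from xb have xb': "\<forall>\<^sub>F n in sequentially. norm (x (Suc n)) \<le> 2 / real (Suc n) \<and> 0 < Re (x (Suc n))"
    by (subst (asm) eventually_sequentially_Suc[symmetric]) (auto elim: eventually_mono)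
  have "\<forall>\<^sub>F n in sequentially. 0 < n \<and> norm (x (Suc n)) \<le> 2 / real n \<and> 0 < Re (x (Suc n)) \<and>
      norm (y n) \<le> \<rho> * norm (y (Suc n)) + (4 * G) / (real n)\<^sup>2 \<and> norm (y n) < 1"
    using a xb' eventually_gt_at_top[of "0::nat"] order_tendstoD(2)[OF tendsto_norm[OF lims(2)], of 1, simplified]
  proof eventually_elim
    case (elim n)
    have "2 / real (Suc n) \<le> 2 / real n" using elim by (intro divide_left_mono) auto
    then have 1: "norm (x (Suc n)) \<le> 2 / real n" using elim by linarith
    then have "(norm (x (Suc n)))\<^sup>2 \<le> (2 / real n)\<^sup>2" by (intro power_mono) auto
    then have "(norm (x (Suc n)))\<^sup>2 * G \<le> (2 / real n)\<^sup>2 * G" using assms(2) by (rule mult_right_mono)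
    then show ?case using elim 1 by (simp add: power_divide)
  qed
  then obtain N where N: "\<And>n. N \<le> n \<Longrightarrow> 0 < n \<and> norm (x (Suc n)) \<le> 2 / real n \<and> 0 < Re (x (Suc n)) \<and>
      norm (y n) \<le> \<rho> * norm (y (Suc n)) + (4 * G) / (real n)\<^sup>2 \<and> norm (y n) < 1"
    unfolding eventually_sequentially by blast
  define K where "K = 4 * G / (1 - \<rho>)"
  have K0: "0 \<le> K" unfolding K_def using assms by simp
  have "norm (y n) \<le> K / (real n)\<^sup>2" if "N \<le> n" for n
    unfolding K_def
    by (rule backward_decay[where u = "\<lambda>n. norm (y n)" and N = N and B = 1])
      (use assms N that in \<open>auto simp: less_imp_le\<close>)
  then have yb: "norm (y (Suc n)) \<le> K / (real n)\<^sup>2" if "N \<le> n" for n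
  proof -
    have "K / (real (Suc n))\<^sup>2 \<le> K / (real n)\<^sup>2"
      using K0 N[OF that] by (intro divide_left_mono power_mono) auto
    then show ?thesis using \<open>\<And>n. N \<le> n \<Longrightarrow> norm (y n) \<le> K / (real n)\<^sup>2\<close>[of "Suc n"] that by linarith
  qed
  define v where "v n = w_out q (x n, y n) + of_nat n" for n
  have "\<forall>\<^sub>F n in sequentially. norm (v (Suc n) - v n) \<le> (norm r * K + C' * (4 + K\<^sup>2)) / (real n)\<^sup>2"
    using a eventually_ge_at_top[of N]
  proof eventually_elim
    case (elim n)
    have "x n = x (Suc n) * (1 + x (Suc n) * a n)" using inverse_step(3)[of "x (Suc n)" "a n" "x n"] elim by simp
    then have L: "Ln (x n) = Ln (x (Suc n)) + Ln (1 + x (Suc n) * a n)"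
      using Ln_mult_near_1[of "x (Suc n)"] elim N[of n] by simp
    have "v (Suc n) - v n = - ((a n / (1 + x (Suc n) * a n) - q * Ln (1 + x (Suc n) * a n)) - 1)"
      using inverse_step(2)[of "x (Suc n)" "a n" "x n"] elim L
      by (simp add: v_def w_out_def algebra_simps)
    then have "norm (v (Suc n) - v n) = norm ((a n / (1 + x (Suc n) * a n) - q * Ln (1 + x (Suc n) * a n)) - 1)"
      by (simp only: norm_minus_cancel)
    then show ?case using quadratic_error_bound[of "x (Suc n)" "real n" "y (Suc n)" K C'
        "a n / (1 + x (Suc n) * a n) - q * Ln (1 + x (Suc n) * a n)" r]
      elim d K0 yb[of n] N[of n] by simp
  qed
  then have conv: "convergent v" by (rule convergent_if_increments_quadratic)
  then show "convergent (\<lambda>n. w_out q (x n, y n) + of_nat n)" unfolding v_def .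
  have "(\<lambda>n. v n / of_nat n) \<longlonglongrightarrow> 0"
  proof -
    obtain l where "v \<longlonglongrightarrow> l" using conv by (auto simp: convergent_def)
    from tendsto_mult[OF this lim_1_over_n] show ?thesis by simp
  qed
  moreover note orbit(2)
  ultimately have "(\<lambda>n. 1 - (v n / of_nat n + q * (Ln (x n) / of_nat n))) \<longlonglongrightarrow> 1 - (0 + q * 0)"
    by (intro tendsto_intros)
  moreover have "\<forall>\<^sub>F n in sequentially. 1 - (v n / of_nat n + q * (Ln (x n) / of_nat n)) = 1 / x n / of_nat n"
    using xb by eventually_elim (auto simp: v_def w_out_def field_simps)
  ultimately have "(\<lambda>n. 1 / x n / of_nat n) \<longlonglongrightarrow> 1 - (0 + q * 0)" by (rule Lim_transform_eventually)
  then show "(\<lambda>n. 1 / x n / of_nat n) \<longlonglongrightarrow> 1" by simp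
  show "\<forall>\<^sub>F n in sequentially. norm (x n) \<le> 2 / real n \<and> 0 < Re (x n)" using xb by eventually_elim auto
qed


section \<open>Outgoing orbits are determined by their Fatou coordinate\<close>

lemma quotient_lipschitz:
  fixes a a' x x' :: complex
  assumes "norm (x * a) \<le> 1 / 4" "norm (x' * a') \<le> 1 / 4"
    "norm (a / (1 + x * a) - 1) \<le> 1 / 4" "norm (a' / (1 + x' * a') - 1) \<le> 1 / 4"
  shows "norm (a / (1 + x * a) - a' / (1 + x' * a')) \<le> 2 * norm (a - a') + 8 * norm (x - x')"
proof -
  have den: "3 / 4 \<le> norm (1 + z)" "norm (1 + z) \<le> 5 / 4" if "norm z \<le> 1 / 4" for z :: complex
    using that norm_diff_ineq[of 1 z] norm_triangle_ineq[of 1 z] by auto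
  have small: "norm b \<le> 2" if "norm (z * b) \<le> 1 / 4" "norm (b / (1 + z * b) - 1) \<le> 1 / 4" for z b :: complex
  proof -
    have "1 + z * b \<noteq> 0" using den(1)[OF that(1)] by auto
    then have "b = b / (1 + z * b) * (1 + z * b)" by simp
    then have "norm b = norm (b / (1 + z * b)) * norm (1 + z * b)" by (metis norm_mult)
    also have "\<dots> \<le> 5 / 4 * (5 / 4)"
      using den(2)[OF that(1)] that(2) norm_triangle_ineq[of "b / (1 + z * b) - 1" 1] by (intro mult_mono) auto
    finally show ?thesis by simp
  qed
  have nz: "1 + x * a \<noteq> 0" "1 + x' * a' \<noteq> 0" using den(1)[OF assms(1)] den(1)[OF assms(2)] by auto
  have "a / (1 + x * a) - a' / (1 + x' * a') = (a * (1 + x' * a') - a' * (1 + x * a)) / ((1 + x * a) * (1 + x' * a'))"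
    using nz by (simp add: diff_frac_eq)
  also have "a * (1 + x' * a') - a' * (1 + x * a) = (a - a') - a * a' * (x - x')"
    by (simp add: algebra_simps)
  finally have "norm (a / (1 + x * a) - a' / (1 + x' * a')) =
      norm ((a - a') - a * a' * (x - x')) / (norm (1 + x * a) * norm (1 + x' * a'))"
    by (simp add: norm_divide norm_mult)
  \<comment> \<open>With |a| and |a'| at most 2 and both denominators at least 3/4, the constants
    are 16/9 and 64/9, rounded up to 2 and 8 below.\<close>
  also have "\<dots> \<le> (norm (a - a') + 2 * 2 * norm (x - x')) / (3 / 4 * (3 / 4))"
  proof (rule frac_le)
    have "norm (a * a' * (x - x')) \<le> 2 * 2 * norm (x - x')"
      unfolding norm_mult using small[OF assms(1,3)] small[OF assms(2,4)]
      by (intro mult_right_mono mult_mono) auto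
    then show "norm ((a - a') - a * a' * (x - x')) \<le> norm (a - a') + 2 * 2 * norm (x - x')"
      using norm_triangle_ineq4[of "a - a'" "a * a' * (x - x')"] by linarith
    show "3 / 4 * (3 / 4) \<le> norm (1 + x * a) * norm (1 + x' * a')"
      using den(1)[OF assms(1)] den(1)[OF assms(2)] by (intro mult_mono) auto
  qed auto
  also have "\<dots> \<le> 2 * norm (a - a') + 8 * norm (x - x')" by simp
  finally show ?thesis .
qed

text \<open>Both sequences are asymptotic to 1/n. This removes the logarithms when two outgoing
  orbits are compared: equal Fatou coordinates then mean that 1/x - 1/x' tends to 0.\<close>

lemma Ln_diff_tendsto_0:
  fixes x x' :: "nat \<Rightarrow> complex"
  assumes "(\<lambda>n. 1 / x n / of_nat n) \<longlonglongrightarrow> 1" "(\<lambda>n. 1 / x' n / of_nat n) \<longlonglongrightarrow> 1"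
    and "\<forall>\<^sub>F n in sequentially. 0 < Re (x n)" "\<forall>\<^sub>F n in sequentially. 0 < Re (x' n)"
  shows "(\<lambda>n. Ln (x n) - Ln (x' n)) \<longlonglongrightarrow> 0"
proof -
  have *: "(\<lambda>n. Ln (1 / (1 / z n / of_nat n))) \<longlonglongrightarrow> 0" if "(\<lambda>n. 1 / z n / of_nat n) \<longlonglongrightarrow> 1" for z :: "nat \<Rightarrow> complex"
  proof -
    have "(\<lambda>n. Ln (1 / (1 / z n / of_nat n))) \<longlonglongrightarrow> Ln (1 / 1)"
      by (intro tendsto_Ln tendsto_divide tendsto_const that) auto
    then show ?thesis by simp
  qed
  have "(\<lambda>n. Ln (1 / (1 / x n / of_nat n)) - Ln (1 / (1 / x' n / of_nat n))) \<longlonglongrightarrow> 0 - 0"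
    by (intro tendsto_diff * assms)
  moreover have "\<forall>\<^sub>F n in sequentially. Ln (1 / (1 / x n / of_nat n)) - Ln (1 / (1 / x' n / of_nat n)) = Ln (x n) - Ln (x' n)"
    using assms(3,4) eventually_gt_at_top[of "0::nat"]
  proof eventually_elim
    case (elim n)
    have "Ln (of_nat n * x n) = Ln (of_nat n) + Ln (x n)" "Ln (of_nat n * x' n) = Ln (of_nat n) + Ln (x' n)"
      by (rule Ln_times_of_nat; use elim in auto)+
    then show ?case by (simp add: mult.commute)
  qed
  ultimately show ?thesis by (simp add: Lim_transform_eventually)
qed

text \<open>As d tends to 0, \<open>d n\<close> is the sum of the increments after n, and the tail
  of the sum of 1/k^2 is at most 1/n.\<close>

lemma summed_increments_bound:
  fixes d :: "nat \<Rightarrow> complex"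
  assumes "d \<longlonglongrightarrow> 0" "0 < N" "0 \<le> c" and step: "\<And>n. N \<le> n \<Longrightarrow> norm (d n - d (Suc n)) \<le> c / (real (Suc n))\<^sup>2"
    and n: "N \<le> n"
  shows "norm (d n) \<le> c / real n"
proof -
  have *: "norm (d n) \<le> norm (d (n + k)) + c * (1 / real n - 1 / real (n + k))" for k
  proof (induction k)
    case (Suc k)
    let ?m = "n + k"
    have m: "0 < real ?m" using n assms(2) by simp
    have "1 / (real (Suc ?m))\<^sup>2 \<le> 1 / real ?m - 1 / real (Suc ?m)"
    proof -
      have "1 / real ?m - 1 / real (Suc ?m) = 1 / (real ?m * real (Suc ?m))"
        using m by (simp add: field_simps)
      moreover have "1 / (real (Suc ?m))\<^sup>2 \<le> 1 / (real ?m * real (Suc ?m))"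
        using m unfolding power2_eq_square by (intro divide_left_mono mult_right_mono mult_pos_pos) auto
      ultimately show ?thesis by simp
    qed
    from mult_left_mono[OF this assms(3)]
    have "c / (real (Suc ?m))\<^sup>2 \<le> c * (1 / real ?m) - c * (1 / real (Suc ?m))"
      by (simp add: right_diff_distrib)
    moreover have "norm (d ?m) \<le> norm (d (Suc ?m)) + c / (real (Suc ?m))\<^sup>2"
      using step[of ?m] n norm_triangle_ineq[of "d ?m - d (Suc ?m)" "d (Suc ?m)"] by simp
    ultimately show ?case using Suc unfolding right_diff_distrib add_Suc_right by linarith
  qed simp
  have "(\<lambda>k. norm (d (n + k)) + c * (1 / real n - 1 / real (n + k))) \<longlonglongrightarrow> norm (0::complex) + c * (1 / real n - 0)"
  proof (intro tendsto_add tendsto_norm tendsto_mult tendsto_const tendsto_diff)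
    show "(\<lambda>k. d (n + k)) \<longlonglongrightarrow> 0" using LIMSEQ_ignore_initial_segment[OF assms(1), of n] by (simp add: add.commute)
    show "(\<lambda>k. 1 / real (n + k)) \<longlonglongrightarrow> 0" by real_asymp
  qed
  then show ?thesis using *
    by (intro LIMSEQ_le_const[where X = "\<lambda>k. norm (d (n + k)) + c * (1 / real n - 1 / real (n + k))"]) auto
qed

text \<open>Suppose |1/x - 1/x'| <= s from N on. Then |x - x'| <= 4s/n^2, and the contraction gives
  |y - y'| = O(s/n^2). By the Lipschitz bounds the increments of 1/x - 1/x' are at most Ks/n^2, and
  as this difference tends to 0, summing the tail bounds it by Ks/n <= s/2. So the bound halves
  itself arbitrarily often and the orbits agree. Injectivity of the outgoing Fatou coordinate
  results without a parametrization of the asymptotic curve.\<close>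

lemma outgoing_unique:
  fixes a g :: "complex \<Rightarrow> complex \<Rightarrow> complex" and c :: "complex \<Rightarrow> complex" and x y x' y' :: "nat \<Rightarrow> complex"
  assumes csts: "0 \<le> C" "0 \<le> G" "0 \<le> \<rho>" "\<rho> < 1" "0 \<le> L" "0 < \<delta>"
    and bounds: "\<And>x y. norm x < \<delta> \<Longrightarrow> norm y < \<delta> \<Longrightarrow>
       norm (a x y - (1 + (q + 1) * x + r * y)) \<le> C * ((norm x)\<^sup>2 + (norm y)\<^sup>2) \<and> norm (c x) \<le> \<rho> \<and> norm (g x y) \<le> G"
    and lip: "\<And>x y x' y'. norm x < \<delta> \<Longrightarrow> norm y < \<delta> \<Longrightarrow> norm x' < \<delta> \<Longrightarrow> norm y' < \<delta> \<Longrightarrow>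
       norm (a x y - a x' y') \<le> L * (norm (x - x') + norm (y - y')) \<and>
       norm (g x y - g x' y') \<le> L * (norm (x - x') + norm (y - y')) \<and> norm (c x - c x') \<le> L * norm (x - x')"
    and lims: "x \<longlonglongrightarrow> 0" "y \<longlonglongrightarrow> 0" "x' \<longlonglongrightarrow> 0" "y' \<longlonglongrightarrow> 0"
    and dyn: "\<forall>\<^sub>F n in sequentially. x n \<noteq> 0 \<and> x n = x (Suc n) + (x (Suc n))\<^sup>2 * a (x (Suc n)) (y (Suc n)) \<and>
       y n = c (x (Suc n)) * y (Suc n) + (x (Suc n))\<^sup>2 * g (x (Suc n)) (y (Suc n))"
    and dyn': "\<forall>\<^sub>F n in sequentially. x' n \<noteq> 0 \<and> x' n = x' (Suc n) + (x' (Suc n))\<^sup>2 * a (x' (Suc n)) (y' (Suc n)) \<and>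
       y' n = c (x' (Suc n)) * y' (Suc n) + (x' (Suc n))\<^sup>2 * g (x' (Suc n)) (y' (Suc n))"
    and same: "(\<lambda>n. w_out q (x n, y n) - w_out q (x' n, y' n)) \<longlonglongrightarrow> 0"
  shows "\<forall>\<^sub>F n in sequentially. x n = x' n \<and> y n = y' n"
proof -
  have small: "\<forall>\<^sub>F n in sequentially. norm (z n) < \<delta>" if "z \<longlonglongrightarrow> 0" for z :: "nat \<Rightarrow> complex"
    using order_tendstoD(2)[OF tendsto_norm[OF that]] csts by simp
  have shape: "convergent (\<lambda>n. w_out q (x n, y n) + of_nat n) \<and> (\<lambda>n. 1 / x n / of_nat n) \<longlonglongrightarrow> 1 \<and>
      (\<forall>\<^sub>F n in sequentially. norm (x n) \<le> 2 / real n \<and> 0 < Re (x n))"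
    if lims: "x \<longlonglongrightarrow> 0" "y \<longlonglongrightarrow> 0"
    and dyn: "\<forall>\<^sub>F n in sequentially. x n \<noteq> 0 \<and> x n = x (Suc n) + (x (Suc n))\<^sup>2 * a (x (Suc n)) (y (Suc n)) \<and>
       y n = c (x (Suc n)) * y (Suc n) + (x (Suc n))\<^sup>2 * g (x (Suc n)) (y (Suc n))" for x y
  proof -
    have "\<forall>\<^sub>F n in sequentially. x (Suc n) \<noteq> 0"
      using dyn by (subst eventually_sequentially_Suc) (auto elim: eventually_mono)
    then have "\<forall>\<^sub>F n in sequentially. x (Suc n) \<noteq> 0 \<and> (\<exists>a b g. x n = x (Suc n) + (x (Suc n))\<^sup>2 * a \<and>
       y n = b * y (Suc n) + (x (Suc n))\<^sup>2 * g \<and>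
       norm (a - (1 + (q + 1) * x (Suc n) + r * y (Suc n))) \<le> C * ((norm (x (Suc n)))\<^sup>2 + (norm (y (Suc n)))\<^sup>2) \<and>
       norm b \<le> \<rho> \<and> norm g \<le> G)"
      using dyn small[OF LIMSEQ_Suc[OF lims(1)]] small[OF LIMSEQ_Suc[OF lims(2)]]
    proof eventually_elim
      case (elim n)
      then show ?case using bounds[of "x (Suc n)" "y (Suc n)"] by blast
    qed
    from outgoing_orbit[OF csts(1-4) lims this] show ?thesis by blast
  qed
  note S = shape[OF lims(1,2) dyn] and S' = shape[OF lims(3,4) dyn']
  define D where "D n = 1 / x n - 1 / x' n" for n
  have D0: "D \<longlonglongrightarrow> 0"
  proof -
    have "\<forall>\<^sub>F n in sequentially. 0 < Re (x n)" "\<forall>\<^sub>F n in sequentially. 0 < Re (x' n)"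
      using S S' by (auto elim: eventually_mono)
    then have "(\<lambda>n. Ln (x n) - Ln (x' n)) \<longlonglongrightarrow> 0" using S S' by (intro Ln_diff_tendsto_0) auto
    then have "(\<lambda>n. - ((w_out q (x n, y n) - w_out q (x' n, y' n)) + q * (Ln (x n) - Ln (x' n)))) \<longlonglongrightarrow> - (0 + q * 0)"
      by (intro tendsto_intros same)
    then show ?thesis by (simp add: w_out_def D_def[abs_def] algebra_simps)
  qed
  obtain \<delta>1 C' where d: "0 < \<delta>1"
    and inc: "\<And>x (y::complex) (e::complex) a. \<lbrakk>norm x < \<delta>1; norm y < \<delta>1; norm e < \<delta>1;
        norm (a - (1 + (q + 1) * x + r * y)) \<le> C * ((norm x)\<^sup>2 + (norm y)\<^sup>2 + (norm e)\<^sup>2)\<rbrakk> \<Longrightarrow>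
       norm (x * a) \<le> 1 / 4 \<and> norm (a / (1 + x * a) - 1) \<le> 1 / 4 \<and>
       norm (a / (1 + x * a) - q * Ln (1 + x * a) - (1 + r * y))
         \<le> C' * ((norm x)\<^sup>2 + (norm y)\<^sup>2 + (norm e)\<^sup>2)"
    using normal_form_increment[OF csts(1), of q r] by metis
  \<comment> \<open>Small enough that \<rho> + \<epsilon>L <= \<sigma> < 1, so that the dependence
    of \<open>g\<close> on y does not spoil the contraction of y - y'.\<close>
  define \<epsilon> where "\<epsilon> = min (min \<delta> \<delta>1) (min 1 ((1 - \<rho>) / (2 * (L + 1))))"
  have eps: "0 < \<epsilon>" "\<epsilon> \<le> \<delta>" "\<epsilon> \<le> \<delta>1" "\<epsilon> \<le> 1" "\<epsilon> * L \<le> (1 - \<rho>) / 2"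
  proof -
    have p: "0 < (1 - \<rho>) / (2 * (L + 1))" using csts by (intro divide_pos_pos) auto
    then show e0: "0 < \<epsilon>" unfolding \<epsilon>_def using csts d by simp
    show "\<epsilon> \<le> \<delta>" "\<epsilon> \<le> \<delta>1" "\<epsilon> \<le> 1" unfolding \<epsilon>_def by linarith+
    have "\<epsilon> * L \<le> (1 - \<rho>) / (2 * (L + 1)) * (L + 1)"
    proof (rule mult_mono)
      show "\<epsilon> \<le> (1 - \<rho>) / (2 * (L + 1))" unfolding \<epsilon>_def by linarith
    qed (use p csts in auto)
    also have "\<dots> = (1 - \<rho>) / 2" using csts by (simp add: field_simps)
    finally show "\<epsilon> * L \<le> (1 - \<rho>) / 2" .
  qed
  define \<sigma> where "\<sigma> = (1 + \<rho>) / 2"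
  have sig: "0 \<le> \<sigma>" "\<sigma> < 1" unfolding \<sigma>_def using csts by auto
  \<comment> \<open>If |D| <= s, then c1 s/m^2 is the forcing in the recursion for |y - y'|, and
    Ks/m^2 bounds the increments of D.\<close>
  define c1 where "c1 = 4 * (2 * L + 2 * G)"
  define K where "K = (2 * L + 8) * (4 + c1 / (1 - \<sigma>))"
  have K0: "0 \<le> c1" "0 \<le> K" unfolding K_def c1_def using csts sig by auto
  have small': "\<forall>\<^sub>F n in sequentially. norm (z n) < \<epsilon>" if "z \<longlonglongrightarrow> 0" for z :: "nat \<Rightarrow> complex"
    using order_tendstoD(2)[OF tendsto_norm[OF that]] eps by simp
  define P where "P n \<longleftrightarrow> x n \<noteq> 0 \<and> x n = x (Suc n) + (x (Suc n))\<^sup>2 * a (x (Suc n)) (y (Suc n)) \<and>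
       y n = c (x (Suc n)) * y (Suc n) + (x (Suc n))\<^sup>2 * g (x (Suc n)) (y (Suc n))" for n
  define P' where "P' n \<longleftrightarrow> x' n \<noteq> 0 \<and> x' n = x' (Suc n) + (x' (Suc n))\<^sup>2 * a (x' (Suc n)) (y' (Suc n)) \<and>
       y' n = c (x' (Suc n)) * y' (Suc n) + (x' (Suc n))\<^sup>2 * g (x' (Suc n)) (y' (Suc n))" for n
  have "\<forall>\<^sub>F n in sequentially. (norm (x n) < \<epsilon> \<and> norm (y n) < \<epsilon> \<and> norm (x' n) < \<epsilon> \<and> norm (y' n) < \<epsilon>) \<and>
     norm (x n) \<le> 2 / real n \<and> norm (x' n) \<le> 2 / real n \<and> norm (D n) < 1 \<and> 1 \<le> n \<and> 2 * K \<le> real n \<and> P n \<and> P' n"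
  proof (intro eventually_conj small' lims eventually_ge_at_top)
    show "\<forall>\<^sub>F n in sequentially. norm (x n) \<le> 2 / real n" "\<forall>\<^sub>F n in sequentially. norm (x' n) \<le> 2 / real n"
      using S S' by (auto elim: eventually_mono)
    show "\<forall>\<^sub>F n in sequentially. norm (D n) < 1" using order_tendstoD(2)[OF tendsto_norm[OF D0]] by simp
    show "\<forall>\<^sub>F n in sequentially. 2 * K \<le> real n" by real_asymp
    show "\<forall>\<^sub>F n in sequentially. P n" unfolding P_def by (rule dyn)
    show "\<forall>\<^sub>F n in sequentially. P' n" unfolding P'_def by (rule dyn')
  qed
  then obtain N where N: "\<And>n. N \<le> n \<Longrightarrow> (norm (x n) < \<epsilon> \<and> norm (y n) < \<epsilon> \<and> norm (x' n) < \<epsilon> \<and> norm (y' n) < \<epsilon>) \<and>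
     norm (x n) \<le> 2 / real n \<and> norm (x' n) \<le> 2 / real n \<and> norm (D n) < 1 \<and> 1 \<le> n \<and> 2 * K \<le> real n \<and> P n \<and> P' n"
    unfolding eventually_sequentially by blast
  have NP: "x n \<noteq> 0" "x n = x (Suc n) + (x (Suc n))\<^sup>2 * a (x (Suc n)) (y (Suc n))"
     "y n = c (x (Suc n)) * y (Suc n) + (x (Suc n))\<^sup>2 * g (x (Suc n)) (y (Suc n))"
     "x' n \<noteq> 0" "x' n = x' (Suc n) + (x' (Suc n))\<^sup>2 * a (x' (Suc n)) (y' (Suc n))"
     "y' n = c (x' (Suc n)) * y' (Suc n) + (x' (Suc n))\<^sup>2 * g (x' (Suc n)) (y' (Suc n))" if "N \<le> n" for n
    using N[OF that] unfolding P_def P'_def by blast+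
  have N0: "0 < N" using N[of N] by simp
  define E where "E n = norm (y n - y' n)" for n
  have dx: "norm (x n - x' n) \<le> 4 / (real n)\<^sup>2 * norm (D n)" if n: "N \<le> n" for n
  proof -
    have "x n - x' n = - (x n * x' n * D n)"
      unfolding D_def using NP(1,4)[OF n] by (simp add: field_simps)
    then have "norm (x n - x' n) = norm (x n) * norm (x' n) * norm (D n)" by (simp add: norm_mult)
    also have "\<dots> \<le> 2 / real n * (2 / real n) * norm (D n)"
      using N[OF n] by (intro mult_right_mono mult_mono) auto
    finally show ?thesis by (simp add: power2_eq_square)
  qed
  have E: "E n \<le> \<sigma> * E (Suc n) + (2 * L + 2 * G) * norm (x (Suc n) - x' (Suc n))" if n: "N \<le> n" for n
  proof -
    let ?X = "x (Suc n)" and ?Y = "y (Suc n)" and ?X' = "x' (Suc n)" and ?Y' = "y' (Suc n)"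
    note b = N[of "Suc n"]
    have bb: "norm ?X < \<epsilon>" "norm ?Y < \<epsilon>" "norm ?X' < \<epsilon>" "norm ?Y' < \<epsilon>" using b n by auto
    have bd: "norm ?X < \<delta>" "norm ?Y < \<delta>" "norm ?X' < \<delta>" "norm ?Y' < \<delta>" using bb eps by auto
    note lp = lip[OF bd] and B = bounds[OF bd(1,2)] bounds[OF bd(3,4)]
    \<comment> \<open>The last summand 0 pads the sum to the five terms of
      \<open>norm_add5_le\<close>.\<close>
    have eqy: "y n - y' n = c ?X * (?Y - ?Y') + (c ?X - c ?X') * ?Y' + (?X + ?X') * (?X - ?X') * g ?X ?Y
        + ?X'\<^sup>2 * (g ?X ?Y - g ?X' ?Y') + 0"
      unfolding NP(3,6)[OF n] by (simp add: algebra_simps power2_eq_square)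
    have "E n \<le> norm (c ?X * (?Y - ?Y')) + norm ((c ?X - c ?X') * ?Y') + norm ((?X + ?X') * (?X - ?X') * g ?X ?Y)
        + norm (?X'\<^sup>2 * (g ?X ?Y - g ?X' ?Y')) + norm (0 :: complex)"
      unfolding E_def eqy by (rule norm_add5_le)
    also have "\<dots> \<le> \<rho> * E (Suc n) + (L * norm (?X - ?X')) * 1 + 2 * norm (?X - ?X') * G
        + \<epsilon> * (L * (norm (?X - ?X') + E (Suc n))) + 0"
    proof (intro add_mono)
      show "norm (c ?X * (?Y - ?Y')) \<le> \<rho> * E (Suc n)"
        unfolding norm_mult E_def using B by (intro mult_right_mono) auto
      show "norm ((c ?X - c ?X') * ?Y') \<le> (L * norm (?X - ?X')) * 1"
        unfolding norm_mult using lp bb eps csts by (intro mult_mono) auto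
      have "norm (?X + ?X') \<le> 2" using bb eps norm_triangle_ineq[of ?X ?X'] by linarith
      then show "norm ((?X + ?X') * (?X - ?X') * g ?X ?Y) \<le> 2 * norm (?X - ?X') * G"
        unfolding norm_mult using B by (intro mult_mono) auto
      have "(norm ?X')\<^sup>2 \<le> \<epsilon> * 1" unfolding power2_eq_square using bb eps by (intro mult_mono) auto
      then show "norm (?X'\<^sup>2 * (g ?X ?Y - g ?X' ?Y')) \<le> \<epsilon> * (L * (norm (?X - ?X') + E (Suc n)))"
        unfolding norm_mult norm_power E_def using lp eps by (intro mult_mono) auto
    qed auto
    also have "\<dots> = (\<rho> + \<epsilon> * L) * E (Suc n) + (L + 2 * G + \<epsilon> * L) * norm (?X - ?X')"
      by (simp add: algebra_simps)
    also have "\<dots> \<le> \<sigma> * E (Suc n) + (2 * L + 2 * G) * norm (?X - ?X')"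
    proof -
      have "(\<rho> + \<epsilon> * L) * E (Suc n) \<le> \<sigma> * E (Suc n)"
        by (rule mult_right_mono) (use eps in \<open>auto simp: \<sigma>_def field_simps E_def\<close>)
      moreover have "\<epsilon> * L \<le> 1 * L" using eps csts by (intro mult_right_mono) auto
      then have "(L + 2 * G + \<epsilon> * L) * norm (?X - ?X') \<le> (2 * L + 2 * G) * norm (?X - ?X')"
        by (intro mult_right_mono) auto
      ultimately show ?thesis by (rule add_mono)
    qed
    finally show ?thesis .
  qed
  have Ebound: "E n \<le> c1 * s / (1 - \<sigma>) / (real n)\<^sup>2"
    if s: "0 \<le> s" "\<And>m. N \<le> m \<Longrightarrow> norm (D m) \<le> s" and n: "N \<le> n" for n s
  proof (rule backward_decay[where N = N and B = 2, OF sig _ N0 _ _ n])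
    show "0 \<le> c1 * s" using K0 s by simp
    fix m assume m: "N \<le> m"
    have "norm (x (Suc m) - x' (Suc m)) \<le> 4 / (real (Suc m))\<^sup>2 * norm (D (Suc m))" using m by (intro dx) auto
    also have "\<dots> \<le> 4 / (real m)\<^sup>2 * s"
      using m N0 s(1) s(2)[of "Suc m"] by (intro mult_mono divide_left_mono power_mono mult_pos_pos) auto
    finally have "(2 * L + 2 * G) * norm (x (Suc m) - x' (Suc m)) \<le> (2 * L + 2 * G) * (4 / (real m)\<^sup>2 * s)"
      using csts by (intro mult_left_mono) auto
    also have "\<dots> = c1 * s / (real m)\<^sup>2" unfolding c1_def by simp
    finally show "E m \<le> \<sigma> * E (Suc m) + c1 * s / (real m)\<^sup>2" using E[OF m] by linarith
    show "E m \<le> 2" unfolding E_def using N[OF m] eps norm_triangle_ineq4[of "y m" "y' m"] by linarith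
  qed
  have half: "norm (D n) \<le> s / 2" if s: "0 \<le> s" "\<And>m. N \<le> m \<Longrightarrow> norm (D m) \<le> s" and n: "N \<le> n" for n s
  proof -
    have "norm (D n) \<le> K * s / real n"
    proof (rule summed_increments_bound[OF D0 N0 _ _ n])
      show "0 \<le> K * s" using K0 s by simp
      fix m assume m: "N \<le> m"
      let ?X = "x (Suc m)" and ?Y = "y (Suc m)" and ?X' = "x' (Suc m)" and ?Y' = "y' (Suc m)"
      have bb: "norm ?X < \<epsilon>" "norm ?Y < \<epsilon>" "norm ?X' < \<epsilon>" "norm ?Y' < \<epsilon>" using N[of "Suc m"] m by auto
      have bd: "norm ?X < \<delta>" "norm ?Y < \<delta>" "norm ?X' < \<delta>" "norm ?Y' < \<delta>" using bb eps by auto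
      have I: "norm (?X * a ?X ?Y) \<le> 1 / 4" "norm (a ?X ?Y / (1 + ?X * a ?X ?Y) - 1) \<le> 1 / 4"
        "norm (?X' * a ?X' ?Y') \<le> 1 / 4" "norm (a ?X' ?Y' / (1 + ?X' * a ?X' ?Y') - 1) \<le> 1 / 4"
        using inc[of ?X ?Y 0 "a ?X ?Y"] inc[of ?X' ?Y' 0 "a ?X' ?Y'"] bb eps d bounds[OF bd(1,2)] bounds[OF bd(3,4)] by auto
      have nz: "?X \<noteq> 0" "?X' \<noteq> 0" using NP(1,4)[of "Suc m"] m by auto
      have "1 / ?X = 1 / x m + a ?X ?Y / (1 + ?X * a ?X ?Y)"
        by (rule inverse_step(2)[OF nz(1) I(1)]) (rule NP(2)[OF m])
      moreover have "1 / ?X' = 1 / x' m + a ?X' ?Y' / (1 + ?X' * a ?X' ?Y')"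
        by (rule inverse_step(2)[OF nz(2) I(3)]) (rule NP(5)[OF m])
      ultimately have "D (Suc m) - D m = a ?X ?Y / (1 + ?X * a ?X ?Y) - a ?X' ?Y' / (1 + ?X' * a ?X' ?Y')"
        unfolding D_def by simp
      then have "norm (D m - D (Suc m)) \<le> 2 * norm (a ?X ?Y - a ?X' ?Y') + 8 * norm (?X - ?X')"
        using quotient_lipschitz[OF I(1,3,2,4)] norm_minus_commute[of "D m"] by simp
      also have "\<dots> \<le> (2 * L + 8) * (norm (?X - ?X') + E (Suc m))"
      proof -
        have "norm (a ?X ?Y - a ?X' ?Y') \<le> L * (norm (?X - ?X') + E (Suc m))" using lip[OF bd] unfolding E_def by simp
        moreover have "0 \<le> E (Suc m)" unfolding E_def by simp
        ultimately show ?thesis by (simp add: algebra_simps)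
      qed
      also have "\<dots> \<le> (2 * L + 8) * (4 / (real (Suc m))\<^sup>2 * s + c1 * s / (1 - \<sigma>) / (real (Suc m))\<^sup>2)"
      proof (intro mult_left_mono add_mono)
        have "norm (?X - ?X') \<le> 4 / (real (Suc m))\<^sup>2 * norm (D (Suc m))" using m by (intro dx) auto
        also have "\<dots> \<le> 4 / (real (Suc m))\<^sup>2 * s" using s m by (intro mult_left_mono) auto
        finally show "norm (?X - ?X') \<le> 4 / (real (Suc m))\<^sup>2 * s" .
        show "E (Suc m) \<le> c1 * s / (1 - \<sigma>) / (real (Suc m))\<^sup>2" using m by (intro Ebound s) auto
      qed (use csts in auto)
      also have "\<dots> = K * s / (real (Suc m))\<^sup>2"
        unfolding K_def by (simp add: add_divide_distrib distrib_left distrib_right)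
      finally show "norm (D m - D (Suc m)) \<le> K * s / (real (Suc m))\<^sup>2" .
    qed
    also have "\<dots> \<le> s / 2"
    proof -
      have "2 * K * s \<le> real n * s" using N[OF n] s by (intro mult_right_mono) auto
      then show ?thesis using N[OF n] by (simp add: field_simps)
    qed
    finally show ?thesis .
  qed
  \<comment> \<open>|D| < 1 from N on, and \<open>half\<close> improves the bound on this same
    range, so it can be iterated.\<close>
  have pow: "\<forall>m\<ge>N. norm (D m) \<le> (1 / 2) ^ j" for j
  proof (induction j)
    case 0
    then show ?case using N by (auto intro: less_imp_le)
  next
    case (Suc j)
    then show ?case using half[of "(1 / 2) ^ j"] by auto
  qed
  have Dz: "norm (D m) \<le> 0" if "N \<le> m" for m
    by (rule LIMSEQ_le_const[OF LIMSEQ_power_zero[of "1 / 2 :: real"]]) (use pow that in auto)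
  have "x n = x' n \<and> y n = y' n" if n: "N \<le> n" for n
  proof
    show "x n = x' n" using dx[OF n] Dz[OF n] by simp
    have "E n \<le> c1 * 0 / (1 - \<sigma>) / (real n)\<^sup>2" by (rule Ebound[OF _ Dz n]) auto
    then show "y n = y' n" by (simp add: E_def)
  qed
  then show ?thesis unfolding eventually_sequentially by blast
qed


section \<open>Families in normal form\<close>

text \<open>Holomorphy in several variables enters the proof through continuity and through
  restriction to holomorphic curves, where Cauchy's inequality in one variable applies.\<close>

lemma holo3_on_chain:
  assumes "holo3_on f S" "(u t, v t, w t) \<in> S"
    and "(u has_field_derivative u') (at t)" "(v has_field_derivative v') (at t)" "(w has_field_derivative w') (at t)"
  shows "(\<lambda>t. f (u t, v t, w t)) field_differentiable (at t)"
proof -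
  obtain a b c where f: "(f has_derivative (\<lambda>(g, h, k). a * g + b * h + c * k)) (at (u t, v t, w t))"
    using assms(1,2) unfolding holo3_on_def by blast
  have "((\<lambda>t. (u t, v t, w t)) has_derivative (\<lambda>h. (u' * h, v' * h, w' * h))) (at t)"
    using assms(3-5) unfolding has_field_derivative_def by (intro has_derivative_Pair)
  from has_derivative_compose[OF this f]
  have "((\<lambda>t. f (u t, v t, w t)) has_field_derivative (a * u' + b * v' + c * w')) (at t)"
    by (rule has_derivative_imp_has_field_derivative) (simp add: algebra_simps)
  then show ?thesis unfolding field_differentiable_def by blast
qed

lemma holo2_on_chain:
  assumes "holo2_on f S" "(v t, w t) \<in> S"
    and "(v has_field_derivative v') (at t)" "(w has_field_derivative w') (at t)"
  shows "(\<lambda>t. f (v t, w t)) field_differentiable (at t)"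
proof -
  obtain b c where f: "(f has_derivative (\<lambda>(h, k). b * h + c * k)) (at (v t, w t))"
    using assms(1,2) unfolding holo2_on_def by blast
  have "((\<lambda>t. (v t, w t)) has_derivative (\<lambda>h. (v' * h, w' * h))) (at t)"
    using assms(3-4) unfolding has_field_derivative_def by (intro has_derivative_Pair)
  from has_derivative_compose[OF this f]
  have "((\<lambda>t. f (v t, w t)) has_field_derivative (b * v' + c * w')) (at t)"
    by (rule has_derivative_imp_has_field_derivative) (simp add: algebra_simps)
  then show ?thesis unfolding field_differentiable_def by blast
qed

lemma holo3_on_isCont: "holo3_on f S \<Longrightarrow> p \<in> S \<Longrightarrow> isCont f p"
  unfolding holo3_on_def by (metis has_derivative_continuous)

lemma holo2_on_isCont: "holo2_on f S \<Longrightarrow> p \<in> S \<Longrightarrow> isCont f p"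
  unfolding holo2_on_def by (metis has_derivative_continuous)

lemma holo_family_on_isCont:
  assumes "holo_family_on f D S" "e \<in> D" "p \<in> S"
  shows "isCont (\<lambda>(\<epsilon>, p). f \<epsilon> p) (e, p)"
proof -
  have "isCont (\<lambda>z. ((\<lambda>(\<epsilon>, p). fst (f \<epsilon> p)) z, (\<lambda>(\<epsilon>, p). snd (f \<epsilon> p)) z)) (e, p)"
    using assms unfolding holo_family_on_def by (intro continuous_Pair) (auto intro: holo3_on_isCont)
  then show ?thesis by (simp add: case_prod_unfold)
qed

text \<open>Stated for the two components because \<open>field_differentiable\<close> concerns
  functions with values in the field itself.\<close>

definition holo_curve :: "complex set \<Rightarrow> (complex \<Rightarrow> complex \<times> complex) \<Rightarrow> bool" where
  "holo_curve S \<gamma> \<longleftrightarrow> (\<forall>t\<in>S. (\<lambda>t. fst (\<gamma> t)) field_differentiable (at t) \<and> (\<lambda>t. snd (\<gamma> t)) field_differentiable (at t))"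

lemma holo_curve_family:
  assumes "holo_family_on f D S'" "e \<in> D" "holo_curve S \<gamma>" "\<gamma> ` S \<subseteq> S'"
  shows "holo_curve S (\<lambda>t. f e (\<gamma> t))"
  unfolding holo_curve_def
proof (intro ballI)
  fix t assume t: "t \<in> S"
  then obtain v w where vw: "((\<lambda>t. fst (\<gamma> t)) has_field_derivative v) (at t)"
    "((\<lambda>t. snd (\<gamma> t)) has_field_derivative w) (at t)"
    using assms(3) unfolding holo_curve_def field_differentiable_def by blast
  have "(e, fst (\<gamma> t), snd (\<gamma> t)) \<in> D \<times> S'" using assms t by auto
  from holo3_on_chain[of _ "D \<times> S'" "\<lambda>_. e" t, OF _ this DERIV_const vw]
  show "(\<lambda>t. fst (f e (\<gamma> t))) field_differentiable (at t) \<and> (\<lambda>t. snd (f e (\<gamma> t))) field_differentiable (at t)"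
    using assms(1) unfolding holo_family_on_def by fastforce
qed

text \<open>Cauchy's inequality on discs of radius R/4 about the points of the half-size disc bounds
  the derivative by 4M/R.\<close>

lemma bounded_holomorphic_lipschitz:
  fixes f :: "complex \<Rightarrow> complex"
  assumes "0 < R" "f holomorphic_on ball 0 R" "\<And>z. z \<in> ball 0 R \<Longrightarrow> norm (f z) \<le> M"
    and uv: "norm u < R / 2" "norm v < R / 2"
  shows "norm (f u - f v) \<le> 4 * M / R * norm (u - v)"
proof (rule field_differentiable_bound[where S = "ball 0 (R / 2)" and f' = "deriv f"])
  fix z :: complex assume "z \<in> ball 0 (R / 2)"
  then have z: "norm z < R / 2" by simp
  then have "norm z < R" using assms(1) by linarith
  then have "z \<in> ball 0 R" by simp
  from holomorphic_derivI[OF assms(2) open_ball this]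
  show "(f has_field_derivative deriv f z) (at z within ball 0 (R / 2))" .
  have sub: "cball z (R / 4) \<subseteq> ball 0 R"
  proof
    fix w assume "w \<in> cball z (R / 4)"
    then have "norm (w - z) \<le> R / 4" by (simp add: dist_norm norm_minus_commute)
    then show "w \<in> ball 0 R" using z norm_triangle_ineq[of "w - z" z] assms(1) by simp
  qed
  have "norm ((deriv ^^ 1) f z) \<le> fact 1 * M / (R / 4) ^ 1"
  proof (rule Cauchy_inequality)
    show "f holomorphic_on ball z (R / 4)"
      by (rule holomorphic_on_subset[OF assms(2)]) (use sub in auto)
    show "continuous_on (cball z (R / 4)) f"
      by (rule continuous_on_subset[OF holomorphic_on_imp_continuous_on[OF assms(2)] sub])
    fix w assume "norm (z - w) = R / 4"
    then have "w \<in> cball z (R / 4)" by (simp add: dist_norm)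
    then show "norm (f w) \<le> M" using sub assms(3) by blast
  qed (use assms in auto)
  then show "norm (deriv f z) \<le> 4 * M / R" by (simp add: mult.commute)
qed (use uv in auto)

lemma continuous_on_funpow:
  fixes F :: "'a::t2_space \<Rightarrow> 'a"
  assumes "continuous_on UNIV F"
  shows "continuous_on UNIV (F ^^ n)"
proof (induction n)
  case (Suc n)
  then show ?case unfolding funpow.simps by (rule continuous_on_compose) (rule continuous_on_subset[OF assms], simp)
qed (simp add: continuous_on_id)

section \<open>The family in its moving charts, uniformly for small parameters\<close>

locale semi_parabolic_family =
  fixes F :: "complex \<Rightarrow> complex \<times> complex \<Rightarrow> complex \<times> complex"
    and D :: "complex set" and z\<^sub>0 :: "complex \<times> complex" and U :: "(complex \<times> complex) set"
    and \<Phi> :: "complex \<Rightarrow> complex \<times> complex \<Rightarrow> complex \<times> complex"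
    and q r b :: complex
    and a \<beta> :: "complex \<times> complex \<times> complex \<Rightarrow> complex" and c :: "complex \<times> complex \<Rightarrow> complex"
  assumes D: "open D" "0 \<in> D"
    and diffeo: "\<And>e. e \<in> D \<Longrightarrow> polynomial_diffeo (F e)"
    and F_holo: "holo_family_on F D UNIV"
    and fixpoint: "F 0 z\<^sub>0 = z\<^sub>0"
    and coords: "local_coordinates D U z\<^sub>0 \<Phi>"
    and a_holo: "holo3_on a (SIGMA \<epsilon>:D. \<Phi> \<epsilon> ` U)"
    and \<beta>_holo: "holo3_on \<beta> (SIGMA \<epsilon>:D. \<Phi> \<epsilon> ` U)"
    and c_holo: "holo2_on c (SIGMA \<epsilon>:D. fst ` \<Phi> \<epsilon> ` U)"
    and a_expansion: "(\<lambda>(\<epsilon>, x, y). a (\<epsilon>, x, y) - (1 + (q + 1) * x + r * y))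
          \<in> O[nhds (0, 0, 0)](\<lambda>(\<epsilon>, x, y). of_real ((norm x)\<^sup>2 + (norm y)\<^sup>2 + (norm \<epsilon>)\<^sup>2))"
    and c0: "c (0, 0) = b"
    and normal_form: "\<And>\<epsilon> p x y. \<lbrakk>\<epsilon> \<in> D; p \<in> U; F \<epsilon> p \<in> U; \<Phi> \<epsilon> p = (x, y)\<rbrakk> \<Longrightarrow>
        \<Phi> \<epsilon> (F \<epsilon> p) = (x + (x\<^sup>2 + \<epsilon>\<^sup>2) * a (\<epsilon>, x, y), c (\<epsilon>, x) * y + (x\<^sup>2 + \<epsilon>\<^sup>2) * \<beta> (\<epsilon>, x, y))"
    and b1: "norm b < 1"
begin

lemma coords': "open U" "z\<^sub>0 \<in> U" "\<Phi> 0 z\<^sub>0 = (0, 0)" "holo_family_on \<Phi> D U" "inj_on (\<Phi> 0) U" "open (\<Phi> 0 ` U)"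
    "holo2_map_on (inv_into U (\<Phi> 0)) (\<Phi> 0 ` U)"
  using coords D unfolding local_coordinates_def by auto

lemma zero_in_image: "(0, 0) \<in> \<Phi> 0 ` U"
  using coords' by (metis image_eqI)

text \<open>Continuity at the origin, and the expansion of a; \<rho> is halfway between |b| and
  1.\<close>

lemma bounds_near_0:
  obtains \<delta> C G \<rho> where "0 < \<delta>" "0 \<le> C" "0 \<le> G" "0 \<le> \<rho>" "\<rho> < 1"
    "\<And>e x y. norm e < \<delta> \<Longrightarrow> norm x < \<delta> \<Longrightarrow> norm y < \<delta> \<Longrightarrow>
       e \<in> D \<and> norm (a (e, x, y) - (1 + (q + 1) * x + r * y)) \<le> C * ((norm x)\<^sup>2 + (norm y)\<^sup>2 + (norm e)\<^sup>2) \<and>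
       norm (c (e, x)) \<le> \<rho> \<and> norm (\<beta> (e, x, y)) \<le> G \<and> norm (a (e, x, y)) \<le> G"
proof -
  have mem: "(0, 0, 0) \<in> (SIGMA \<epsilon>:D. \<Phi> \<epsilon> ` U)" "(0, 0) \<in> (SIGMA \<epsilon>:D. fst ` \<Phi> \<epsilon> ` U)"
    using D imageI[OF zero_in_image, of fst] zero_in_image by simp_all
  obtain C where C: "0 < C" "\<forall>\<^sub>F z in nhds (0, 0, 0).
     norm ((\<lambda>(\<epsilon>, x, y). a (\<epsilon>, x, y) - (1 + (q + 1) * x + r * y)) z)
       \<le> C * norm ((\<lambda>(\<epsilon>::complex, x::complex, y::complex). of_real ((norm x)\<^sup>2 + (norm y)\<^sup>2 + (norm \<epsilon>)\<^sup>2) :: complex) z)"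
    by (rule landau_o.bigE[OF a_expansion]) (rule that)
  have ev: "\<forall>\<^sub>F z in nhds z0. norm (f z) < B" if "isCont f z0" "norm (f z0) < B"
    for f :: "'z::t2_space \<Rightarrow> complex" and z0 B
  proof -
    have "(f \<longlongrightarrow> f z0) (nhds z0)" using that(1) by (simp add: isCont_def tendsto_at_iff_tendsto_nhds)
    from order_tendstoD(2)[OF tendsto_norm[OF this] that(2)] show ?thesis .
  qed
  define G where "G = max (norm (a (0, 0, 0))) (norm (\<beta> (0, 0, 0))) + 1"
  define \<rho> where "\<rho> = (1 + norm b) / 2"
  have e1: "\<forall>\<^sub>F z in nhds (0, 0, 0). norm (a z) < G" "\<forall>\<^sub>F z in nhds (0, 0, 0). norm (\<beta> z) < G"
    by (intro ev holo3_on_isCont[OF a_holo] holo3_on_isCont[OF \<beta>_holo] mem; simp add: G_def)+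
  have e2: "\<forall>\<^sub>F z in nhds (0, 0). norm (c z) < \<rho>"
    by (intro ev holo2_on_isCont[OF c_holo] mem) (use b1 in \<open>simp add: \<rho>_def c0\<close>)
  have "\<forall>\<^sub>F z in nhds (0, 0, 0). norm (a z) < G \<and> norm (\<beta> z) < G \<and>
     norm ((\<lambda>(\<epsilon>, x, y). a (\<epsilon>, x, y) - (1 + (q + 1) * x + r * y)) z)
       \<le> C * norm ((\<lambda>(\<epsilon>::complex, x::complex, y::complex). of_real ((norm x)\<^sup>2 + (norm y)\<^sup>2 + (norm \<epsilon>)\<^sup>2) :: complex) z)"
    using e1 C(2) by eventually_elim auto
  then obtain d1 where d1: "0 < d1" "\<And>z. dist z (0, 0, 0) < d1 \<Longrightarrow> norm (a z) < G \<and> norm (\<beta> z) < G \<and>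
     norm ((\<lambda>(\<epsilon>, x, y). a (\<epsilon>, x, y) - (1 + (q + 1) * x + r * y)) z)
       \<le> C * norm ((\<lambda>(\<epsilon>::complex, x::complex, y::complex). of_real ((norm x)\<^sup>2 + (norm y)\<^sup>2 + (norm \<epsilon>)\<^sup>2) :: complex) z)"
    unfolding eventually_nhds_metric by blast
  obtain d2 where d2: "0 < d2" "\<And>z. dist z (0, 0) < d2 \<Longrightarrow> norm (c z) < \<rho>"
    using e2 unfolding eventually_nhds_metric by blast
  obtain d3 where d3: "0 < d3" "ball 0 d3 \<subseteq> D" using D open_contains_ball by blast
  have n3: "norm (e, x, y) \<le> norm e + norm x + norm y" for e x y :: complex
    using norm_Pair_le[of e "(x, y)"] norm_Pair_le[of x y] by linarith
  show thesis
  proof (rule that[of "min (d1 / 3) (min (d2 / 2) d3)" C G \<rho>])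
    show "0 < min (d1 / 3) (min (d2 / 2) d3)" "0 \<le> C" "0 \<le> G" "0 \<le> \<rho>" "\<rho> < 1"
      using d1 d2 d3 C b1 unfolding G_def \<rho>_def by (auto simp: le_max_iff_disj intro: add_nonneg_nonneg)
    fix e x y :: complex
    assume "norm e < min (d1 / 3) (min (d2 / 2) d3)" "norm x < min (d1 / 3) (min (d2 / 2) d3)"
      "norm y < min (d1 / 3) (min (d2 / 2) d3)"
    then have "norm (e, x, y) < d1" "norm (e, x) < d2" "norm e < d3"
      using n3[of e x y] norm_Pair_le[of e x] by auto
    then have "dist (e, x, y) (0, 0, 0) < d1" "dist (e, x) (0, 0) < d2" "e \<in> D"
      using d3 by (auto simp: dist_norm)
    then show "e \<in> D \<and> norm (a (e, x, y) - (1 + (q + 1) * x + r * y)) \<le> C * ((norm x)\<^sup>2 + (norm y)\<^sup>2 + (norm e)\<^sup>2) \<and>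
       norm (c (e, x)) \<le> \<rho> \<and> norm (\<beta> (e, x, y)) \<le> G \<and> norm (a (e, x, y)) \<le> G"
      using d1(2)[of "(e, x, y)"] d2(2)[of "(e, x)"] by (auto simp del: of_real_add of_real_power)
  qed
qed

lemma \<Phi>_tendsto:
  assumes "(e \<longlongrightarrow> e0) A" "(p \<longlongrightarrow> p0) A" "e0 \<in> D" "p0 \<in> U"
  shows "((\<lambda>i. \<Phi> (e i) (p i)) \<longlongrightarrow> \<Phi> e0 p0) A"
  using isCont_tendsto_compose[OF holo_family_on_isCont[OF coords'(4) assms(3,4)] tendsto_Pair[OF assms(1,2)]]
  by simp

lemma F_continuous: "continuous_on (D \<times> UNIV) (\<lambda>(\<epsilon>, p). F \<epsilon> p)"
  by (intro continuous_at_imp_continuous_on ballI) (auto intro: holo_family_on_isCont[OF F_holo])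

lemma funpow_F_tendsto:
  assumes "(e \<longlongrightarrow> e0) A" "(p \<longlongrightarrow> p0) A" "e0 \<in> D"
  shows "((\<lambda>i. (F (e i) ^^ n) (p i)) \<longlongrightarrow> (F e0 ^^ n) p0) A"
  by (rule funpow_tendsto[OF F_continuous D(1) assms(3,1,2)])

text \<open>The inverse charts are not assumed to be jointly continuous in point and parameter, so
  closeness to the fixed point is not obtained by inverting them. Instead, a limit point l of the
  sequence in the compact set satisfies \<open>\<Phi> 0 l = \<Phi> 0 z\<^sub>0\<close>, and \<Phi> 0
  is injective.\<close>

lemma tendsto_fixpoint:
  assumes K: "compact K" "K \<subseteq> U" and p: "\<And>i. p i \<in> K" and e: "e \<longlonglongrightarrow> 0" and lim: "(\<lambda>i. \<Phi> (e i) (p i)) \<longlonglongrightarrow> (0, 0)"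
  shows "p \<longlonglongrightarrow> z\<^sub>0"
proof (rule ccontr)
  assume "\<not> p \<longlonglongrightarrow> z\<^sub>0"
  then obtain \<eta> where \<eta>: "0 < \<eta>" "\<exists>\<^sub>F i in sequentially. \<eta> \<le> dist (p i) z\<^sub>0"
    unfolding tendsto_iff by (auto simp: frequently_def not_le)
  then have inf: "infinite {i. \<eta> \<le> dist (p i) z\<^sub>0}"
    by (simp add: frequently_cofinite[symmetric] cofinite_eq_sequentially)
  define \<sigma> where "\<sigma> = enumerate {i. \<eta> \<le> dist (p i) z\<^sub>0}"
  have \<sigma>: "strict_mono \<sigma>" "\<And>i. \<eta> \<le> dist (p (\<sigma> i)) z\<^sub>0"
    using inf enumerate_in_set[OF inf] unfolding \<sigma>_def by (auto simp: strict_mono_enumerate)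
  have "\<exists>l\<in>K. \<exists>\<tau>. strict_mono \<tau> \<and> ((p \<circ> \<sigma>) \<circ> \<tau>) \<longlonglongrightarrow> l"
    by (rule K(1)[unfolded compact_def, rule_format]) (simp add: p)
  then obtain l \<tau> where l: "l \<in> K" "strict_mono \<tau>" "((p \<circ> \<sigma>) \<circ> \<tau>) \<longlonglongrightarrow> l" by blast
  define \<mu> where "\<mu> = \<sigma> \<circ> \<tau>"
  have \<mu>: "strict_mono \<mu>" unfolding \<mu>_def using \<sigma> l by (simp add: strict_mono_o)
  have pl: "(\<lambda>i. p (\<mu> i)) \<longlonglongrightarrow> l" using l(3) by (simp add: \<mu>_def o_def)
  have el: "(\<lambda>i. e (\<mu> i)) \<longlonglongrightarrow> 0" using LIMSEQ_subseq_LIMSEQ[OF e \<mu>] by (simp add: o_def)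
  have "(\<lambda>i. \<Phi> (e (\<mu> i)) (p (\<mu> i))) \<longlonglongrightarrow> \<Phi> 0 l" using \<Phi>_tendsto[OF el pl] D l K by auto
  moreover have "(\<lambda>i. \<Phi> (e (\<mu> i)) (p (\<mu> i))) \<longlonglongrightarrow> (0, 0)" using LIMSEQ_subseq_LIMSEQ[OF lim \<mu>] by (simp add: o_def)
  ultimately have "\<Phi> 0 l = \<Phi> 0 z\<^sub>0" unfolding coords'(3) by (rule LIMSEQ_unique)
  then have "l = z\<^sub>0" by (rule inj_onD[OF coords'(5)]) (use coords'(2) l K in auto)
  then have "(\<lambda>i. dist (p (\<mu> i)) z\<^sub>0) \<longlonglongrightarrow> 0" using tendsto_dist[OF pl tendsto_const[of z\<^sub>0]] by simp
  then have "\<forall>\<^sub>F i in sequentially. dist (p (\<mu> i)) z\<^sub>0 < \<eta>" using \<eta>(1) by (rule order_tendstoD(2))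
  then obtain i where "dist (p (\<mu> i)) z\<^sub>0 < \<eta>" using eventually_happens'[OF sequentially_bot] by blast
  then show False using \<sigma>(2)[of "\<tau> i"] by (simp add: \<mu>_def)
qed

text \<open>The normal form speaks only of points whose image also lies in the chart domain. On the
  compact ball K, small coordinates mean closeness to the fixed point, and then the image is in K
  again. Thus smallness of the coordinates alone keeps an orbit in K and the recursion
  valid.\<close>

lemma tracking:
  obtains K \<delta> C G \<rho> where "compact K" "K \<subseteq> U" "z\<^sub>0 \<in> interior K"
    "0 < \<delta>" "0 \<le> C" "0 \<le> G" "0 \<le> \<rho>" "\<rho> < 1"
    "\<And>e p. \<lbrakk>p \<in> K; norm e < \<delta>; norm (fst (\<Phi> e p)) < \<delta>; norm (snd (\<Phi> e p)) < \<delta>\<rbrakk> \<Longrightarrow> F e p \<in> K \<and>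
       fst (\<Phi> e (F e p)) = fst (\<Phi> e p) + ((fst (\<Phi> e p))\<^sup>2 + e\<^sup>2) * a (e, \<Phi> e p) \<and>
       snd (\<Phi> e (F e p)) = c (e, fst (\<Phi> e p)) * snd (\<Phi> e p) + ((fst (\<Phi> e p))\<^sup>2 + e\<^sup>2) * \<beta> (e, \<Phi> e p)"
    "\<And>e x y. norm e < \<delta> \<Longrightarrow> norm x < \<delta> \<Longrightarrow> norm y < \<delta> \<Longrightarrow>
       e \<in> D \<and> norm (a (e, x, y) - (1 + (q + 1) * x + r * y)) \<le> C * ((norm x)\<^sup>2 + (norm y)\<^sup>2 + (norm e)\<^sup>2) \<and>
       norm (c (e, x)) \<le> \<rho> \<and> norm (\<beta> (e, x, y)) \<le> G \<and> norm (a (e, x, y)) \<le> G"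
proof -
  obtain \<delta>1 C G \<rho> where B: "0 < \<delta>1" "0 \<le> C" "0 \<le> G" "0 \<le> \<rho>" "\<rho> < 1"
    "\<And>e x y. norm e < \<delta>1 \<Longrightarrow> norm x < \<delta>1 \<Longrightarrow> norm y < \<delta>1 \<Longrightarrow>
       e \<in> D \<and> norm (a (e, x, y) - (1 + (q + 1) * x + r * y)) \<le> C * ((norm x)\<^sup>2 + (norm y)\<^sup>2 + (norm e)\<^sup>2) \<and>
       norm (c (e, x)) \<le> \<rho> \<and> norm (\<beta> (e, x, y)) \<le> G \<and> norm (a (e, x, y)) \<le> G"
    by (rule bounds_near_0) (rule that)
  obtain s where s: "0 < s" "cball z\<^sub>0 s \<subseteq> U"
    using open_contains_cball[THEN iffD1, OF coords'(1)] coords'(2) by blast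
  define K where "K = cball z\<^sub>0 s"
  have K: "compact K" "K \<subseteq> U" "z\<^sub>0 \<in> interior K" unfolding K_def using s by auto
  have "isCont (\<lambda>(\<epsilon>, p). F \<epsilon> p) (0, z\<^sub>0)" using holo_family_on_isCont[OF F_holo] D by simp
  then have "((\<lambda>(\<epsilon>, p). F \<epsilon> p) \<longlongrightarrow> z\<^sub>0) (nhds (0, z\<^sub>0))"
    using tendsto_at_iff_tendsto_nhds[of "\<lambda>(\<epsilon>, p). F \<epsilon> p" "(0, z\<^sub>0)"] by (simp add: isCont_def fixpoint)
  from topological_tendstoD[OF this open_interior K(3)]
  have "\<forall>\<^sub>F z in nhds (0, z\<^sub>0). (\<lambda>(\<epsilon>, p). F \<epsilon> p) z \<in> K"
    by (rule eventually_mono) (use interior_subset in blast)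
  then obtain t where t: "0 < t" "\<And>z. dist z (0, z\<^sub>0) < t \<Longrightarrow> (\<lambda>(\<epsilon>, p). F \<epsilon> p) z \<in> K"
    unfolding eventually_nhds_metric by blast
  have "\<exists>\<eta>>0. \<forall>e p. p \<in> K \<and> norm e < \<eta> \<and> norm (fst (\<Phi> e p)) < \<eta> \<and> norm (snd (\<Phi> e p)) < \<eta> \<longrightarrow> dist p z\<^sub>0 < t / 2"
  proof (rule ccontr)
    assume "\<not> ?thesis"
    then have ex: "\<exists>e p. p \<in> K \<and> norm e < h \<and> norm (fst (\<Phi> e p)) < h \<and> norm (snd (\<Phi> e p)) < h \<and> \<not> dist p z\<^sub>0 < t / 2"
      if "0 < h" for h using that by blast
    have "\<forall>n. \<exists>e p. p \<in> K \<and> norm e < inverse (real (Suc n)) \<and> norm (fst (\<Phi> e p)) < inverse (real (Suc n)) \<and>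
        norm (snd (\<Phi> e p)) < inverse (real (Suc n)) \<and> \<not> dist p z\<^sub>0 < t / 2"
      by (intro allI ex) simp
    then obtain e p where "\<forall>n. p n \<in> K \<and> norm (e n) < inverse (real (Suc n)) \<and> norm (fst (\<Phi> (e n) (p n))) < inverse (real (Suc n)) \<and>
        norm (snd (\<Phi> (e n) (p n))) < inverse (real (Suc n)) \<and> \<not> dist (p n) z\<^sub>0 < t / 2"
      unfolding choice_iff by blast
    then have ep: "\<And>n. p n \<in> K" "\<And>n. norm (e n) < inverse (real (Suc n))"
        "\<And>n. norm (fst (\<Phi> (e n) (p n))) < inverse (real (Suc n))"
        "\<And>n. norm (snd (\<Phi> (e n) (p n))) < inverse (real (Suc n))" "\<And>n. \<not> dist (p n) z\<^sub>0 < t / 2"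
      by blast+
    have z: "u \<longlonglongrightarrow> 0" if "\<And>n. norm (u n) < inverse (real (Suc n))" for u :: "nat \<Rightarrow> complex"
      by (rule Lim_null_comparison[OF _ LIMSEQ_inverse_real_of_nat]) (intro always_eventually allI less_imp_le[OF that])
    have "(\<lambda>n. (fst (\<Phi> (e n) (p n)), snd (\<Phi> (e n) (p n)))) \<longlonglongrightarrow> (0, 0)"
      by (intro tendsto_Pair z ep)
    then have pl: "p \<longlonglongrightarrow> z\<^sub>0" using tendsto_fixpoint[OF K(1,2) ep(1) z[OF ep(2)]] by simp
    have "(\<lambda>n. dist (p n) z\<^sub>0) \<longlonglongrightarrow> 0" using tendsto_dist[OF pl tendsto_const[of z\<^sub>0]] by simp
    then have "\<forall>\<^sub>F n in sequentially. dist (p n) z\<^sub>0 < t / 2" using t by (intro order_tendstoD(2)) auto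
    then show False using ep(5) by simp
  qed
  then obtain \<eta> where \<eta>: "0 < \<eta>" "\<And>e p. \<lbrakk>p \<in> K; norm e < \<eta>; norm (fst (\<Phi> e p)) < \<eta>; norm (snd (\<Phi> e p)) < \<eta>\<rbrakk> \<Longrightarrow> dist p z\<^sub>0 < t / 2"
    by blast
  \<comment> \<open>The parameter and the point contribute at most t/2 each to the distance t within
    which images stay in K.\<close>
  define \<delta> where "\<delta> = min \<delta>1 (min \<eta> (t / 2))"
  have \<delta>: "0 < \<delta>" "\<delta> \<le> \<delta>1" "\<delta> \<le> \<eta>" "\<delta> \<le> t / 2" unfolding \<delta>_def using B \<eta> t by auto
  show thesis
  proof (rule that[OF K \<delta>(1) B(2-5)])
    fix e p assume p: "p \<in> K" "norm e < \<delta>" "norm (fst (\<Phi> e p)) < \<delta>" "norm (snd (\<Phi> e p)) < \<delta>"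
    have "dist p z\<^sub>0 < t / 2" using \<eta>(2)[of p e] p \<delta> by auto
    then have "norm (e, p - z\<^sub>0) < t" using norm_Pair_le[of e "p - z\<^sub>0"] p \<delta> by (simp add: dist_norm)
    then have FK: "F e p \<in> K" using t(2)[of "(e, p)"] by (simp add: dist_norm)
    have "e \<in> D" using B(6)[of e 0 0] p \<delta> B(1) by auto
    moreover obtain x y where xy: "\<Phi> e p = (x, y)" by (cases "\<Phi> e p")
    ultimately have "\<Phi> e (F e p) = (x + (x\<^sup>2 + e\<^sup>2) * a (e, x, y), c (e, x) * y + (x\<^sup>2 + e\<^sup>2) * \<beta> (e, x, y))"
      using FK p(1) K(2) by (intro normal_form) auto
    then show "F e p \<in> K \<and>
       fst (\<Phi> e (F e p)) = fst (\<Phi> e p) + ((fst (\<Phi> e p))\<^sup>2 + e\<^sup>2) * a (e, \<Phi> e p) \<and>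
       snd (\<Phi> e (F e p)) = c (e, fst (\<Phi> e p)) * snd (\<Phi> e p) + ((fst (\<Phi> e p))\<^sup>2 + e\<^sup>2) * \<beta> (e, \<Phi> e p)"
      using FK by (simp add: xy)
  next
    fix e x y :: complex assume "norm e < \<delta>" "norm x < \<delta>" "norm y < \<delta>"
    then show "e \<in> D \<and> norm (a (e, x, y) - (1 + (q + 1) * x + r * y)) \<le> C * ((norm x)\<^sup>2 + (norm y)\<^sup>2 + (norm e)\<^sup>2) \<and>
       norm (c (e, x)) \<le> \<rho> \<and> norm (\<beta> (e, x, y)) \<le> G \<and> norm (a (e, x, y)) \<le> G"
      using \<delta> by (intro B(6)) auto
  qed
qed

end

text \<open>The neighborhood and the constants found in \<open>tracking\<close> become parameters,
  so that all later statements share them.\<close>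

locale tracked_semi_parabolic_family = semi_parabolic_family +
  fixes K :: "(complex \<times> complex) set" and \<delta> C G \<rho> :: real
  assumes K: "compact K" "K \<subseteq> U" "z\<^sub>0 \<in> interior K"
    and csts: "0 < \<delta>" "0 \<le> C" "0 \<le> G" "0 \<le> \<rho>" "\<rho> < 1"
    and track: "\<And>e p. \<lbrakk>p \<in> K; norm e < \<delta>; norm (fst (\<Phi> e p)) < \<delta>; norm (snd (\<Phi> e p)) < \<delta>\<rbrakk> \<Longrightarrow> F e p \<in> K \<and>
       fst (\<Phi> e (F e p)) = fst (\<Phi> e p) + ((fst (\<Phi> e p))\<^sup>2 + e\<^sup>2) * a (e, \<Phi> e p) \<and>
       snd (\<Phi> e (F e p)) = c (e, fst (\<Phi> e p)) * snd (\<Phi> e p) + ((fst (\<Phi> e p))\<^sup>2 + e\<^sup>2) * \<beta> (e, \<Phi> e p)"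
    and bounds: "\<And>e x y. norm e < \<delta> \<Longrightarrow> norm x < \<delta> \<Longrightarrow> norm y < \<delta> \<Longrightarrow>
       e \<in> D \<and> norm (a (e, x, y) - (1 + (q + 1) * x + r * y)) \<le> C * ((norm x)\<^sup>2 + (norm y)\<^sup>2 + (norm e)\<^sup>2) \<and>
       norm (c (e, x)) \<le> \<rho> \<and> norm (\<beta> (e, x, y)) \<le> G \<and> norm (a (e, x, y)) \<le> G"
begin

section \<open>The basin and the asymptotic curve of the limit map\<close>

abbreviation "f \<equiv> F 0"
abbreviation "\<phi> \<equiv> \<Phi> 0"

lemma f_bij: "bij f" "continuous_on UNIV f" "continuous_on UNIV (inv f)"
  using diffeo[OF D(2)] unfolding polynomial_diffeo_def by (auto intro: polynomial_map_continuous)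

lemma f_inv: "f (inv f p) = p" "inv f (f p) = p"
  using f_bij(1) by (simp_all add: bij_is_surj surj_f_inv_f bij_is_inj)

lemma funpow_inv: "(f ^^ k) ((inv f ^^ k) p) = p"
proof (induction k)
  case (Suc k)
  have "(f ^^ Suc k) ((inv f ^^ Suc k) p) = (f ^^ k) (f (inv f ((inv f ^^ k) p)))"
    by (simp only: funpow_Suc_right[of k f] funpow.simps(2)[of k "inv f"] o_apply)
  then show ?case by (simp only: f_inv Suc)
qed simp

lemma \<phi>_lims:
  assumes "z \<longlonglongrightarrow> z\<^sub>0"
  shows "(\<lambda>n. fst (\<phi> (z n))) \<longlonglongrightarrow> 0" "(\<lambda>n. snd (\<phi> (z n))) \<longlonglongrightarrow> 0"
    "\<forall>\<^sub>F n in sequentially. z n \<in> K \<and> norm (fst (\<phi> (z n))) < \<delta> \<and> norm (snd (\<phi> (z n))) < \<delta>"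
proof -
  have "(\<lambda>n. \<phi> (z n)) \<longlonglongrightarrow> (0, 0)"
    using \<Phi>_tendsto[OF tendsto_const assms, of 0] D coords' by simp
  from tendsto_fst[OF this] tendsto_snd[OF this]
  show l: "(\<lambda>n. fst (\<phi> (z n))) \<longlonglongrightarrow> 0" "(\<lambda>n. snd (\<phi> (z n))) \<longlonglongrightarrow> 0" by simp_all
  have "\<forall>\<^sub>F n in sequentially. z n \<in> interior K" by (rule topological_tendstoD[OF assms open_interior K(3)])
  moreover have "\<forall>\<^sub>F n in sequentially. norm (fst (\<phi> (z n))) < \<delta>"
    using tendsto_norm[OF l(1)] csts(1) by (intro order_tendstoD(2)) auto
  moreover have "\<forall>\<^sub>F n in sequentially. norm (snd (\<phi> (z n))) < \<delta>"
    using tendsto_norm[OF l(2)] csts(1) by (intro order_tendstoD(2)) auto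
  ultimately show "\<forall>\<^sub>F n in sequentially. z n \<in> K \<and> norm (fst (\<phi> (z n))) < \<delta> \<and> norm (snd (\<phi> (z n))) < \<delta>"
    by eventually_elim (use interior_subset in auto)
qed

lemma track0:
  assumes "p \<in> K" "norm (fst (\<phi> p)) < \<delta>" "norm (snd (\<phi> p)) < \<delta>"
  shows "f p \<in> K" "fst (\<phi> (f p)) = fst (\<phi> p) + (fst (\<phi> p))\<^sup>2 * a (0, fst (\<phi> p), snd (\<phi> p))"
    "snd (\<phi> (f p)) = c (0, fst (\<phi> p)) * snd (\<phi> p) + (fst (\<phi> p))\<^sup>2 * \<beta> (0, fst (\<phi> p), snd (\<phi> p))"
  using track[OF assms(1) _ assms(2,3)] csts(1) by simp_all

lemma basin_tendsto: "(\<lambda>n. (f ^^ n) p) \<longlonglongrightarrow> z\<^sub>0" if "p \<in> parabolic_basin f z\<^sub>0"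
  using that unfolding parabolic_basin_def by (auto intro: tendsto_uniform_limitI)

text \<open>A point of the basin cannot reach the strong stable manifold \<open>x = 0\<close>: transversally to it
  the iterates have derivative \<open>1\<close>, which by Cauchy's inequality is impossible for functions that
  converge uniformly to \<open>0\<close>.\<close>

lemma basin_nonzero:
  assumes "p \<in> parabolic_basin f z\<^sub>0"
  shows "\<forall>\<^sub>F n in sequentially. fst (\<phi> ((f ^^ n) p)) \<noteq> 0"
proof -
  obtain V where V: "open V" "p \<in> V" "uniform_limit V (\<lambda>n. f ^^ n) (\<lambda>_. z\<^sub>0) sequentially"
    using assms unfolding parabolic_basin_def by blast
  have \<phi>_near: "\<exists>s>0. \<forall>p. dist p z\<^sub>0 < s \<longrightarrow> p \<in> K \<and> norm (fst (\<phi> p)) < h \<and> norm (snd (\<phi> p)) < h" if "0 < h" for h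
  proof -
    have "(\<phi> \<longlongrightarrow> \<phi> z\<^sub>0) (nhds z\<^sub>0)"
      using \<Phi>_tendsto[OF tendsto_const filterlim_ident D(2) coords'(2)] by simp
    then have t: "(\<phi> \<longlongrightarrow> (0, 0)) (nhds z\<^sub>0)" by (simp add: coords')
    have "\<forall>\<^sub>F p in nhds z\<^sub>0. norm (fst (\<phi> p)) < h" "\<forall>\<^sub>F p in nhds z\<^sub>0. norm (snd (\<phi> p)) < h"
      using tendsto_norm[OF tendsto_fst[OF t]] tendsto_norm[OF tendsto_snd[OF t]] that
      by (auto intro!: order_tendstoD(2))
    moreover have "\<forall>\<^sub>F p in nhds z\<^sub>0. p \<in> interior K" using K by (intro eventually_nhds_in_open) auto
    ultimately have "\<forall>\<^sub>F p in nhds z\<^sub>0. p \<in> K \<and> norm (fst (\<phi> p)) < h \<and> norm (snd (\<phi> p)) < h"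
      by eventually_elim (use interior_subset in auto)
    then show ?thesis unfolding eventually_nhds_metric by blast
  qed
  have unif: "\<exists>N. \<forall>n\<ge>N. \<forall>v\<in>V. (f ^^ n) v \<in> K \<and> norm (fst (\<phi> ((f ^^ n) v))) < h \<and> norm (snd (\<phi> ((f ^^ n) v))) < h"
    if h: "0 < h" for h
  proof -
    obtain s where s: "0 < s" "\<And>p. dist p z\<^sub>0 < s \<Longrightarrow> p \<in> K \<and> norm (fst (\<phi> p)) < h \<and> norm (snd (\<phi> p)) < h"
      using \<phi>_near[OF h] by blast
    have "\<forall>\<^sub>F n in sequentially. \<forall>v\<in>V. dist ((f ^^ n) v) z\<^sub>0 < s"
      using uniform_limitD[OF V(3) s(1)] .
    then show ?thesis unfolding eventually_sequentially using s(2) by blast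
  qed
  obtain N where N: "\<And>n v. N \<le> n \<Longrightarrow> v \<in> V \<Longrightarrow>
      (f ^^ n) v \<in> K \<and> norm (fst (\<phi> ((f ^^ n) v))) < \<delta> \<and> norm (snd (\<phi> ((f ^^ n) v))) < \<delta>"
    using unif[OF csts(1)] by blast
  have "fst (\<phi> ((f ^^ n) p)) \<noteq> 0" if n: "N \<le> n" for n
  proof
    assume zero: "fst (\<phi> ((f ^^ n) p)) = 0"
    define P where "P = (f ^^ n) p"
    define y1 where "y1 = snd (\<phi> P)"
    have P: "P \<in> U" "\<phi> P = (0, y1)" using N[OF n V(2)] K(2) zero by (auto simp: P_def y1_def prod_eq_iff)
    \<comment> \<open>Every point of W is the n-th iterate of a point of V, so the uniform estimates
      on V hold along its whole forward orbit.\<close>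
    define W where "W = (inv f ^^ n) -` V"
    have W: "open W" unfolding W_def by (intro open_vimage V(1) continuous_on_funpow f_bij(3))
    have inv_n: "(inv f ^^ n) ((f ^^ n) v) = v" "(f ^^ n) ((inv f ^^ n) v) = v" for v
      using inv_fn[OF f_bij(1), of n] bij_fn[OF f_bij(1), of n]
      by (metis bij_inv_eq_iff)+
    have PW: "P \<in> W" unfolding W_def P_def using V(2) inv_n by simp
    \<comment> \<open>The horizontal line through P in the chart, transversal to x = 0.\<close>
    define h where "h \<zeta> = inv_into U \<phi> (\<zeta>, y1)" for \<zeta>
    have h0: "h 0 = P" unfolding h_def P(2)[symmetric] by (rule inv_into_f_f[OF coords'(5) P(1)])
    have im0: "(0, y1) \<in> \<phi> ` U" using P by (metis image_eqI)
    have hd: "(\<lambda>\<zeta>. fst (h \<zeta>)) field_differentiable (at \<zeta>) \<and> (\<lambda>\<zeta>. snd (h \<zeta>)) field_differentiable (at \<zeta>)"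
      if "(\<zeta>, y1) \<in> \<phi> ` U" for \<zeta>
    proof -
      have "holo2_on (fst \<circ> inv_into U \<phi>) (\<phi> ` U)" "holo2_on (snd \<circ> inv_into U \<phi>) (\<phi> ` U)"
        using coords'(7) unfolding holo2_map_on_def by auto
      from this[THEN holo2_on_chain, OF that DERIV_ident DERIV_const] show ?thesis
        unfolding h_def by simp
    qed
    have hcont: "isCont h 0"
    proof -
      have "isCont (\<lambda>\<zeta>. (fst (h \<zeta>), snd (h \<zeta>))) 0"
        using hd[OF im0] by (intro continuous_Pair field_differentiable_imp_continuous_at) auto
      then show ?thesis by simp
    qed
    have "\<forall>\<^sub>F \<zeta> in nhds 0. h \<zeta> \<in> W"
      using hcont tendsto_at_iff_tendsto_nhds[of h 0] PW h0
      by (intro topological_tendstoD[OF _ W]) (auto simp: isCont_def)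
    moreover have "\<forall>\<^sub>F \<zeta> in nhds 0. (\<zeta>, y1) \<in> \<phi> ` U"
    proof -
      have "((\<lambda>\<zeta>. (\<zeta>, y1)) \<longlongrightarrow> (0, y1)) (nhds 0)" by (intro tendsto_Pair tendsto_const filterlim_ident)
      from topological_tendstoD[OF this coords'(6) im0] show ?thesis .
    qed
    ultimately have "\<forall>\<^sub>F \<zeta> in nhds 0. h \<zeta> \<in> W \<and> (\<zeta>, y1) \<in> \<phi> ` U" by eventually_elim auto
    then obtain d where d: "0 < d" "\<And>\<zeta>. dist \<zeta> 0 < d \<Longrightarrow> h \<zeta> \<in> W \<and> (\<zeta>, y1) \<in> \<phi> ` U"
      unfolding eventually_nhds_metric by blast
    define B where "B = ball (0 :: complex) d"
    have B: "open B" "0 \<in> B" "\<And>\<zeta>. \<zeta> \<in> B \<Longrightarrow> h \<zeta> \<in> W" "\<And>\<zeta>. \<zeta> \<in> B \<Longrightarrow> (\<zeta>, y1) \<in> \<phi> ` U"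
      unfolding B_def using d by (auto simp: dist_commute)
    define \<Gamma> where "\<Gamma> m \<zeta> = \<phi> ((f ^^ m) (h \<zeta>))" for m \<zeta>
    have orbit: "\<exists>v\<in>V. (f ^^ m) (h \<zeta>) = (f ^^ (m + n)) v" if "\<zeta> \<in> B" for m \<zeta>
    proof (rule bexI)
      show "(inv f ^^ n) (h \<zeta>) \<in> V" using B(3)[OF that] by (simp add: W_def)
      show "(f ^^ m) (h \<zeta>) = (f ^^ (m + n)) ((inv f ^^ n) (h \<zeta>))" by (simp add: funpow_add inv_n)
    qed
    have in_K: "(f ^^ m) (h \<zeta>) \<in> K \<and> norm (fst (\<Gamma> m \<zeta>)) < \<delta> \<and> norm (snd (\<Gamma> m \<zeta>)) < \<delta>" if "\<zeta> \<in> B" for m \<zeta>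
      using orbit[OF that, of m] N[of "m + n"] n unfolding \<Gamma>_def by auto
    have curve: "holo_curve B (\<lambda>\<zeta>. (f ^^ m) (h \<zeta>))" for m
    proof (induction m)
      case 0
      then show ?case using hd B(4) by (simp add: holo_curve_def)
    next
      case (Suc m)
      from holo_curve_family[OF F_holo D(2) this] show ?case by simp
    qed
    have \<Gamma>_curve: "holo_curve B (\<Gamma> m)" for m
    proof -
      have "(\<lambda>\<zeta>. (f ^^ m) (h \<zeta>)) ` B \<subseteq> U" using in_K K(2) by auto
      from holo_curve_family[OF coords'(4) D(2) curve this] show ?thesis unfolding \<Gamma>_def .
    qed
    have \<Gamma>0: "\<Gamma> 0 \<zeta> = (\<zeta>, y1)" if "\<zeta> \<in> B" for \<zeta>
      unfolding \<Gamma>_def h_def using B(4)[OF that] by (simp add: f_inv_into_f)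
    have \<Gamma>Suc: "fst (\<Gamma> (Suc m) \<zeta>) = fst (\<Gamma> m \<zeta>) + (fst (\<Gamma> m \<zeta>))\<^sup>2 * a (0, fst (\<Gamma> m \<zeta>), snd (\<Gamma> m \<zeta>))"
      if "\<zeta> \<in> B" for m \<zeta>
      using track0(2)[of "(f ^^ m) (h \<zeta>)"] in_K[OF that, of m] unfolding \<Gamma>_def by simp
    have \<Gamma>_zero: "fst (\<Gamma> m 0) = 0" for m
      by (induction m) (use \<Gamma>0[OF B(2)] \<Gamma>Suc[OF B(2)] in auto)
    \<comment> \<open>At \<zeta> = 0 the first coordinate remains 0, so the term with its square
      adds nothing to the derivative.\<close>
    have deriv1: "((\<lambda>\<zeta>. fst (\<Gamma> m \<zeta>)) has_field_derivative 1) (at 0)" for m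
    proof (induction m)
      case 0
      show ?case
        by (rule has_field_derivative_transform_within_open[OF DERIV_ident B(1,2)]) (simp add: \<Gamma>0)
    next
      case (Suc m)
      obtain k' where k': "((\<lambda>\<zeta>. snd (\<Gamma> m \<zeta>)) has_field_derivative k') (at 0)"
        using \<Gamma>_curve[of m] B(2) unfolding holo_curve_def field_differentiable_def by blast
      have "(0, fst (\<Gamma> m 0), snd (\<Gamma> m 0)) \<in> (SIGMA \<epsilon>:D. \<Phi> \<epsilon> ` U)"
        using D(2) in_K[OF B(2), of m] K(2) by (auto simp: \<Gamma>_def)
      from holo3_on_chain[of a _ "\<lambda>_. 0" 0, OF a_holo this DERIV_const Suc k']
      obtain A' where A': "((\<lambda>\<zeta>. a (0, fst (\<Gamma> m \<zeta>), snd (\<Gamma> m \<zeta>))) has_field_derivative A') (at 0)"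
        unfolding field_differentiable_def by blast
      have "((\<lambda>\<zeta>. fst (\<Gamma> m \<zeta>) + (fst (\<Gamma> m \<zeta>))\<^sup>2 * a (0, fst (\<Gamma> m \<zeta>), snd (\<Gamma> m \<zeta>))) has_field_derivative 1) (at 0)"
        by (rule derivative_eq_intros Suc A' refl)+ (simp add: \<Gamma>_zero)
      then show ?case
        by (rule has_field_derivative_transform_within_open[OF _ B(1,2)]) (simp add: \<Gamma>Suc)
    qed
    \<comment> \<open>A bound d/8 on a disc of radius d/2 forces a derivative of modulus at most
      1/4, against the value 1.\<close>
    obtain M where M: "\<And>m v. M \<le> m \<Longrightarrow> v \<in> V \<Longrightarrow> norm (fst (\<phi> ((f ^^ m) v))) < d / 8"
      using unif[of "d / 8"] d(1) by auto
    have small: "norm (fst (\<Gamma> M \<zeta>)) \<le> d / 8" if "\<zeta> \<in> B" for \<zeta>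
      using orbit[OF that, of M] M[of "M + n"] unfolding \<Gamma>_def by (auto intro: less_imp_le)
    have hol: "(\<lambda>\<zeta>. fst (\<Gamma> M \<zeta>)) holomorphic_on B"
      using \<Gamma>_curve[of M] unfolding holo_curve_def holomorphic_on_def
      by (auto intro: field_differentiable_at_within)
    have sub: "cball 0 (d / 2) \<subseteq> B" unfolding B_def using d(1) by auto
    have "norm ((deriv ^^ 1) (\<lambda>\<zeta>. fst (\<Gamma> M \<zeta>)) 0) \<le> fact 1 * (d / 8) / (d / 2) ^ 1"
    proof (rule Cauchy_inequality)
      show "(\<lambda>\<zeta>. fst (\<Gamma> M \<zeta>)) holomorphic_on ball 0 (d / 2)"
        by (rule holomorphic_on_subset[OF hol]) (use sub in auto)
      show "continuous_on (cball 0 (d / 2)) (\<lambda>\<zeta>. fst (\<Gamma> M \<zeta>))"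
        by (rule continuous_on_subset[OF holomorphic_on_imp_continuous_on[OF hol] sub])
      fix w :: complex assume "norm (0 - w) = d / 2"
      then have "w \<in> cball 0 (d / 2)" by simp
      then show "norm (fst (\<Gamma> M w)) \<le> d / 8" using sub by (intro small) auto
    qed (use d(1) in auto)
    then show False using DERIV_imp_deriv[OF deriv1[of M]] d(1) by simp
  qed
  then show ?thesis unfolding eventually_sequentially by blast
qed

lemma basin_incoming:
  assumes "p \<in> parabolic_basin f z\<^sub>0"
  obtains Cy where "0 \<le> Cy" "\<forall>\<^sub>F n in sequentially. norm (snd (\<phi> ((f ^^ n) p))) \<le> Cy / (real n)\<^sup>2"
    "convergent (\<lambda>n. w_in q (\<phi> ((f ^^ n) p)) - of_nat n)"
    "(\<lambda>n. - 1 / fst (\<phi> ((f ^^ n) p)) / of_nat n) \<longlonglongrightarrow> 1"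
    "\<forall>\<^sub>F n in sequentially. 0 < Re (- fst (\<phi> ((f ^^ n) p)))"
proof -
  note L = \<phi>_lims[OF basin_tendsto[OF assms]]
  have "\<forall>\<^sub>F n in sequentially. fst (\<phi> ((f ^^ n) p)) \<noteq> 0 \<and> (\<exists>a b g.
      fst (\<phi> ((f ^^ Suc n) p)) = fst (\<phi> ((f ^^ n) p)) + (fst (\<phi> ((f ^^ n) p)))\<^sup>2 * a \<and>
      snd (\<phi> ((f ^^ Suc n) p)) = b * snd (\<phi> ((f ^^ n) p)) + (fst (\<phi> ((f ^^ n) p)))\<^sup>2 * g \<and>
      norm (a - (1 + (q + 1) * fst (\<phi> ((f ^^ n) p)) + r * snd (\<phi> ((f ^^ n) p))))
        \<le> C * ((norm (fst (\<phi> ((f ^^ n) p))))\<^sup>2 + (norm (snd (\<phi> ((f ^^ n) p))))\<^sup>2) \<and> norm b \<le> \<rho> \<and> norm g \<le> G)"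
    using basin_nonzero[OF assms] L(3)
  proof eventually_elim
    case (elim n)
    let ?z = "(f ^^ n) p"
    show ?case
      using elim track0[of ?z] bounds[of 0 "fst (\<phi> ?z)" "snd (\<phi> ?z)"] csts(1)
      by (intro conjI exI[of _ "a (0, fst (\<phi> ?z), snd (\<phi> ?z))"] exI[of _ "c (0, fst (\<phi> ?z))"]
          exI[of _ "\<beta> (0, fst (\<phi> ?z), snd (\<phi> ?z))"]) auto
  qed
  then show thesis
    by (rule incoming_orbit[OF csts(2,3,4,5) L(1,2)]) (rule that, simp_all)
qed

text \<open>One variable is changed at a time, by way of the point (x', y), so that the one-variable
  bound applies.\<close>

lemma lipschitz_at_0:
  obtains L \<delta>' where "0 \<le> L" "0 < \<delta>'" "\<delta>' \<le> \<delta>"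
    "\<And>x y x' y'. norm x < \<delta>' \<Longrightarrow> norm y < \<delta>' \<Longrightarrow> norm x' < \<delta>' \<Longrightarrow> norm y' < \<delta>' \<Longrightarrow>
       norm (a (0, x, y) - a (0, x', y')) \<le> L * (norm (x - x') + norm (y - y')) \<and>
       norm (\<beta> (0, x, y) - \<beta> (0, x', y')) \<le> L * (norm (x - x') + norm (y - y')) \<and>
       norm (c (0, x) - c (0, x')) \<le> L * norm (x - x')"
proof -
  have "\<forall>\<^sub>F z in nhds (0, 0). z \<in> \<phi> ` U" using coords'(6) zero_in_image by (rule eventually_nhds_in_open)
  then obtain d where d: "0 < d" "\<And>z. dist z (0, 0) < d \<Longrightarrow> z \<in> \<phi> ` U"
    unfolding eventually_nhds_metric by blast
  define R where "R = min \<delta> (d / 2)"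
  have R: "0 < R" "R \<le> \<delta>" unfolding R_def using csts d by auto
  have im: "(x, y) \<in> \<phi> ` U" if "norm x < R" "norm y < R" for x y
    using that norm_Pair_le[of x y] d(2)[of "(x, y)"] unfolding R_def by (simp add: dist_norm)
  define M where "M = max G \<rho>"
  have bd: "norm (a (0, x, y)) \<le> M" "norm (\<beta> (0, x, y)) \<le> M" "norm (c (0, x)) \<le> M"
    if "norm x < R" "norm y < R" for x y
    using bounds[of 0 x y] csts(1) that R(2) unfolding M_def by auto
  have two: "norm (g (0, x, y) - g (0, x', y')) \<le> 4 * M / R * (norm (x - x') + norm (y - y'))"
    if g: "holo3_on g (SIGMA \<epsilon>:D. \<Phi> \<epsilon> ` U)" "\<And>x y. norm x < R \<Longrightarrow> norm y < R \<Longrightarrow> norm (g (0, x, y)) \<le> M"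
      and s: "norm x < R / 2" "norm y < R / 2" "norm x' < R / 2" "norm y' < R / 2" for g x y x' y'
  proof -
    have mem: "(0, x, y) \<in> (SIGMA \<epsilon>:D. \<Phi> \<epsilon> ` U)" if "norm x < R" "norm y < R" for x y
      using im[OF that] D by auto
    have lt: "norm x < R" "norm y < R" "norm x' < R" "norm y' < R" using s R(1) by linarith+
    have h1: "(\<lambda>x. g (0, x, y)) holomorphic_on ball 0 R"
      unfolding holomorphic_on_def
    proof
      fix t :: complex assume "t \<in> ball 0 R"
      then have "(0, t, y) \<in> (SIGMA \<epsilon>:D. \<Phi> \<epsilon> ` U)" using lt by (intro mem) auto
      from holo3_on_chain[of g _ "\<lambda>_. 0" t "\<lambda>t. t" "\<lambda>_. y", OF g(1) this DERIV_const DERIV_ident DERIV_const]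
      show "(\<lambda>x. g (0, x, y)) field_differentiable at t within ball 0 R"
        by (rule field_differentiable_at_within)
    qed
    have h2: "(\<lambda>y. g (0, x', y)) holomorphic_on ball 0 R"
      unfolding holomorphic_on_def
    proof
      fix t :: complex assume "t \<in> ball 0 R"
      then have "(0, x', t) \<in> (SIGMA \<epsilon>:D. \<Phi> \<epsilon> ` U)" using lt by (intro mem) auto
      from holo3_on_chain[of g _ "\<lambda>_. 0" t "\<lambda>_. x'" "\<lambda>t. t", OF g(1) this DERIV_const DERIV_const DERIV_ident]
      show "(\<lambda>y. g (0, x', y)) field_differentiable at t within ball 0 R"
        by (rule field_differentiable_at_within)
    qed
    have "norm (g (0, x, y) - g (0, x', y)) \<le> 4 * M / R * norm (x - x')"
      by (rule bounded_holomorphic_lipschitz[OF R(1) h1 _ s(1,3)]) (use g(2) lt in auto)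
    moreover have "norm (g (0, x', y) - g (0, x', y')) \<le> 4 * M / R * norm (y - y')"
      by (rule bounded_holomorphic_lipschitz[OF R(1) h2 _ s(2,4)]) (use g(2) lt in auto)
    ultimately show ?thesis
      using norm_triangle_ineq[of "g (0, x, y) - g (0, x', y)" "g (0, x', y) - g (0, x', y')"]
      by (simp add: distrib_left)
  qed
  show thesis
  proof (rule that[of "4 * M / R" "R / 2"])
    show "0 \<le> 4 * M / R" "0 < R / 2" "R / 2 \<le> \<delta>" using R csts unfolding M_def by (auto simp: le_max_iff_disj)
    fix x y x' y' :: complex
    assume s: "norm x < R / 2" "norm y < R / 2" "norm x' < R / 2" "norm y' < R / 2"
    have "(\<lambda>x. c (0, x)) holomorphic_on ball 0 R"
      unfolding holomorphic_on_def
    proof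
      fix t :: complex assume "t \<in> ball 0 R"
      then have "(t, 0) \<in> \<phi> ` U" using R(1) by (intro im) auto
      then have "(0, t) \<in> (SIGMA \<epsilon>:D. fst ` \<Phi> \<epsilon> ` U)" using D imageI[of "(t, 0)" "\<phi> ` U" fst] by simp
      from holo2_on_chain[of c _ "\<lambda>_. 0" t "\<lambda>t. t", OF c_holo this DERIV_const DERIV_ident]
      show "(\<lambda>x. c (0, x)) field_differentiable at t within ball 0 R"
        by (rule field_differentiable_at_within)
    qed
    then have "norm (c (0, x) - c (0, x')) \<le> 4 * M / R * norm (x - x')"
      by (rule bounded_holomorphic_lipschitz[OF R(1) _ _ s(1,3)]) (use bd(3)[of _ 0] R(1) in auto)
    then show "norm (a (0, x, y) - a (0, x', y')) \<le> 4 * M / R * (norm (x - x') + norm (y - y')) \<and>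
       norm (\<beta> (0, x, y) - \<beta> (0, x', y')) \<le> 4 * M / R * (norm (x - x') + norm (y - y')) \<and>
       norm (c (0, x) - c (0, x')) \<le> 4 * M / R * norm (x - x')"
      using two[OF a_holo bd(1) s] two[OF \<beta>_holo bd(2) s] by blast
  qed
qed

text \<open>The coordinate x is not 0 along the late backward orbit. Otherwise it is 0 at all
  further preimages too, as 1 + xa does not vanish. There the map contracts y, so a bounded backward
  orbit has y = 0; this puts it at the fixed point, and Q with it.\<close>

lemma asymptotic_dynamics:
  assumes "Q \<in> asymptotic_curve f z\<^sub>0"
  defines "x \<equiv> \<lambda>n. fst (\<phi> ((inv f ^^ n) Q))" and "y \<equiv> \<lambda>n. snd (\<phi> ((inv f ^^ n) Q))"
  shows "x \<longlonglongrightarrow> 0" "y \<longlonglongrightarrow> 0"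
    "\<forall>\<^sub>F n in sequentially. x n \<noteq> 0 \<and> x n = x (Suc n) + (x (Suc n))\<^sup>2 * a (0, x (Suc n), y (Suc n)) \<and>
       y n = c (0, x (Suc n)) * y (Suc n) + (x (Suc n))\<^sup>2 * \<beta> (0, x (Suc n), y (Suc n))"
    "\<forall>\<^sub>F n in sequentially. (inv f ^^ n) Q \<in> K \<and> norm (x n) < \<delta> \<and> norm (y n) < \<delta>"
proof -
  have lim: "(\<lambda>n. (inv f ^^ n) Q) \<longlonglongrightarrow> z\<^sub>0" and ne: "Q \<noteq> z\<^sub>0"
    using assms(1) unfolding asymptotic_curve_def by auto
  note L = \<phi>_lims[OF lim]
  show xl: "x \<longlonglongrightarrow> 0" and "y \<longlonglongrightarrow> 0"
    and ev: "\<forall>\<^sub>F n in sequentially. (inv f ^^ n) Q \<in> K \<and> norm (x n) < \<delta> \<and> norm (y n) < \<delta>"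
    using L unfolding x_def y_def by auto
  \<comment> \<open>Makes |xa| < 1, so that 1 + xa is not 0.\<close>
  have "(\<lambda>n. norm (x n) * G) \<longlonglongrightarrow> norm (0 :: complex) * G" by (intro tendsto_intros xl)
  then have "\<forall>\<^sub>F n in sequentially. norm (x n) * G < 1" by (rule order_tendstoD(2)) simp
  with ev have "\<forall>\<^sub>F n in sequentially. 0 < n \<and> norm (x n) * G < 1 \<and> (inv f ^^ n) Q \<in> K \<and> norm (x n) < \<delta> \<and> norm (y n) < \<delta>"
    using eventually_gt_at_top[of "0::nat"] by eventually_elim auto
  then obtain N where N: "\<And>n. N \<le> n \<Longrightarrow> 0 < n \<and> norm (x n) * G < 1 \<and> (inv f ^^ n) Q \<in> K \<and> norm (x n) < \<delta> \<and> norm (y n) < \<delta>"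
    unfolding eventually_sequentially by blast
  have dyn: "x n = x (Suc n) + (x (Suc n))\<^sup>2 * a (0, x (Suc n), y (Suc n))"
      "y n = c (0, x (Suc n)) * y (Suc n) + (x (Suc n))\<^sup>2 * \<beta> (0, x (Suc n), y (Suc n))" if "N \<le> n" for n
    using track0(2,3)[of "(inv f ^^ Suc n) Q"] N[of "Suc n"] that unfolding x_def y_def by (auto simp: f_inv)
  have nz: "x n \<noteq> 0" if n: "N \<le> n" for n
  proof
    assume x0: "x n = 0"
    have xz: "x m = 0" if "n \<le> m" for m
      using that
    proof (induction m rule: nat_induct_at_least)
      case base
      then show ?case by (rule x0)
    next
      case (Suc m)
      then have m: "N \<le> m" using n by simp
      have "norm (x (Suc m) * a (0, x (Suc m), y (Suc m))) \<le> norm (x (Suc m)) * G"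
        unfolding norm_mult using bounds[of 0 "x (Suc m)" "y (Suc m)"] N[of "Suc m"] m csts(1)
        by (intro mult_left_mono) auto
      also have "\<dots> < 1" using N[of "Suc m"] m by simp
      finally have "1 + x (Suc m) * a (0, x (Suc m), y (Suc m)) \<noteq> 0"
        using norm_diff_ineq[of 1 "x (Suc m) * a (0, x (Suc m), y (Suc m))"] by auto
      moreover have "0 = x (Suc m) * (1 + x (Suc m) * a (0, x (Suc m), y (Suc m)))"
        using dyn(1)[OF m] Suc.IH by (simp add: algebra_simps power2_eq_square)
      ultimately show ?case by (metis mult_eq_0_iff)
    qed
    have "norm (y n) \<le> 0 / (1 - \<rho>) / (real n)\<^sup>2"
    proof (rule backward_decay[where N = n and B = \<delta> and u = "\<lambda>n. norm (y n)"])
      fix m assume m: "n \<le> m"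
      then have Nm: "N \<le> m" using n by simp
      have "y m = c (0, x (Suc m)) * y (Suc m)" using dyn(2)[OF Nm] xz[of "Suc m"] m by simp
      then have "norm (y m) = norm (c (0, x (Suc m))) * norm (y (Suc m))" by (simp add: norm_mult)
      also have "\<dots> \<le> \<rho> * norm (y (Suc m))"
        using bounds[of 0 "x (Suc m)" "y (Suc m)"] N[of "Suc m"] Nm csts(1) by (intro mult_right_mono) auto
      finally show "norm (y m) \<le> \<rho> * norm (y (Suc m)) + 0 / (real m)\<^sup>2" by simp
      show "norm (y m) \<le> \<delta>" using N[OF Nm] by simp
    qed (use csts N[OF n] in auto)
    then have "y n = 0" by simp
    with x0 have "\<phi> ((inv f ^^ n) Q) = \<phi> z\<^sub>0" unfolding x_def y_def coords'(3) by (simp add: prod_eq_iff)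
    then have Qn: "(inv f ^^ n) Q = z\<^sub>0"
      using inj_onD[OF coords'(5)] N[OF n] K(2) coords'(2) by blast
    have "(f ^^ k) z\<^sub>0 = z\<^sub>0" for k by (induction k) (simp_all add: fixpoint)
    then show False using Qn ne funpow_inv[of n Q] by simp
  qed
  show "\<forall>\<^sub>F n in sequentially. x n \<noteq> 0 \<and> x n = x (Suc n) + (x (Suc n))\<^sup>2 * a (0, x (Suc n), y (Suc n)) \<and>
       y n = c (0, x (Suc n)) * y (Suc n) + (x (Suc n))\<^sup>2 * \<beta> (0, x (Suc n), y (Suc n))"
    unfolding eventually_sequentially using dyn nz by blast
qed

lemma asymptotic_convergent:
  assumes "Q \<in> asymptotic_curve f z\<^sub>0"
  shows "convergent (\<lambda>n. w_out q (\<phi> ((inv f ^^ n) Q)) + of_nat n)"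
proof -
  define x where "x = (\<lambda>n. fst (\<phi> ((inv f ^^ n) Q)))"
  define y where "y = (\<lambda>n. snd (\<phi> ((inv f ^^ n) Q)))"
  have A: "x \<longlonglongrightarrow> 0" "y \<longlonglongrightarrow> 0"
    "\<forall>\<^sub>F n in sequentially. x n \<noteq> 0 \<and> x n = x (Suc n) + (x (Suc n))\<^sup>2 * a (0, x (Suc n), y (Suc n)) \<and>
       y n = c (0, x (Suc n)) * y (Suc n) + (x (Suc n))\<^sup>2 * \<beta> (0, x (Suc n), y (Suc n))"
    "\<forall>\<^sub>F n in sequentially. (inv f ^^ n) Q \<in> K \<and> norm (x n) < \<delta> \<and> norm (y n) < \<delta>"
    unfolding x_def y_def by (rule asymptotic_dynamics[OF assms])+
  have "\<forall>\<^sub>F n in sequentially. x (Suc n) \<noteq> 0"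
    using A(3) by (subst eventually_sequentially_Suc) (auto elim: eventually_mono)
  moreover have "\<forall>\<^sub>F n in sequentially. norm (x (Suc n)) < \<delta> \<and> norm (y (Suc n)) < \<delta>"
    using A(4) by (subst eventually_sequentially_Suc[of "\<lambda>n. norm (x n) < \<delta> \<and> norm (y n) < \<delta>"]) (auto elim: eventually_mono)
  ultimately have "\<forall>\<^sub>F n in sequentially. x (Suc n) \<noteq> 0 \<and> (\<exists>a b g. x n = x (Suc n) + (x (Suc n))\<^sup>2 * a \<and>
       y n = b * y (Suc n) + (x (Suc n))\<^sup>2 * g \<and>
       norm (a - (1 + (q + 1) * x (Suc n) + r * y (Suc n))) \<le> C * ((norm (x (Suc n)))\<^sup>2 + (norm (y (Suc n)))\<^sup>2) \<and>
       norm b \<le> \<rho> \<and> norm g \<le> G)"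
    using A(3)
  proof eventually_elim
    case (elim n)
    then show ?case using bounds[of 0 "x (Suc n)" "y (Suc n)"] csts(1)
      by (intro conjI exI[of _ "a (0, x (Suc n), y (Suc n))"] exI[of _ "c (0, x (Suc n))"]
          exI[of _ "\<beta> (0, x (Suc n), y (Suc n))"]) simp_all
  qed
  from outgoing_orbit(1)[OF csts(2,3,4,5) A(1,2) this] show ?thesis unfolding x_def y_def by simp
qed

text \<open>By \<open>outgoing_unique\<close> the two backward orbits agree from some time n on;
  applying f another n times returns to Q and Q'.\<close>

lemma fatou_out_inj: "inj_on (fatou_out f \<phi> q) (asymptotic_curve f z\<^sub>0)"
proof (rule inj_onI)
  fix Q Q' assume Q: "Q \<in> asymptotic_curve f z\<^sub>0" and Q': "Q' \<in> asymptotic_curve f z\<^sub>0"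
    and eq: "fatou_out f \<phi> q Q = fatou_out f \<phi> q Q'"
  obtain L \<delta>' where L: "0 \<le> L" "0 < \<delta>'" "\<delta>' \<le> \<delta>"
    "\<And>x y x' y'. norm x < \<delta>' \<Longrightarrow> norm y < \<delta>' \<Longrightarrow> norm x' < \<delta>' \<Longrightarrow> norm y' < \<delta>' \<Longrightarrow>
       norm (a (0, x, y) - a (0, x', y')) \<le> L * (norm (x - x') + norm (y - y')) \<and>
       norm (\<beta> (0, x, y) - \<beta> (0, x', y')) \<le> L * (norm (x - x') + norm (y - y')) \<and>
       norm (c (0, x) - c (0, x')) \<le> L * norm (x - x')"
    by (rule lipschitz_at_0) (rule that)
  have lims: "(\<lambda>n. w_out q (\<phi> ((inv f ^^ n) Q)) + of_nat n) \<longlonglongrightarrow> fatou_out f \<phi> q Q"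
    if "Q \<in> asymptotic_curve f z\<^sub>0" for Q
    using asymptotic_convergent[OF that] unfolding fatou_out_def by (simp add: convergent_LIMSEQ_iff)
  note A = asymptotic_dynamics[OF Q] and A' = asymptotic_dynamics[OF Q']
  have "(\<lambda>n. (w_out q (\<phi> ((inv f ^^ n) Q)) + of_nat n) - (w_out q (\<phi> ((inv f ^^ n) Q')) + of_nat n)) \<longlonglongrightarrow> 0"
    using tendsto_diff[OF lims[OF Q] lims[OF Q']] eq by simp
  then have same: "(\<lambda>n. w_out q (fst (\<phi> ((inv f ^^ n) Q)), snd (\<phi> ((inv f ^^ n) Q)))
      - w_out q (fst (\<phi> ((inv f ^^ n) Q')), snd (\<phi> ((inv f ^^ n) Q')))) \<longlonglongrightarrow> 0" by simp
  have bd: "norm (a (0, x, y) - (1 + (q + 1) * x + r * y)) \<le> C * ((norm x)\<^sup>2 + (norm y)\<^sup>2) \<and>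
      norm (c (0, x)) \<le> \<rho> \<and> norm (\<beta> (0, x, y)) \<le> G" if "norm x < \<delta>'" "norm y < \<delta>'" for x y
    using bounds[of 0 x y] csts(1) that L(3) by simp
  have "\<forall>\<^sub>F n in sequentially. fst (\<phi> ((inv f ^^ n) Q)) = fst (\<phi> ((inv f ^^ n) Q')) \<and>
      snd (\<phi> ((inv f ^^ n) Q)) = snd (\<phi> ((inv f ^^ n) Q'))"
    by (rule outgoing_unique[where a = "\<lambda>x y. a (0, x, y)" and g = "\<lambda>x y. \<beta> (0, x, y)" and c = "\<lambda>x. c (0, x)",
        OF csts(2,3,4,5) L(1,2) bd L(4) A(1,2) A'(1,2) A(3) A'(3) same])
  with A(4) A'(4) have "\<forall>\<^sub>F n in sequentially. (inv f ^^ n) Q = (inv f ^^ n) Q'"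
  proof eventually_elim
    case (elim n)
    then have "\<phi> ((inv f ^^ n) Q) = \<phi> ((inv f ^^ n) Q')" by (simp add: prod_eq_iff)
    then show ?case using inj_onD[OF coords'(5)] elim K(2) by blast
  qed
  then obtain n where "(inv f ^^ n) Q = (inv f ^^ n) Q'"
    using eventually_happens'[OF sequentially_bot] by blast
  then have "(f ^^ n) ((inv f ^^ n) Q) = (f ^^ n) ((inv f ^^ n) Q')" by (rule arg_cong)
  then show "Q = Q'" unfolding funpow_inv .
qed

end


section \<open>Parabolic implosion\<close>

lemma norm_sin_minus_self: "norm (sin z - z) \<le> norm z ^ 3 * exp (norm z)" for z :: complex
proof -
  have "norm ((sin z - z) - (sin 0 - 0)) \<le> ((norm z)\<^sup>2 * exp (norm z)) * norm (z - 0)"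
  proof (rule field_differentiable_bound[where S = "cball 0 (norm z)" and f' = "\<lambda>w. cos w - 1"])
    fix w :: complex assume "w \<in> cball 0 (norm z)"
    then have "(norm w)\<^sup>2 * exp (norm w) \<le> (norm z)\<^sup>2 * exp (norm z)" by (intro mult_mono power_mono) auto
    then show "norm (cos w - 1) \<le> (norm z)\<^sup>2 * exp (norm z)" using norm_cos_minus_1_bound[of w] by linarith
  qed (auto intro!: derivative_eq_intros)
  then show ?thesis by (simp add: power3_eq_cube power2_eq_square mult_ac)
qed

lemma sin_over_tendsto:
  fixes e s :: "nat \<Rightarrow> complex"
  assumes "e \<longlonglongrightarrow> 0" "\<And>i. e i \<noteq> 0" "s \<longlonglongrightarrow> S"
  shows "(\<lambda>i. sin (e i * s i) / e i) \<longlonglongrightarrow> S"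
proof -
  have "(\<lambda>i. sin (e i * s i) / e i - s i) \<longlonglongrightarrow> 0"
  proof (rule Lim_null_comparison)
    show "\<forall>\<^sub>F i in sequentially. norm (sin (e i * s i) / e i - s i)
        \<le> (norm (e i))\<^sup>2 * norm (s i) ^ 3 * exp (norm (e i * s i))"
    proof (intro always_eventually allI)
      fix i
      have "sin (e i * s i) / e i - s i = (sin (e i * s i) - e i * s i) / e i"
        using assms(2)[of i] by (simp add: field_simps)
      then have "norm (sin (e i * s i) / e i - s i) = norm (sin (e i * s i) - e i * s i) / norm (e i)"
        by (simp add: norm_divide)
      also have "\<dots> \<le> norm (e i * s i) ^ 3 * exp (norm (e i * s i)) / norm (e i)"
        by (intro divide_right_mono norm_sin_minus_self) auto
      also have "\<dots> = (norm (e i))\<^sup>2 * norm (s i) ^ 3 * exp (norm (e i * s i))"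
        using assms(2)[of i] by (simp add: norm_mult power3_eq_cube power2_eq_square)
      finally show "norm (sin (e i * s i) / e i - s i) \<le> (norm (e i))\<^sup>2 * norm (s i) ^ 3 * exp (norm (e i * s i))" .
    qed
    have "(\<lambda>i. (norm (e i))\<^sup>2 * norm (s i) ^ 3 * exp (norm (e i * s i))) \<longlonglongrightarrow>
        (norm (0 :: complex))\<^sup>2 * norm S ^ 3 * exp (norm (0 * S))"
      by (intro tendsto_intros assms)
    then show "(\<lambda>i. (norm (e i))\<^sup>2 * norm (s i) ^ 3 * exp (norm (e i * s i))) \<longlonglongrightarrow> 0" by simp
  qed
  from tendsto_add[OF this assms(3)] show ?thesis by simp
qed

lemma Arctan_over_tendsto:
  fixes e w :: "nat \<Rightarrow> complex"
  assumes "e \<longlonglongrightarrow> 0" "\<And>i. e i \<noteq> 0" "w \<longlonglongrightarrow> S"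
  shows "(\<lambda>i. Arctan (e i * w i) / e i) \<longlonglongrightarrow> S"
proof -
  have "(\<lambda>i. norm (e i * w i)) \<longlonglongrightarrow> norm (0 * S)" by (intro tendsto_intros assms)
  then have small: "\<forall>\<^sub>F i in sequentially. norm (e i * w i) < 1 / 2" by (rule order_tendstoD(2)) simp
  have "(\<lambda>i. Arctan (e i * w i) / e i - w i) \<longlonglongrightarrow> 0"
  proof (rule Lim_null_comparison)
    show "\<forall>\<^sub>F i in sequentially. norm (Arctan (e i * w i) / e i - w i) \<le> 2 * ((norm (e i))\<^sup>2 * norm (w i) ^ 3)"
      using small
    proof eventually_elim
      case (elim i)
      have "Arctan (e i * w i) / e i - w i = (Arctan (e i * w i) - e i * w i) / e i"
        using assms(2)[of i] by (simp add: field_simps)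
      then have "norm (Arctan (e i * w i) / e i - w i) = norm (Arctan (e i * w i) - e i * w i) / norm (e i)"
        by (simp add: norm_divide)
      also have "\<dots> \<le> 2 * norm (e i * w i) ^ 3 / norm (e i)"
        using elim by (intro divide_right_mono norm_Arctan_approx) auto
      also have "\<dots> = 2 * ((norm (e i))\<^sup>2 * norm (w i) ^ 3)"
        using assms(2)[of i] by (simp add: norm_mult power3_eq_cube power2_eq_square)
      finally show ?case .
    qed
    have "(\<lambda>i. 2 * ((norm (e i))\<^sup>2 * norm (w i) ^ 3)) \<longlonglongrightarrow> 2 * ((norm (0 :: complex))\<^sup>2 * norm S ^ 3)"
      by (intro tendsto_intros assms)
    then show "(\<lambda>i. 2 * ((norm (e i))\<^sup>2 * norm (w i) ^ 3)) \<longlonglongrightarrow> 0" by simp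
  qed
  from tendsto_add[OF this assms(3)] show ?thesis by simp
qed

text \<open>x = -e cot(es) means tan(es) = -e/x, and Arctan selects the solution s near -1/x. Then
  sin(es)/e has the same limit -1/x0, and Ln(-1/x0) = -Ln(-x0) turns the limit of the transit
  coordinate into \<open>w_in\<close>.\<close>

lemma transit_start:
  fixes e x :: "nat \<Rightarrow> complex"
  assumes e: "e \<longlonglongrightarrow> 0" "\<And>i. e i \<noteq> 0" and x: "x \<longlonglongrightarrow> x0" "0 < Re (- x0)"
  defines "s \<equiv> \<lambda>i. Arctan (e i * (- 1 / x i)) / e i"
  shows "s \<longlonglongrightarrow> - 1 / x0" "(\<lambda>i. transit_coord q (e i) (s i)) \<longlonglongrightarrow> w_in q (x0, y)"
    "\<forall>\<^sub>F i in sequentially. x i * sin (e i * s i) = - e i * cos (e i * s i)"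
proof -
  have x0: "x0 \<noteq> 0" "- x0 \<notin> \<real>\<^sub>\<le>\<^sub>0" using x(2) by (auto simp: complex_nonpos_Reals_iff)
  have w: "(\<lambda>i. - 1 / x i) \<longlonglongrightarrow> - 1 / x0" using x(1) x0 by (intro tendsto_intros)
  show s: "s \<longlonglongrightarrow> - 1 / x0" unfolding s_def by (rule Arctan_over_tendsto[OF e w])
  have Re: "0 < Re (- 1 / x0)"
    using Re_pos_of_inverse[of "1 / (- x0)"] x(2) by simp
  then have "- 1 / x0 \<notin> \<real>\<^sub>\<le>\<^sub>0" by (auto simp: complex_nonpos_Reals_iff)
  then have "(\<lambda>i. s i + q * Ln (sin (e i * s i) / e i)) \<longlonglongrightarrow> - 1 / x0 + q * Ln (- 1 / x0)"
    by (intro tendsto_add s tendsto_mult tendsto_const tendsto_Ln sin_over_tendsto e)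
  moreover have "Ln (- 1 / x0) = - Ln (- x0)" using Ln_inverse[OF x0(2)] by (simp add: inverse_eq_divide)
  then have "- 1 / x0 + q * Ln (- 1 / x0) = w_in q (x0, y)" by (simp add: w_in_def)
  ultimately show "(\<lambda>i. transit_coord q (e i) (s i)) \<longlonglongrightarrow> w_in q (x0, y)"
    by (simp only: transit_coord_def)
  have "(\<lambda>i. norm (e i * (- 1 / x i))) \<longlonglongrightarrow> norm (0 * (- 1 / x0))" by (intro tendsto_norm tendsto_mult e w)
  then have "\<forall>\<^sub>F i in sequentially. norm (e i * (- 1 / x i)) < 1" by (rule order_tendstoD(2)) simp
  moreover have "\<forall>\<^sub>F i in sequentially. x i \<noteq> 0" by (rule tendsto_imp_eventually_ne[OF x(1) x0(1)])
  ultimately show "\<forall>\<^sub>F i in sequentially. x i * sin (e i * s i) = - e i * cos (e i * s i)"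
  proof eventually_elim
    case (elim i)
    define z where "z = e i * (- 1 / x i)"
    have "z\<^sup>2 \<noteq> -1"
    proof
      assume "z\<^sup>2 = -1"
      then have "norm z ^ 2 = 1" by (metis norm_minus_cancel norm_one norm_power)
      then show False using elim(1) abs_square_eq_1[of "norm z"] unfolding z_def by simp
    qed
    then have t: "tan (Arctan z) = z" by (rule tan_Arctan)
    have c: "cos (Arctan z) \<noteq> 0"
    proof
      assume c0: "cos (Arctan z) = 0"
      then have "z = 0" using t by (simp add: tan_def)
      with c0 show False by simp
    qed
    have "sin (Arctan z) = z * cos (Arctan z)" using t c by (simp add: tan_def field_simps)
    moreover have "e i * s i = Arctan z" unfolding s_def z_def using e(2)[of i] by simp
    ultimately show ?case using elim(2) by (simp add: z_def)
  qed
qed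

text \<open>At the exit s is unbounded, but S = \<pi>/e - s converges. The reflection keeps the sine
  and changes the sign of the cosine, so xS tends to 1 and sin(es)/e to S0 = 1/x0. Subtracting
  \<pi>/e from the transit coordinate leaves -S0 + q Ln S0, which is \<open>w_out\<close>.\<close>

lemma transit_end:
  fixes e x S :: "nat \<Rightarrow> complex"
  assumes e: "e \<longlonglongrightarrow> 0" "\<And>i. e i \<noteq> 0" and x: "x \<longlonglongrightarrow> x0" and S: "S \<longlonglongrightarrow> S0" "0 < Re S0"
    and xS: "\<And>i. x i * sin (e i * (of_real pi / e i - S i)) = - e i * cos (e i * (of_real pi / e i - S i))"
  shows "x0 \<noteq> 0" "(\<lambda>i. transit_coord q (e i) (of_real pi / e i - S i) - of_real pi / e i) \<longlonglongrightarrow> w_out q (x0, y)"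
proof -
  have arg: "e i * (of_real pi / e i - S i) = of_real pi - e i * S i" for i
    using e(2)[of i] by (simp add: field_simps)
  have sc: "sin (e i * (of_real pi / e i - S i)) = sin (e i * S i)"
      "cos (e i * (of_real pi / e i - S i)) = - cos (e i * S i)" for i
    unfolding arg by (simp_all add: sin_diff cos_diff)
  note so = sin_over_tendsto[OF e S(1)]
  have eq: "x i * (sin (e i * S i) / e i) = cos (e i * S i)" for i
    using xS[of i] e(2)[of i] unfolding sc by (simp add: field_simps)
  have "(\<lambda>i. cos (e i * S i)) \<longlonglongrightarrow> cos (0 * S0)" by (intro tendsto_intros e S)
  moreover have "(\<lambda>i. x i * (sin (e i * S i) / e i)) \<longlonglongrightarrow> x0 * S0" by (intro tendsto_mult x so)
  ultimately have x1: "x0 * S0 = 1" unfolding eq using LIMSEQ_unique by fastforce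
  then show "x0 \<noteq> 0" by auto
  have S0: "S0 \<noteq> 0" "S0 \<notin> \<real>\<^sub>\<le>\<^sub>0" using S(2) by (auto simp: complex_nonpos_Reals_iff)
  have xS0: "x0 = inverse S0" using x1 S0(1) by (simp add: field_simps)
  have "(\<lambda>i. - S i + q * Ln (sin (e i * S i) / e i)) \<longlonglongrightarrow> - S0 + q * Ln S0"
    using S0(2) by (intro tendsto_add tendsto_minus S tendsto_mult tendsto_const tendsto_Ln so)
  moreover have "w_out q (x0, y) = - S0 + q * Ln S0"
    unfolding w_out_def xS0 using Ln_inverse[OF S0(2)] by (simp add: divide_inverse)
  ultimately show "(\<lambda>i. transit_coord q (e i) (of_real pi / e i - S i) - of_real pi / e i) \<longlonglongrightarrow> w_out q (x0, y)"
    unfolding transit_coord_def sc by simp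
qed

section \<open>Orbits of the perturbed maps on their way through the gate\<close>

context tracked_semi_parabolic_family
begin

text \<open>The conclusion of \<open>transit\<close> for the orbit of p, at the times that keep
  distance M from both 0 and n; v stands for the transit coordinate at the entrance time M.\<close>

definition passes_gate :: "real \<Rightarrow> complex \<Rightarrow> nat \<Rightarrow> complex \<times> complex \<Rightarrow> nat \<Rightarrow> complex \<Rightarrow> bool" where
  "passes_gate B e n p M v \<longleftrightarrow> 2 * M \<le> n \<and>
     (\<forall>k. M \<le> k \<longrightarrow> k + M \<le> n \<longrightarrow> (F e ^^ k) p \<in> K \<and>
        norm (fst (\<Phi> e ((F e ^^ k) p))) \<le> B / min (real k) (real n - real k) \<and>
        norm (snd (\<Phi> e ((F e ^^ k) p))) \<le> B / (min (real k) (real n - real k))\<^sup>2 \<and>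
        (\<exists>s. fst (\<Phi> e ((F e ^^ k) p)) * sin (e * s) = - e * cos (e * s) \<and>
          norm (s - of_nat k) \<le> min (real k) (real n - real k) / 12 \<and>
          norm (transit_coord q e s - v - (of_nat k - of_nat M)) \<le> B / real M))"

text \<open>For fixed M, the first M iterates converge as e tends to 0, so the perturbed orbit
  inherits at time M the entrance conditions of \<open>transit\<close> that the basin orbit
  satisfies. \<open>M1\<close> and \<open>B\<close> are chosen before M because M tends to infinity
  later.\<close>

lemma transit_orbit:
  assumes p: "p \<in> parabolic_basin f z\<^sub>0" and e: "e \<longlonglongrightarrow> 0" "\<And>i. e i \<noteq> 0"
    and n: "filterlim n at_top sequentially" "(\<lambda>i. of_nat (n i) - of_real pi / e i) \<longlonglongrightarrow> \<alpha>"
    and pp: "pp \<longlonglongrightarrow> p"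
  obtains M1 :: nat and B v0 where "norm \<alpha> + 1 < real M1 / 2" "0 < B"
    "\<And>M. M1 \<le> M \<Longrightarrow> (\<lambda>i. v0 M i) \<longlonglongrightarrow> w_in q (\<phi> ((f ^^ M) p))"
    "\<And>M. M1 \<le> M \<Longrightarrow> \<forall>\<^sub>F i in sequentially. norm (of_real pi / e i - of_nat (n i)) \<le> norm \<alpha> + 1 \<and>
      passes_gate B (e i) (n i) (pp i) M (v0 M i)"
proof -
  obtain Cy where I: "0 \<le> Cy" "\<forall>\<^sub>F n in sequentially. norm (snd (\<phi> ((f ^^ n) p))) \<le> Cy / (real n)\<^sup>2"
    "convergent (\<lambda>n. w_in q (\<phi> ((f ^^ n) p)) - of_nat n)"
    "(\<lambda>n. - 1 / fst (\<phi> ((f ^^ n) p)) / of_nat n) \<longlonglongrightarrow> 1"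
    "\<forall>\<^sub>F n in sequentially. 0 < Re (- fst (\<phi> ((f ^^ n) p)))"
    by (rule basin_incoming[OF p]) (rule that)
  obtain l where l: "(\<lambda>n. w_in q (\<phi> ((f ^^ n) p)) - of_nat n) \<longlonglongrightarrow> l" using I(3) by (auto simp: convergent_def)
  \<comment> \<open>The margins in A, in C0, in Cy + 1 and in 1/32 against 1/16 make the conditions
    strict for the limit orbit, so that they hold for all large i.\<close>
  define A where "A = norm \<alpha> + 1"
  define C0 where "C0 = norm l + 2"
  have nn: "0 \<le> A" "0 \<le> C0" "0 \<le> Cy + 1" unfolding A_def C0_def using I(1) by auto
  show thesis
  proof (rule transit[OF csts(2,3,4,5) nn csts(1), of q r])
    fix M0 :: nat and B :: real
    assume M0: "0 < M0" "0 < B" and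
      tr: "\<And>(M::nat) (n::nat) (e::complex) (x :: nat \<Rightarrow> complex) (y :: nat \<Rightarrow> complex) s0.
        \<lbrakk>M0 \<le> M; e \<noteq> 0; norm (of_real pi / e - of_nat n) \<le> A;
         x M * sin (e * s0) = - e * cos (e * s0); norm (s0 - of_nat M) \<le> real M / 16;
         norm (transit_coord q e s0 - of_nat M) \<le> C0; norm (y M) \<le> (Cy + 1) / (real M)\<^sup>2;
         \<And>k. \<lbrakk>M \<le> k; k < n - M; \<forall>j. M \<le> j \<longrightarrow> j \<le> k \<longrightarrow> norm (x j) < \<delta> \<and> norm (y j) < \<delta>; norm e < \<delta>\<rbrakk> \<Longrightarrow>
           \<exists>a b g. x (Suc k) = x k + ((x k)\<^sup>2 + e\<^sup>2) * a \<and> y (Suc k) = b * y k + ((x k)\<^sup>2 + e\<^sup>2) * g \<and>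
             norm (a - (1 + (q + 1) * x k + r * y k)) \<le> C * ((norm (x k))\<^sup>2 + (norm (y k))\<^sup>2 + (norm e)\<^sup>2) \<and>
             norm b \<le> \<rho> \<and> norm g \<le> G\<rbrakk> \<Longrightarrow>
        \<forall>k. M \<le> k \<longrightarrow> k + M \<le> n \<longrightarrow>
          norm e < \<delta> \<and> norm (x k) < \<delta> \<and> norm (y k) < \<delta> \<and>
          norm (x k) \<le> B / min (real k) (real n - real k) \<and> norm (y k) \<le> B / (min (real k) (real n - real k))\<^sup>2 \<and>
          (\<exists>s. x k * sin (e * s) = - e * cos (e * s) \<and> norm (s - of_nat k) \<le> min (real k) (real n - real k) / 12 \<and>
            norm (transit_coord q e s - transit_coord q e s0 - (of_nat k - of_nat M)) \<le> B / real M)"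
    define x where "x M = fst (\<phi> ((f ^^ M) p))" for M
    define y where "y M = snd (\<phi> ((f ^^ M) p))" for M
    have "\<forall>\<^sub>F M in sequentially. M0 \<le> M \<and> norm \<alpha> + 1 < real M / 2 \<and> (f ^^ M) p \<in> interior K \<and> norm (y M) \<le> Cy / (real M)\<^sup>2 \<and>
        norm (- 1 / x M / of_nat M - 1) < 1 / 32 \<and> 0 < Re (- x M) \<and> norm (w_in q (x M, y M) - of_nat M - l) < 1"
    proof (intro eventually_conj)
      show "\<forall>\<^sub>F M in sequentially. norm \<alpha> + 1 < real M / 2" by real_asymp
      show "\<forall>\<^sub>F M in sequentially. (f ^^ M) p \<in> interior K"
        by (rule topological_tendstoD[OF basin_tendsto[OF p] open_interior K(3)])
      show "\<forall>\<^sub>F M in sequentially. norm (y M) \<le> Cy / (real M)\<^sup>2" unfolding y_def by (rule I(2))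
      show "\<forall>\<^sub>F M in sequentially. norm (- 1 / x M / of_nat M - 1) < 1 / 32"
        unfolding x_def using tendstoD[OF I(4), of "1 / 32"] by (simp add: dist_norm)
      show "\<forall>\<^sub>F M in sequentially. 0 < Re (- x M)" unfolding x_def by (rule I(5))
      show "\<forall>\<^sub>F M in sequentially. norm (w_in q (x M, y M) - of_nat M - l) < 1"
        unfolding x_def y_def using tendstoD[OF l, of 1] by (simp add: dist_norm)
    qed (rule eventually_ge_at_top)
    then obtain M1 where M1: "\<And>M. M1 \<le> M \<Longrightarrow> M0 \<le> M \<and> norm \<alpha> + 1 < real M / 2 \<and> (f ^^ M) p \<in> interior K \<and>
        norm (y M) \<le> Cy / (real M)\<^sup>2 \<and> norm (- 1 / x M / of_nat M - 1) < 1 / 32 \<and> 0 < Re (- x M) \<and>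
        norm (w_in q (x M, y M) - of_nat M - l) < 1"
      unfolding eventually_sequentially by blast
    define X where "X M i = fst (\<Phi> (e i) ((F (e i) ^^ M) (pp i)))" for M i
    define Y where "Y M i = snd (\<Phi> (e i) ((F (e i) ^^ M) (pp i)))" for M i
    define s0 where "s0 M = (\<lambda>i. Arctan (e i * (- 1 / X M i)) / e i)" for M
    define v0 where "v0 M i = transit_coord q (e i) (s0 M i)" for M i
    have lims: "(\<lambda>i. (F (e i) ^^ M) (pp i)) \<longlonglongrightarrow> (f ^^ M) p" for M
      by (rule funpow_F_tendsto[OF e(1) pp D(2)])
    have XY: "X M \<longlonglongrightarrow> x M" "Y M \<longlonglongrightarrow> y M" if "M1 \<le> M" for M
    proof -
      have "(f ^^ M) p \<in> U" using M1[OF that] K(2) interior_subset by blast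
      from \<Phi>_tendsto[OF e(1) lims D(2) this]
      have t: "(\<lambda>i. \<Phi> (e i) ((F (e i) ^^ M) (pp i))) \<longlonglongrightarrow> \<phi> ((f ^^ M) p)" .
      show "X M \<longlonglongrightarrow> x M" "Y M \<longlonglongrightarrow> y M"
        unfolding X_def[abs_def] Y_def[abs_def] x_def y_def using tendsto_fst[OF t] tendsto_snd[OF t] by simp_all
    qed
    show thesis
    proof (rule that[of M1 B v0])
      show "norm \<alpha> + 1 < real M1 / 2" "0 < B" using M1[of M1] M0 by auto
      fix M assume M: "M1 \<le> M"
      note m1 = M1[OF M]
      have Mpos: "0 < real M" using m1 M0 by simp
      have re: "0 < Re (- x M)" using m1 by blast
      have ts: "s0 M \<longlonglongrightarrow> - 1 / x M" "(\<lambda>i. transit_coord q (e i) (s0 M i)) \<longlonglongrightarrow> w_in q (x M, y M)"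
        "\<forall>\<^sub>F i in sequentially. X M i * sin (e i * s0 M i) = - e i * cos (e i * s0 M i)"
        unfolding s0_def by (rule transit_start[OF e XY(1)[OF M] re])+
      have v: "v0 M \<longlonglongrightarrow> w_in q (x M, y M)"
        using ts(2) unfolding v0_def[abs_def] by simp
      then show "(\<lambda>i. v0 M i) \<longlonglongrightarrow> w_in q (\<phi> ((f ^^ M) p))" unfolding x_def y_def by simp
      have e1: "\<forall>\<^sub>F i in sequentially. 2 * M \<le> n i" using n(1) unfolding filterlim_at_top by blast
      have e2: "\<forall>\<^sub>F i in sequentially. norm (of_real pi / e i - of_nat (n i)) < A"
      proof -
        have "(\<lambda>i. norm (of_nat (n i) - of_real pi / e i)) \<longlonglongrightarrow> norm \<alpha>" using n(2) by (rule tendsto_norm)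
        then have "\<forall>\<^sub>F i in sequentially. norm (of_nat (n i) - of_real pi / e i) < A"
          by (rule order_tendstoD(2)) (simp add: A_def)
        then show ?thesis by (simp add: norm_minus_commute)
      qed
      have e3: "\<forall>\<^sub>F i in sequentially. (F (e i) ^^ M) (pp i) \<in> interior K"
        using m1 by (intro topological_tendstoD[OF lims open_interior]) blast
      have e4: "\<forall>\<^sub>F i in sequentially. norm (s0 M i - of_nat M) < real M / 16"
      proof -
        have "- 1 / x M - of_nat M = of_nat M * (- 1 / x M / of_nat M - 1)" using Mpos by (simp add: field_simps)
        then have "norm (- 1 / x M - of_nat M) = real M * norm (- 1 / x M / of_nat M - 1)"
          by (metis norm_mult norm_of_nat)
        also have "\<dots> < real M * (1 / 16)" using m1 Mpos by (intro mult_strict_left_mono) auto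
        finally have "norm (- 1 / x M - of_nat M) < real M / 16" by simp
        moreover have "(\<lambda>i. norm (s0 M i - of_nat M)) \<longlonglongrightarrow> norm (- 1 / x M - of_nat M)"
          by (intro tendsto_intros ts(1))
        ultimately show ?thesis by (rule order_tendstoD(2)[rotated])
      qed
      have e5: "\<forall>\<^sub>F i in sequentially. norm (v0 M i - of_nat M) < C0"
      proof -
        have "norm (w_in q (x M, y M) - of_nat M) < C0"
          using m1 norm_triangle_ineq[of "w_in q (x M, y M) - of_nat M - l" l] unfolding C0_def by simp
        moreover have "(\<lambda>i. norm (v0 M i - of_nat M)) \<longlonglongrightarrow> norm (w_in q (x M, y M) - of_nat M)"
          by (intro tendsto_intros v)
        ultimately show ?thesis by (rule order_tendstoD(2)[rotated])
      qed
      have e6: "\<forall>\<^sub>F i in sequentially. norm (Y M i) < (Cy + 1) / (real M)\<^sup>2"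
      proof -
        have "Cy / (real M)\<^sup>2 < (Cy + 1) / (real M)\<^sup>2" using Mpos by (intro divide_strict_right_mono) auto
        then have "norm (y M) < (Cy + 1) / (real M)\<^sup>2" using m1 by linarith
        then show ?thesis using tendsto_norm[OF XY(2)[OF M]] by (rule order_tendstoD(2)[rotated])
      qed
      show "\<forall>\<^sub>F i in sequentially. norm (of_real pi / e i - of_nat (n i)) \<le> norm \<alpha> + 1 \<and>
        passes_gate B (e i) (n i) (pp i) M (v0 M i)"
        using e1 e2 e3 e4 e5 e6 ts(3)
      proof eventually_elim
        case (elim i)
        \<comment> \<open>Only smallness at times before k is assumed; so this can justify the
          recursion that \<open>transit\<close> asks for without presupposing what
          \<open>transit\<close> concludes.\<close>
        have stay: "(F (e i) ^^ k) (pp i) \<in> K"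
          if "M \<le> k" "norm (e i) < \<delta>" "\<And>j. M \<le> j \<Longrightarrow> j < k \<Longrightarrow> norm (X j i) < \<delta> \<and> norm (Y j i) < \<delta>" for k
          using that
        proof (induction k rule: nat_induct_at_least)
          case base
          then show ?case using elim(3) interior_subset by blast
        next
          case (Suc k)
          then have "(F (e i) ^^ k) (pp i) \<in> K" by auto
          then show ?case using track[of "(F (e i) ^^ k) (pp i)" "e i"] Suc.prems Suc.hyps unfolding X_def Y_def by auto
        qed
        have R: "\<forall>k. M \<le> k \<longrightarrow> k + M \<le> n i \<longrightarrow>
          norm (e i) < \<delta> \<and> norm (X k i) < \<delta> \<and> norm (Y k i) < \<delta> \<and>
          norm (X k i) \<le> B / min (real k) (real (n i) - real k) \<and> norm (Y k i) \<le> B / (min (real k) (real (n i) - real k))\<^sup>2 \<and>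
          (\<exists>s. X k i * sin (e i * s) = - e i * cos (e i * s) \<and> norm (s - of_nat k) \<le> min (real k) (real (n i) - real k) / 12 \<and>
            norm (transit_coord q (e i) s - transit_coord q (e i) (s0 M i) - (of_nat k - of_nat M)) \<le> B / real M)"
        proof (rule tr)
          show "M0 \<le> M" "e i \<noteq> 0" using m1 e by auto
          show "norm (of_real pi / e i - of_nat (n i)) \<le> A" "norm (s0 M i - of_nat M) \<le> real M / 16"
            "norm (transit_coord q (e i) (s0 M i) - of_nat M) \<le> C0" "norm (Y M i) \<le> (Cy + 1) / (real M)\<^sup>2"
            using elim unfolding v0_def by auto
          show "X M i * sin (e i * s0 M i) = - e i * cos (e i * s0 M i)" using elim by blast
          fix k assume k: "M \<le> k" "k < n i - M" "\<forall>j. M \<le> j \<longrightarrow> j \<le> k \<longrightarrow> norm (X j i) < \<delta> \<and> norm (Y j i) < \<delta>"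
            "norm (e i) < \<delta>"
          have inK: "(F (e i) ^^ k) (pp i) \<in> K" using k by (intro stay) auto
          have sm: "norm (X k i) < \<delta>" "norm (Y k i) < \<delta>" using k by auto
          have T: "X (Suc k) i = X k i + ((X k i)\<^sup>2 + (e i)\<^sup>2) * a (e i, X k i, Y k i)"
            "Y (Suc k) i = c (e i, X k i) * Y k i + ((X k i)\<^sup>2 + (e i)\<^sup>2) * \<beta> (e i, X k i, Y k i)"
            using track[OF inK k(4)] sm unfolding X_def Y_def by simp_all
          show "\<exists>a b g. X (Suc k) i = X k i + ((X k i)\<^sup>2 + (e i)\<^sup>2) * a \<and> Y (Suc k) i = b * Y k i + ((X k i)\<^sup>2 + (e i)\<^sup>2) * g \<and>
             norm (a - (1 + (q + 1) * X k i + r * Y k i)) \<le> C * ((norm (X k i))\<^sup>2 + (norm (Y k i))\<^sup>2 + (norm (e i))\<^sup>2) \<and>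
             norm b \<le> \<rho> \<and> norm g \<le> G"
            using T bounds[OF k(4) sm]
            by (intro exI[of _ "a (e i, X k i, Y k i)"] exI[of _ "c (e i, X k i)"] exI[of _ "\<beta> (e i, X k i, Y k i)"] conjI) auto
        qed
        have inK: "(F (e i) ^^ k) (pp i) \<in> K" if k: "M \<le> k" "k + M \<le> n i" for k
          by (rule stay[OF k(1)]) (use R k in auto)
        show ?case unfolding passes_gate_def
        proof (intro conjI allI impI)
          show "2 * M \<le> n i" "norm (of_real pi / e i - of_nat (n i)) \<le> norm \<alpha> + 1" using elim unfolding A_def by auto
          fix k assume k: "M \<le> k" "k + M \<le> n i"
          show "(F (e i) ^^ k) (pp i) \<in> K" by (rule inK[OF k])
          have Rk: "norm (X k i) \<le> B / min (real k) (real (n i) - real k) \<and> norm (Y k i) \<le> B / (min (real k) (real (n i) - real k))\<^sup>2 \<and>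
          (\<exists>s. X k i * sin (e i * s) = - e i * cos (e i * s) \<and> norm (s - of_nat k) \<le> min (real k) (real (n i) - real k) / 12 \<and>
            norm (transit_coord q (e i) s - v0 M i - (of_nat k - of_nat M)) \<le> B / real M)"
            using R k unfolding v0_def by blast
          then show "norm (fst (\<Phi> (e i) ((F (e i) ^^ k) (pp i)))) \<le> B / min (real k) (real (n i) - real k)"
            "norm (snd (\<Phi> (e i) ((F (e i) ^^ k) (pp i)))) \<le> B / (min (real k) (real (n i) - real k))\<^sup>2"
            "\<exists>s. fst (\<Phi> (e i) ((F (e i) ^^ k) (pp i))) * sin (e i * s) = - e i * cos (e i * s) \<and>
            norm (s - of_nat k) \<le> min (real k) (real (n i) - real k) / 12 \<and>
            norm (transit_coord q (e i) s - v0 M i - (of_nat k - of_nat M)) \<le> B / real M"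
            unfolding X_def Y_def by blast+
        qed
      qed
    qed
  qed
qed

end

lemma compact_subseq:
  fixes u :: "nat \<Rightarrow> 'a::metric_space"
  assumes "compact K" "\<forall>\<^sub>F i in sequentially. u i \<in> K"
  obtains l \<sigma> where "l \<in> K" "strict_mono \<sigma>" "(\<lambda>i. u (\<sigma> i)) \<longlonglongrightarrow> l"
proof -
  obtain N where N: "\<And>i. N \<le> i \<Longrightarrow> u i \<in> K" using assms(2) unfolding eventually_sequentially by blast
  have "\<exists>l\<in>K. \<exists>\<tau>. strict_mono \<tau> \<and> ((\<lambda>i. u (i + N)) \<circ> \<tau>) \<longlonglongrightarrow> l"
    by (rule assms(1)[unfolded compact_def, rule_format]) (simp add: N)
  then obtain l \<tau> where l: "l \<in> K" "strict_mono \<tau>" "((\<lambda>i. u (i + N)) \<circ> \<tau>) \<longlonglongrightarrow> l" by blast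
  show thesis
    by (rule that[of l "\<lambda>i. \<tau> i + N"]) (use l in \<open>auto simp: strict_mono_def o_def\<close>)
qed

context tracked_semi_parabolic_family
begin

lemma asymptotic_curveI:
  assumes mem: "\<And>m. M1 \<le> m \<Longrightarrow> (inv f ^^ m) Q \<in> K \<and> fst (\<phi> ((inv f ^^ m) Q)) \<noteq> 0 \<and>
      norm (fst (\<phi> ((inv f ^^ m) Q))) \<le> B / real m \<and> norm (snd (\<phi> ((inv f ^^ m) Q))) \<le> B / (real m)\<^sup>2"
  shows "Q \<in> asymptotic_curve f z\<^sub>0"
proof -
  let ?z = "\<lambda>m. (inv f ^^ m) Q"
  have "?z \<longlonglongrightarrow> z\<^sub>0"
  proof (rule LIMSEQ_offset[of _ M1])
    have z: "u \<longlonglongrightarrow> 0" if "\<forall>\<^sub>F n in sequentially. norm (u n) \<le> v n" "v \<longlonglongrightarrow> 0" for u :: "nat \<Rightarrow> complex" and v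
      using that by (rule Lim_null_comparison)
    have f1: "(\<lambda>m. fst (\<phi> (?z (m + M1)))) \<longlonglongrightarrow> 0"
    proof (rule z)
      show "\<forall>\<^sub>F m in sequentially. norm (fst (\<phi> (?z (m + M1)))) \<le> B / real (m + M1)"
        by (intro always_eventually allI) (use mem in \<open>blast intro: le_add2\<close>)
      show "(\<lambda>m. B / real (m + M1)) \<longlonglongrightarrow> 0" by real_asymp
    qed
    have f2: "(\<lambda>m. snd (\<phi> (?z (m + M1)))) \<longlonglongrightarrow> 0"
    proof (rule z)
      show "\<forall>\<^sub>F m in sequentially. norm (snd (\<phi> (?z (m + M1)))) \<le> B / (real (m + M1))\<^sup>2"
        by (intro always_eventually allI) (use mem in \<open>blast intro: le_add2\<close>)
      show "(\<lambda>m. B / (real (m + M1))\<^sup>2) \<longlonglongrightarrow> 0" by real_asymp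
    qed
    show "(\<lambda>m. ?z (m + M1)) \<longlonglongrightarrow> z\<^sub>0"
    proof (rule tendsto_fixpoint[OF K(1,2)])
      show "?z (m + M1) \<in> K" for m using mem[of "m + M1"] by simp
      show "(\<lambda>i::nat. 0 :: complex) \<longlonglongrightarrow> 0" by simp
      show "(\<lambda>m. \<phi> (?z (m + M1))) \<longlonglongrightarrow> (0, 0)" using tendsto_Pair[OF f1 f2] by simp
    qed
  qed
  moreover have "Q \<noteq> z\<^sub>0"
  proof
    assume "Q = z\<^sub>0"
    moreover have "(inv f ^^ m) z\<^sub>0 = z\<^sub>0" for m
      by (induction m) (simp_all, metis f_inv(2) fixpoint)
    ultimately show False using mem[of M1] coords'(3) by simp
  qed
  ultimately show ?thesis unfolding asymptotic_curve_def by simp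
qed

text \<open>Compactness yields the subsequence, which is all that a limsup needs. Q is fixed by the
  points \<open>M1\<close> steps before the end. For each m >= \<open>M1\<close> a further
  subsequence, depending on m, shows that the m-th preimage of Q is the limit of the points m steps
  before the end, and the transit estimate passes to this limit with error B/m. Letting m grow
  compares the Fatou coordinates.\<close>

lemma parabolic_implosion:
  assumes p: "p \<in> parabolic_basin f z\<^sub>0" and e: "e \<longlonglongrightarrow> 0" "\<And>i. e i \<noteq> 0"
    and n: "filterlim n at_top sequentially" "(\<lambda>i. of_nat (n i) - of_real pi / e i) \<longlonglongrightarrow> \<alpha>"
    and pp: "pp \<longlonglongrightarrow> p"
  obtains \<sigma> where "strict_mono \<sigma>"
    "(\<lambda>i. (F (e (\<sigma> i)) ^^ n (\<sigma> i)) (pp (\<sigma> i))) \<longlonglongrightarrow> lavaurs_map f z\<^sub>0 \<phi> q \<alpha> p"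
proof (rule transit_orbit[OF p e n pp])
  fix M1 :: nat and B v0
  assume M1: "norm \<alpha> + 1 < real M1 / 2" "(0::real) < B"
    and v0: "\<And>M. M1 \<le> M \<Longrightarrow> (\<lambda>i. v0 M i) \<longlonglongrightarrow> w_in q (\<phi> ((f ^^ M) p))"
    and tr: "\<And>M. M1 \<le> M \<Longrightarrow> \<forall>\<^sub>F i in sequentially. norm (of_real pi / e i - of_nat (n i)) \<le> norm \<alpha> + 1 \<and>
      passes_gate B (e i) (n i) (pp i) M (v0 M i)"
  define u where "u m i = (F (e i) ^^ (n i - m)) (pp i)" for m i
  have M1pos: "0 < M1" using M1(1) norm_ge_zero[of \<alpha>] by (cases M1) auto
  \<comment> \<open>At the time k = n - m the minimum in \<open>passes_gate\<close> is m. S =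
    \<pi>/e - s measures the way still to go; putting \<pi>/e for n costs |\<alpha>| + 1, and 2m
    steps are cut off in all, m at each end.\<close>
  have exit_bounds: "\<forall>\<^sub>F i in sequentially. m \<le> n i \<and> u m i \<in> K \<and> norm (fst (\<Phi> (e i) (u m i))) \<le> B / real m \<and>
      norm (snd (\<Phi> (e i) (u m i))) \<le> B / (real m)\<^sup>2 \<and>
      (\<exists>S. fst (\<Phi> (e i) (u m i)) * sin (e i * (of_real pi / e i - S)) = - e i * cos (e i * (of_real pi / e i - S)) \<and>
        norm (S - of_nat m) \<le> real m / 12 + (norm \<alpha> + 1) \<and>
        norm (transit_coord q (e i) (of_real pi / e i - S) - v0 m i - (of_nat (n i) - 2 * of_nat m)) \<le> B / real m)"
    if m: "M1 \<le> m" for m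
    using tr[OF m] unfolding passes_gate_def
  proof eventually_elim
    case (elim i)
    have k: "m \<le> n i - m" "n i - m + m \<le> n i" using elim by auto
    have r: "real (n i - m) = real (n i) - real m" using elim by (simp add: of_nat_diff)
    have mn: "min (real (n i - m)) (real (n i) - real (n i - m)) = real m" unfolding r using elim by auto
    from elim k obtain s where s: "u m i \<in> K" "norm (fst (\<Phi> (e i) (u m i))) \<le> B / real m"
      "norm (snd (\<Phi> (e i) (u m i))) \<le> B / (real m)\<^sup>2"
      "fst (\<Phi> (e i) (u m i)) * sin (e i * s) = - e i * cos (e i * s)"
      "norm (s - of_nat (n i - m)) \<le> real m / 12"
      "norm (transit_coord q (e i) s - v0 m i - (of_nat (n i - m) - of_nat m)) \<le> B / real m"
      unfolding u_def mn[symmetric] by (metis mn)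
    have c: "of_nat (n i - m) = (of_nat (n i) - of_nat m :: complex)" using elim by (simp add: of_nat_diff)
    let ?S = "of_real pi / e i - s"
    have "?S - of_nat m = (of_real pi / e i - of_nat (n i)) - (s - of_nat (n i - m))" unfolding c by simp
    then have "norm (?S - of_nat m) \<le> norm (of_real pi / e i - of_nat (n i)) + norm (s - of_nat (n i - m))"
      by (metis norm_triangle_ineq4)
    also have "\<dots> \<le> real m / 12 + (norm \<alpha> + 1)" using s(5) elim by linarith
    finally have "norm (?S - of_nat m) \<le> real m / 12 + (norm \<alpha> + 1)" .
    moreover have "of_real pi / e i - ?S = s" by simp
    moreover have "norm (transit_coord q (e i) s - v0 m i - (of_nat (n i) - 2 * of_nat m)) \<le> B / real m"
      using s(6) unfolding c by (simp add: algebra_simps)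
    ultimately show ?case using s elim by (intro conjI exI[of _ ?S]) auto
  qed
  have "\<forall>\<^sub>F i in sequentially. u M1 i \<in> K" using exit_bounds[of M1] by (auto elim: eventually_mono)
  then obtain q1 \<sigma> where \<sigma>: "q1 \<in> K" "strict_mono \<sigma>" "(\<lambda>i. u M1 (\<sigma> i)) \<longlonglongrightarrow> q1"
    by (rule compact_subseq[OF K(1)])
  define Q where "Q = (f ^^ M1) q1"
  have sub: "(\<lambda>i. e (\<tau> i)) \<longlonglongrightarrow> 0" "(\<lambda>i. of_nat (n (\<tau> i)) - of_real pi / e (\<tau> i)) \<longlonglongrightarrow> \<alpha>" if "strict_mono \<tau>" for \<tau>
    using LIMSEQ_subseq_LIMSEQ[OF e(1) that] LIMSEQ_subseq_LIMSEQ[OF n(2) that] by (simp_all add: o_def)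
  have along: "\<forall>\<^sub>F i in sequentially. P (\<tau> i)" if "strict_mono \<tau>" "eventually P sequentially" for \<tau> P
    using that by (rule eventually_subseq)
  have full: "\<forall>\<^sub>F i in sequentially. (F (e i) ^^ m) (u m i) = (F (e i) ^^ n i) (pp i)" if "M1 \<le> m" for m
    using exit_bounds[OF that]
  proof eventually_elim
    case (elim i)
    then have "n i = m + (n i - m)" by simp
    then show ?case unfolding u_def by (metis funpow_add comp_apply)
  qed
  have toQ: "(\<lambda>i. (F (e (\<sigma> i)) ^^ n (\<sigma> i)) (pp (\<sigma> i))) \<longlonglongrightarrow> Q"
  proof (rule Lim_transform_eventually)
    show "(\<lambda>i. (F (e (\<sigma> i)) ^^ M1) (u M1 (\<sigma> i))) \<longlonglongrightarrow> Q"
      unfolding Q_def by (rule funpow_F_tendsto[OF sub(1)[OF \<sigma>(2)] \<sigma>(3) D(2)])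
    show "\<forall>\<^sub>F i in sequentially. (F (e (\<sigma> i)) ^^ M1) (u M1 (\<sigma> i)) = (F (e (\<sigma> i)) ^^ n (\<sigma> i)) (pp (\<sigma> i))"
      using along[OF \<sigma>(2) full[OF order_refl]] .
  qed
  have backward: "(inv f ^^ m) Q \<in> K \<and> fst (\<phi> ((inv f ^^ m) Q)) \<noteq> 0 \<and>
      norm (fst (\<phi> ((inv f ^^ m) Q))) \<le> B / real m \<and> norm (snd (\<phi> ((inv f ^^ m) Q))) \<le> B / (real m)\<^sup>2 \<and>
      norm ((w_out q (\<phi> ((inv f ^^ m) Q)) + of_nat m) - ((w_in q (\<phi> ((f ^^ m) p)) - of_nat m) + \<alpha>)) \<le> B / real m"
    if m: "M1 \<le> m" for m
  proof -
    have "\<forall>\<^sub>F i in sequentially. \<exists>S. m \<le> n i \<and> u m i \<in> K \<and> norm (fst (\<Phi> (e i) (u m i))) \<le> B / real m \<and>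
      norm (snd (\<Phi> (e i) (u m i))) \<le> B / (real m)\<^sup>2 \<and>
      fst (\<Phi> (e i) (u m i)) * sin (e i * (of_real pi / e i - S)) = - e i * cos (e i * (of_real pi / e i - S)) \<and>
        norm (S - of_nat m) \<le> real m / 12 + (norm \<alpha> + 1) \<and>
        norm (transit_coord q (e i) (of_real pi / e i - S) - v0 m i - (of_nat (n i) - 2 * of_nat m)) \<le> B / real m"
      using exit_bounds[OF m] by (rule eventually_mono) blast
    then obtain S where S: "\<forall>\<^sub>F i in sequentially. m \<le> n i \<and> u m i \<in> K \<and> norm (fst (\<Phi> (e i) (u m i))) \<le> B / real m \<and>
      norm (snd (\<Phi> (e i) (u m i))) \<le> B / (real m)\<^sup>2 \<and>
      fst (\<Phi> (e i) (u m i)) * sin (e i * (of_real pi / e i - S i)) = - e i * cos (e i * (of_real pi / e i - S i)) \<and>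
        norm (S i - of_nat m) \<le> real m / 12 + (norm \<alpha> + 1) \<and>
        norm (transit_coord q (e i) (of_real pi / e i - S i) - v0 m i - (of_nat (n i) - 2 * of_nat m)) \<le> B / real m"
      unfolding eventually_ex by blast
    define R where "R = real m / 12 + (norm \<alpha> + 1)"
    \<comment> \<open>The point and S are put into one compact set, so that a single subsequence
      serves both.\<close>
    have "\<forall>\<^sub>F i in sequentially. (u m (\<sigma> i), S (\<sigma> i)) \<in> K \<times> cball (of_nat m) R"
      using along[OF \<sigma>(2) S] by eventually_elim (auto simp: R_def dist_norm norm_minus_commute)
    then obtain lS \<tau>' where lS: "lS \<in> K \<times> cball (of_nat m) R" "strict_mono \<tau>'"
        "(\<lambda>i. (u m (\<sigma> (\<tau>' i)), S (\<sigma> (\<tau>' i)))) \<longlonglongrightarrow> lS"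
      by (rule compact_subseq[OF compact_Times[OF K(1) compact_cball]])
    define L where "L = fst lS"
    define S0 where "S0 = snd lS"
    define \<tau> where "\<tau> i = \<sigma> (\<tau>' i)" for i
    have \<tau>: "strict_mono \<tau>" unfolding \<tau>_def[abs_def] using \<sigma>(2) lS(2) by (simp add: strict_mono_def)
    have L: "L \<in> K" "(\<lambda>i. u m (\<tau> i)) \<longlonglongrightarrow> L" and S0: "(\<lambda>i. S (\<tau> i)) \<longlonglongrightarrow> S0" "norm (S0 - of_nat m) \<le> R"
      using lS(1) tendsto_fst[OF lS(3)] tendsto_snd[OF lS(3)]
      unfolding L_def S0_def \<tau>_def by (auto simp: dist_norm norm_minus_commute)
    \<comment> \<open>The condition |\<alpha>| + 1 < \<open>M1\<close>/2 serves this purpose: m/12 +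
      m/2 < m.\<close>
    have ReS: "0 < Re S0"
    proof -
      have "R < real m" using M1(1) m M1pos unfolding R_def by linarith
      then show ?thesis using S0(2) abs_Re_le_cmod[of "S0 - of_nat m"] by simp
    qed
    have "(\<lambda>i. (F (e (\<tau> i)) ^^ m) (u m (\<tau> i))) \<longlonglongrightarrow> (f ^^ m) L"
      by (rule funpow_F_tendsto[OF sub(1)[OF \<tau>] L(2) D(2)])
    moreover have "(\<lambda>i. (F (e (\<tau> i)) ^^ m) (u m (\<tau> i))) \<longlonglongrightarrow> Q"
    proof (rule Lim_transform_eventually)
      show "(\<lambda>i. (F (e (\<tau> i)) ^^ n (\<tau> i)) (pp (\<tau> i))) \<longlonglongrightarrow> Q"
        using LIMSEQ_subseq_LIMSEQ[OF toQ lS(2)] unfolding \<tau>_def by (simp add: o_def)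
      show "\<forall>\<^sub>F i in sequentially. (F (e (\<tau> i)) ^^ n (\<tau> i)) (pp (\<tau> i)) = (F (e (\<tau> i)) ^^ m) (u m (\<tau> i))"
        using along[OF \<tau> full[OF m]] by eventually_elim simp
    qed
    ultimately have "(f ^^ m) L = Q" by (rule LIMSEQ_unique)
    then have "(f ^^ m) L = (f ^^ m) ((inv f ^^ m) Q)" unfolding funpow_inv .
    then have Leq: "(inv f ^^ m) Q = L" using bij_fn[OF f_bij(1), of m] by (metis bij_inv_eq_iff)
    have \<Phi>L: "(\<lambda>i. \<Phi> (e (\<tau> i)) (u m (\<tau> i))) \<longlonglongrightarrow> \<phi> L"
      using L K(2) by (intro \<Phi>_tendsto sub[OF \<tau>] D) auto
    note S\<tau> = along[OF \<tau> S]
    have b1: "norm (fst (\<phi> L)) \<le> B / real m"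
      by (rule tendsto_upperbound[OF tendsto_norm[OF tendsto_fst[OF \<Phi>L]]])
        (use S\<tau> in \<open>auto elim: eventually_mono\<close>)
    have b2: "norm (snd (\<phi> L)) \<le> B / (real m)\<^sup>2"
      by (rule tendsto_upperbound[OF tendsto_norm[OF tendsto_snd[OF \<Phi>L]]])
        (use S\<tau> in \<open>auto elim: eventually_mono\<close>)
    \<comment> \<open>\<open>transit_end\<close> expects its relation at every index, so the
      finitely many exceptional ones are shifted away in \<mu>.\<close>
    obtain N where N: "\<And>i. N \<le> i \<Longrightarrow> m \<le> n (\<tau> i) \<and> u m (\<tau> i) \<in> K \<and> norm (fst (\<Phi> (e (\<tau> i)) (u m (\<tau> i)))) \<le> B / real m \<and>
      norm (snd (\<Phi> (e (\<tau> i)) (u m (\<tau> i)))) \<le> B / (real m)\<^sup>2 \<and>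
      fst (\<Phi> (e (\<tau> i)) (u m (\<tau> i))) * sin (e (\<tau> i) * (of_real pi / e (\<tau> i) - S (\<tau> i)))
        = - e (\<tau> i) * cos (e (\<tau> i) * (of_real pi / e (\<tau> i) - S (\<tau> i))) \<and>
        norm (S (\<tau> i) - of_nat m) \<le> real m / 12 + (norm \<alpha> + 1) \<and>
        norm (transit_coord q (e (\<tau> i)) (of_real pi / e (\<tau> i) - S (\<tau> i)) - v0 m (\<tau> i) - (of_nat (n (\<tau> i)) - 2 * of_nat m)) \<le> B / real m"
      using S\<tau> unfolding eventually_sequentially by blast
    define \<mu> where "\<mu> i = \<tau> (i + N)" for i
    have \<mu>: "strict_mono \<mu>" using \<tau> unfolding \<mu>_def strict_mono_def by simp
    have shift: "(\<lambda>i. g (\<mu> i)) \<longlonglongrightarrow> l" if "(\<lambda>i. g (\<tau> i)) \<longlonglongrightarrow> l" for g and l :: complex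
      unfolding \<mu>_def using LIMSEQ_ignore_initial_segment[OF that, of N] .
    have fstl: "(\<lambda>i. fst (\<Phi> (e (\<mu> i)) (u m (\<mu> i)))) \<longlonglongrightarrow> fst (\<phi> L)"
      using shift[of "\<lambda>i. fst (\<Phi> (e i) (u m i))"] tendsto_fst[OF \<Phi>L] by simp
    have S\<mu>: "(\<lambda>i. S (\<mu> i)) \<longlonglongrightarrow> S0" using shift[of S] S0(1) by simp
    have xS: "fst (\<Phi> (e (\<mu> i)) (u m (\<mu> i))) * sin (e (\<mu> i) * (of_real pi / e (\<mu> i) - S (\<mu> i)))
        = - e (\<mu> i) * cos (e (\<mu> i) * (of_real pi / e (\<mu> i) - S (\<mu> i)))" for i
      using N[of "i + N"] unfolding \<mu>_def by simp
    note te = transit_end[OF sub(1)[OF \<mu>] e(2) fstl S\<mu> ReS xS]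
    have vm: "(\<lambda>i. v0 m (\<mu> i)) \<longlonglongrightarrow> w_in q (\<phi> ((f ^^ m) p))"
      using LIMSEQ_subseq_LIMSEQ[OF v0[OF m] \<mu>] by (simp add: o_def)
    \<comment> \<open>Both n and \<pi>/e diverge; the grouping gives each bracket a limit, namely
      \<open>w_out\<close>, \<open>w_in\<close> and \<alpha>.\<close>
    have "(\<lambda>i. norm ((transit_coord q (e (\<mu> i)) (of_real pi / e (\<mu> i) - S (\<mu> i)) - of_real pi / e (\<mu> i)) - v0 m (\<mu> i)
        - (of_nat (n (\<mu> i)) - of_real pi / e (\<mu> i)) + 2 * of_nat m)) \<longlonglongrightarrow>
        norm (w_out q (fst (\<phi> L), snd (\<phi> L)) - w_in q (\<phi> ((f ^^ m) p)) - \<alpha> + 2 * of_nat m)"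
      by (intro tendsto_norm tendsto_add tendsto_diff te(2) vm sub[OF \<mu>] tendsto_const)
    then have "norm (w_out q (fst (\<phi> L), snd (\<phi> L)) - w_in q (\<phi> ((f ^^ m) p)) - \<alpha> + 2 * of_nat m) \<le> B / real m"
    proof (rule tendsto_upperbound)
      show "\<forall>\<^sub>F i in sequentially. norm ((transit_coord q (e (\<mu> i)) (of_real pi / e (\<mu> i) - S (\<mu> i)) - of_real pi / e (\<mu> i)) - v0 m (\<mu> i)
        - (of_nat (n (\<mu> i)) - of_real pi / e (\<mu> i)) + 2 * of_nat m) \<le> B / real m"
      proof (intro always_eventually allI)
        fix i
        have eq: "(transit_coord q (e (\<mu> i)) (of_real pi / e (\<mu> i) - S (\<mu> i)) - of_real pi / e (\<mu> i)) - v0 m (\<mu> i)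
        - (of_nat (n (\<mu> i)) - of_real pi / e (\<mu> i)) + 2 * of_nat m
          = transit_coord q (e (\<mu> i)) (of_real pi / e (\<mu> i) - S (\<mu> i)) - v0 m (\<mu> i) - (of_nat (n (\<mu> i)) - 2 * of_nat m)"
          by simp
        show "norm ((transit_coord q (e (\<mu> i)) (of_real pi / e (\<mu> i) - S (\<mu> i)) - of_real pi / e (\<mu> i)) - v0 m (\<mu> i)
        - (of_nat (n (\<mu> i)) - of_real pi / e (\<mu> i)) + 2 * of_nat m) \<le> B / real m"
          unfolding eq using N[of "i + N", OF le_add2] unfolding \<mu>_def by blast
      qed
    qed simp
    moreover have eq: "w_out q (fst (\<phi> L), snd (\<phi> L)) - w_in q (\<phi> ((f ^^ m) p)) - \<alpha> + 2 * of_nat m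
        = (w_out q (\<phi> L) + of_nat m) - ((w_in q (\<phi> ((f ^^ m) p)) - of_nat m) + \<alpha>)" by simp
    ultimately have "norm ((w_out q (\<phi> L) + of_nat m) - ((w_in q (\<phi> ((f ^^ m) p)) - of_nat m) + \<alpha>)) \<le> B / real m"
      by (simp only: eq)
    then show ?thesis unfolding Leq using L(1) te(1) b1 b2 by blast
  qed
  have Q: "Q \<in> asymptotic_curve f z\<^sub>0" by (rule asymptotic_curveI[of M1 Q B]) (use backward in blast)
  obtain l where l: "(\<lambda>m. w_in q (\<phi> ((f ^^ m) p)) - of_nat m) \<longlonglongrightarrow> l"
    by (rule basin_incoming[OF p]) (auto simp: convergent_def that)
  then have fin: "fatou_in f \<phi> q p = l" unfolding fatou_in_def by (rule limI)
  have "(\<lambda>m. (w_out q (\<phi> ((inv f ^^ m) Q)) + of_nat m) - ((w_in q (\<phi> ((f ^^ m) p)) - of_nat m) + \<alpha>)) \<longlonglongrightarrow> 0"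
  proof (rule Lim_null_comparison)
    show "\<forall>\<^sub>F m in sequentially. norm ((w_out q (\<phi> ((inv f ^^ m) Q)) + of_nat m) - ((w_in q (\<phi> ((f ^^ m) p)) - of_nat m) + \<alpha>)) \<le> B / real m"
      using eventually_ge_at_top[of M1] by eventually_elim (use backward in blast)
    show "(\<lambda>m. B / real m) \<longlonglongrightarrow> 0" by real_asymp
  qed
  from tendsto_add[OF this tendsto_add[OF l tendsto_const[of \<alpha>]]]
  have "(\<lambda>m. w_out q (\<phi> ((inv f ^^ m) Q)) + of_nat m) \<longlonglongrightarrow> l + \<alpha>" by (simp add: add.commute)
  then have "fatou_out f \<phi> q Q = fatou_in f \<phi> q p + \<alpha>" unfolding fin fatou_out_def by (rule limI)
  then have "lavaurs_map f z\<^sub>0 \<phi> q \<alpha> p = Q"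
    unfolding lavaurs_map_def using inv_into_f_f[OF fatou_out_inj Q] by simp
  then show thesis using that[OF \<sigma>(2)] toQ by simp
qed

end

section \<open>Limits superior by subsequences, and the conclusion\<close>

lemma limsup_sets_iff_subseq:
  fixes X :: "nat \<Rightarrow> 'a::metric_space set"
  shows "z \<in> limsup_sets X \<longleftrightarrow> (\<exists>\<sigma> u. strict_mono \<sigma> \<and> (\<forall>i. u i \<in> X (\<sigma> i)) \<and> u \<longlonglongrightarrow> z)"
proof
  assume z: "z \<in> limsup_sets X"
  have inf: "infinite {j. ball z (inverse (real (Suc i))) \<inter> X j \<noteq> {}}" for i
    using z unfolding limsup_sets_def by simp
  have "\<exists>\<sigma>. \<forall>i. ball z (inverse (real (Suc i))) \<inter> X (\<sigma> i) \<noteq> {} \<and> \<sigma> i < \<sigma> (Suc i)"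
  proof (rule dependent_nat_choice)
    show "\<exists>j. ball z (inverse (real (Suc 0))) \<inter> X j \<noteq> {}"
      using infinite_imp_nonempty[OF inf[of 0]] by blast
    fix j i
    have "\<exists>j'>j. j' \<in> {j. ball z (inverse (real (Suc (Suc i)))) \<inter> X j \<noteq> {}}"
      using inf[of "Suc i"] unfolding infinite_nat_iff_unbounded by blast
    then show "\<exists>j'. ball z (inverse (real (Suc (Suc i)))) \<inter> X j' \<noteq> {} \<and> j < j'" by blast
  qed
  then obtain \<sigma> where \<sigma>: "\<And>i. ball z (inverse (real (Suc i))) \<inter> X (\<sigma> i) \<noteq> {}" "\<And>i. \<sigma> i < \<sigma> (Suc i)" by blast
  then have "\<forall>i. \<exists>w. w \<in> ball z (inverse (real (Suc i))) \<and> w \<in> X (\<sigma> i)" by blast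
  then obtain u where u: "\<forall>i. u i \<in> ball z (inverse (real (Suc i))) \<and> u i \<in> X (\<sigma> i)" unfolding choice_iff by blast
  have "u \<longlonglongrightarrow> z"
  proof (rule metric_tendsto_imp_tendsto[OF LIMSEQ_inverse_real_of_nat])
    show "\<forall>\<^sub>F i in sequentially. dist (u i) z \<le> dist (inverse (real (Suc i))) 0"
      using u by (intro always_eventually allI) (auto simp: dist_commute less_imp_le)
  qed
  moreover have "strict_mono \<sigma>" using \<sigma>(2) by (simp add: strict_mono_Suc_iff)
  ultimately show "\<exists>\<sigma> u. strict_mono \<sigma> \<and> (\<forall>i. u i \<in> X (\<sigma> i)) \<and> u \<longlonglongrightarrow> z" using u by blast
next
  assume "\<exists>\<sigma> u. strict_mono \<sigma> \<and> (\<forall>i. u i \<in> X (\<sigma> i)) \<and> u \<longlonglongrightarrow> z"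
  then obtain \<sigma> u where u: "strict_mono \<sigma>" "\<And>i. u i \<in> X (\<sigma> i)" "u \<longlonglongrightarrow> z" by blast
  show "z \<in> limsup_sets X"
    unfolding limsup_sets_def
  proof (intro CollectI allI impI)
    fix V assume V: "open V \<and> z \<in> V"
    then obtain N where N: "\<And>i. N \<le> i \<Longrightarrow> u i \<in> V"
      using topological_tendstoD[OF u(3), of V] unfolding eventually_sequentially by blast
    have "\<sigma> ` {N..} \<subseteq> {j. V \<inter> X j \<noteq> {}}" using N u(2) by blast
    moreover have "infinite (\<sigma> ` {N..})"
      using finite_imageD[of \<sigma> "{N..}"] strict_mono_imp_inj_on[OF u(1)] infinite_Ici[of N] inj_on_subset by blast
    ultimately show "infinite {j. V \<inter> X j \<noteq> {}}" by (rule infinite_super)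
  qed
qed

lemma K_plus_funpow:
  assumes "p \<in> K_plus g"
  shows "(g ^^ n) p \<in> K_plus g"
proof -
  have "range (\<lambda>k. (g ^^ k) ((g ^^ n) p)) \<subseteq> range (\<lambda>k. (g ^^ k) p)"
    by (auto simp: funpow_add[unfolded o_def fun_eq_iff, rule_format, symmetric])
  then show ?thesis using assms unfolding K_plus_def by (auto intro: bounded_subset)
qed

text \<open>An orbit of T that starts in B \<inter> S stays in S until it leaves B, and at the first
  exit it is a point of K^+ outside B. For S = limsup this reduces the theorem to the inclusion of S
  in K^+ and the invariance of S under T.\<close>

lemma K_plus_TI:
  assumes "S \<subseteq> K_plus f" "\<And>p. p \<in> B \<inter> S \<Longrightarrow> T p \<in> S" "p \<in> B \<inter> S"
  shows "p \<in> K_plus_T f B T"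
proof -
  have stay: "(T ^^ n) p \<in> S" if "\<forall>k<n. (T ^^ k) p \<in> B" for n
    using that
  proof (induction n)
    case (Suc n)
    then show ?case using assms(2)[of "(T ^^ n) p"] by simp
  qed (use assms in simp)
  have "\<exists>n. (\<forall>k<n. (T ^^ k) p \<in> B) \<and> (T ^^ n) p \<in> K_plus f - B" if "\<not> (\<forall>n. (T ^^ n) p \<in> B)"
  proof -
    define n where "n = (LEAST n. (T ^^ n) p \<notin> B)"
    have "(T ^^ n) p \<notin> B" "\<forall>k<n. (T ^^ k) p \<in> B"
      using that LeastI_ex[of "\<lambda>n. (T ^^ n) p \<notin> B"] not_less_Least[of _ "\<lambda>n. (T ^^ n) p \<notin> B"]
      unfolding n_def by blast+
    then show ?thesis using stay[of n] assms(1) by blast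
  qed
  then show ?thesis using assms(1,3) unfolding K_plus_T_def by blast
qed

theorem theorem2:
  fixes F :: "complex \<Rightarrow> complex \<times> complex \<Rightarrow> complex \<times> complex"
    and D :: "complex set"
    and z\<^sub>0 :: "complex \<times> complex"
    and U :: "(complex \<times> complex) set"
    and \<Phi> :: "complex \<Rightarrow> complex \<times> complex \<Rightarrow> complex \<times> complex"
    and q r b \<alpha> :: complex
    and \<epsilon> :: "nat \<Rightarrow> complex"
  assumes "open D" and "0 \<in> D"
    and "\<And>e. e \<in> D \<Longrightarrow> polynomial_diffeo (F e)"
    and "holo_family_on F D UNIV"
    and "conj_to_henon_composition D F"
    and "F 0 z\<^sub>0 = z\<^sub>0"
    and "local_coordinates D U z\<^sub>0 \<Phi>"
    and "normalized_family D U \<Phi> F q r b"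
    and "0 < norm b" and "norm b < 1"
    and "alpha_sequence \<alpha> \<epsilon>"
  shows "parabolic_basin (F 0) z\<^sub>0 \<inter> limsup_sets (\<lambda>j. K_plus (F (\<epsilon> j)))
    \<subseteq> K_plus_T (F 0) (parabolic_basin (F 0) z\<^sub>0) (lavaurs_map (F 0) z\<^sub>0 (\<Phi> 0) q \<alpha>)"
proof -
  from assms(8)[unfolded normalized_family_def]
  obtain a \<beta> c where nf: "holo3_on a (SIGMA \<epsilon>:D. \<Phi> \<epsilon> ` U)" "holo3_on \<beta> (SIGMA \<epsilon>:D. \<Phi> \<epsilon> ` U)"
    "holo2_on c (SIGMA \<epsilon>:D. fst ` \<Phi> \<epsilon> ` U)"
    "(\<lambda>(\<epsilon>, x, y). a (\<epsilon>, x, y) - (1 + (q + 1) * x + r * y))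
          \<in> O[nhds (0, 0, 0)](\<lambda>(\<epsilon>, x, y). of_real ((norm x)\<^sup>2 + (norm y)\<^sup>2 + (norm \<epsilon>)\<^sup>2))"
    "c (0, 0) = b"
    "\<forall>\<epsilon>\<in>D. \<forall>p\<in>U. F \<epsilon> p \<in> U \<longrightarrow> (\<forall>x y. \<Phi> \<epsilon> p = (x, y) \<longrightarrow> \<Phi> \<epsilon> (F \<epsilon> p) =
        (x + (x\<^sup>2 + \<epsilon>\<^sup>2) * a (\<epsilon>, x, y), c (\<epsilon>, x) * y + (x\<^sup>2 + \<epsilon>\<^sup>2) * \<beta> (\<epsilon>, x, y)))"
    by (elim exE conjE) (rule that)
  interpret semi_parabolic_family F D z\<^sub>0 U \<Phi> q r b a \<beta> c
    by unfold_locales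
      (fact assms(1) assms(2) assms(3) assms(4) assms(6) assms(7) assms(10) nf(1) nf(2) nf(3) nf(4) nf(5)
        | (rule nf(6)[rule_format]; assumption))+
  let ?S = "limsup_sets (\<lambda>j. K_plus (F (\<epsilon> j)))"
  let ?T = "lavaurs_map (F 0) z\<^sub>0 (\<Phi> 0) q \<alpha>"
  obtain n where e: "\<And>j. \<epsilon> j \<noteq> 0" "\<epsilon> \<longlonglongrightarrow> 0" and n: "filterlim n at_top sequentially"
      "(\<lambda>j. of_nat (n j) - of_real pi / \<epsilon> j) \<longlonglongrightarrow> \<alpha>"
    using assms(11) unfolding alpha_sequence_def by blast
  have usc: "?S \<subseteq> K_plus (F 0)"
  proof
    fix z assume "z \<in> ?S"
    then obtain \<sigma> u where u: "strict_mono \<sigma>" "\<And>i. u i \<in> K_plus (F (\<epsilon> (\<sigma> i)))" "u \<longlonglongrightarrow> z"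
      unfolding limsup_sets_iff_subseq by blast
    have "(\<lambda>i. \<epsilon> (\<sigma> i)) \<longlonglongrightarrow> 0" using LIMSEQ_subseq_LIMSEQ[OF e(2) u(1)] by (simp add: o_def)
    then show "z \<in> K_plus (F 0)"
      by (rule K_plus_upper_semicontinuous[OF assms(5,1,2) F_continuous _ u(3,2)])
  qed
  have inv: "?T p \<in> ?S" if p: "p \<in> parabolic_basin (F 0) z\<^sub>0 \<inter> ?S" for p
  proof (rule tracking)
    fix K \<delta> C G \<rho>
    assume K: "compact K" "K \<subseteq> U" "z\<^sub>0 \<in> interior K" "0 < \<delta>" "0 \<le> C" "0 \<le> G" "0 \<le> \<rho>" "\<rho> < 1"
      and track: "\<And>e p. \<lbrakk>p \<in> K; norm e < \<delta>; norm (fst (\<Phi> e p)) < \<delta>; norm (snd (\<Phi> e p)) < \<delta>\<rbrakk> \<Longrightarrow> F e p \<in> K \<and>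
       fst (\<Phi> e (F e p)) = fst (\<Phi> e p) + ((fst (\<Phi> e p))\<^sup>2 + e\<^sup>2) * a (e, \<Phi> e p) \<and>
       snd (\<Phi> e (F e p)) = c (e, fst (\<Phi> e p)) * snd (\<Phi> e p) + ((fst (\<Phi> e p))\<^sup>2 + e\<^sup>2) * \<beta> (e, \<Phi> e p)"
      and bounds: "\<And>e x y. norm e < \<delta> \<Longrightarrow> norm x < \<delta> \<Longrightarrow> norm y < \<delta> \<Longrightarrow>
       e \<in> D \<and> norm (a (e, x, y) - (1 + (q + 1) * x + r * y)) \<le> C * ((norm x)\<^sup>2 + (norm y)\<^sup>2 + (norm e)\<^sup>2) \<and>
       norm (c (e, x)) \<le> \<rho> \<and> norm (\<beta> (e, x, y)) \<le> G \<and> norm (a (e, x, y)) \<le> G"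
    interpret tracked_semi_parabolic_family F D z\<^sub>0 U \<Phi> q r b a \<beta> c K \<delta> C G \<rho>
      by unfold_locales (fact K track bounds)+
    from p have "p \<in> ?S" by (rule IntD2)
    then obtain \<sigma> u where u: "strict_mono \<sigma>" "\<And>i. u i \<in> K_plus (F (\<epsilon> (\<sigma> i)))" "u \<longlonglongrightarrow> p"
      unfolding limsup_sets_iff_subseq by blast
    have es: "(\<lambda>i. \<epsilon> (\<sigma> i)) \<longlonglongrightarrow> 0" "(\<lambda>i. of_nat (n (\<sigma> i)) - of_real pi / \<epsilon> (\<sigma> i)) \<longlonglongrightarrow> \<alpha>"
      using LIMSEQ_subseq_LIMSEQ[OF e(2) u(1)] LIMSEQ_subseq_LIMSEQ[OF n(2) u(1)] by (simp_all add: o_def)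
    have ns: "filterlim (\<lambda>i. n (\<sigma> i)) at_top sequentially"
      by (rule filterlim_compose[OF n(1) filterlim_subseq[OF u(1)]])
    have pB: "p \<in> parabolic_basin (F 0) z\<^sub>0" using p by blast
    obtain \<tau> where t: "strict_mono \<tau>"
      "(\<lambda>i. (F (\<epsilon> (\<sigma> (\<tau> i))) ^^ n (\<sigma> (\<tau> i))) (u (\<tau> i))) \<longlonglongrightarrow> ?T p"
      by (rule parabolic_implosion[OF pB es(1) e(1) ns es(2) u(3)])
    \<comment> \<open>The subsequence from the implosion refines the one that realizes p as a limit;
      the iterates stay in K^+ of the same map, so their limit lies in the limsup again.\<close>
    have "strict_mono (\<lambda>i. \<sigma> (\<tau> i))" using u(1) t(1) by (simp add: strict_mono_def)
    moreover have "(F (\<epsilon> (\<sigma> (\<tau> i))) ^^ n (\<sigma> (\<tau> i))) (u (\<tau> i)) \<in> K_plus (F (\<epsilon> (\<sigma> (\<tau> i))))" for i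
      by (rule K_plus_funpow[OF u(2)])
    ultimately show "?T p \<in> ?S"
      unfolding limsup_sets_iff_subseq using t(2)
      by (intro exI[of _ "\<lambda>i. \<sigma> (\<tau> i)"] exI[of _ "\<lambda>i. (F (\<epsilon> (\<sigma> (\<tau> i))) ^^ n (\<sigma> (\<tau> i))) (u (\<tau> i))"] conjI allI)
  qed
  show ?thesis by (rule subsetI) (rule K_plus_TI[OF usc inv])
qed

end
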